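(* Let $Z_0=\{(z,w)\in\mathbb{C}^2 : |z|^2+|w|^2=1\}$ be the unit sphere. Then $Z_0$ is a saddle point for the isoperimetric quotient $\mathcal{Q}$.
   Context: Hypersurfaces are smooth real hypersurfaces. For a strongly pseudoconvex hypersurface $Z\subset\mathbb{C}^2$ with defining function $\rho$, Fefferman's measure is $\mathcal{F}(Z)=\int_Z\sigma_Z$, where $\sigma_Z$ is the positive $3$-form on $Z$ uniquely determined by $$\sigma_Z\wedge d\rho = 2^{4/3} M(\rho)^{1/3}\,\omega_{\mathbb{C}^2},\qquad M(\rho)=-\det\begin{pmatrix}0&\rho_{z_j}\\ \rho_{\bar z_k}&\rho_{z_j\bar z_k}\end{pmatrix}_{1\le j,k\le 2},$$ with $\omega_{\mathbb{C}^2}$ the euclidean volume form and subscripts denoting differentiation; $\sigma_Z$ does not depend on the choice of $\rho$. If $Z$ is the compact boundary of a bounded domain, $\mathcal{V}(Z)$ denotes the euclidean volume enclosed by $Z$, and the isoperimetric quotient is $\mathcal{Q}(Z)=\mathcal{F}(Z)^{3/2}/\mathcal{V}(Z)$. Perturbations of $Z_0$ are considered in the form $Z_\varepsilon=\{(z,w): e^{\varepsilon \mathring{G}(z,w)}(|z|^2+|w|^2)=1\}$, where $\mathring{G}$ is a smooth real-valued function on $\mathbb{C}^2\setminus\{0\}$ that is constant along rays from the origin (so it is determined by its values on $Z_0$), and $\varepsilon$ is a small real parameter. "$Z_0$ is a saddle point for $\mathcal{Q}$" means: $Z_0$ is a critical point, i.e. $\frac{d}{d\varepsilon}\mathcal{Q}(Z_\varepsilon)|_{\varepsilon=0}=0$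 for every such $\mathring{G}$, and the second variation takes both signs, i.e. there are choices of $\mathring{G}$ for which $\frac{d^2}{d\varepsilon^2}\mathcal{Q}(Z_\varepsilon)|_{\varepsilon=0}>0$ and choices of $\mathring{G}$ for which $\frac{d^2}{d\varepsilon^2}\mathcal{Q}(Z_\varepsilon)|_{\varepsilon=0}<0$. *)

theory Defs
  imports "HOL-Analysis.Analysis"
begin

type_synonym C2 = "complex \<times> complex"

primrec Ck_on :: "nat \<Rightarrow> 'a::euclidean_space set \<Rightarrow> ('a \<Rightarrow> 'b::real_normed_vector) \<Rightarrow> bool" where
  "Ck_on 0 S f \<longleftrightarrow> continuous_on S f"
| "Ck_on (Suc k) S f \<longleftrightarrow>
     (\<forall>x\<in>S. f differentiable (at x)) \<and>
     (\<forall>v. Ck_on k S (\<lambda>x. frechet_derivative f (at x) v))"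

definition smooth_on :: "'a::euclidean_space set \<Rightarrow> ('a \<Rightarrow> 'b::real_normed_vector) \<Rightarrow> bool" where
  "smooth_on S f \<longleftrightarrow> open S \<and> (\<forall>k. Ck_on k S f)"

text \<open>\<open>d_hol e f\<close> and \<open>d_antihol e f\<close> are the derivatives \<open>\<partial>/\<partial>z\<^sub>j\<close> and \<open>\<partial>/\<partial>\<bar>z\<^sub>j\<close>,
  where \<open>e\<close> is the coordinate vector of the complex variable \<open>z\<^sub>j\<close>.\<close>

definition mult_i :: "C2 \<Rightarrow> C2" where
  "mult_i v = (\<i> * fst v, \<i> * snd v)"

definition d_hol :: "C2 \<Rightarrow> (C2 \<Rightarrow> complex) \<Rightarrow> C2 \<Rightarrow> complex" where
  "d_hol e f p = (frechet_derivative f (at p) e - \<i> * frechet_derivative f (at p) (mult_i e)) / 2"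

definition d_antihol :: "C2 \<Rightarrow> (C2 \<Rightarrow> complex) \<Rightarrow> C2 \<Rightarrow> complex" where
  "d_antihol e f p = (frechet_derivative f (at p) e + \<i> * frechet_derivative f (at p) (mult_i e)) / 2"

definition e1 :: C2 where "e1 = (1, 0)"
definition e2 :: C2 where "e2 = (0, 1)"

text \<open>\<open>levi \<rho> p v\<close> is \<open>\<Sum>\<^sub>j\<^sub>k \<rho>\<^bsub>z\<^sub>j \<bar>z\<^sub>k\<^esub> v\<^sub>j \<bar>v\<^sub>k\<close>; this Hermitian form is real-valued
  when \<open>\<rho>\<close> is of class \<open>C\<^sup>2\<close>, so taking the real part discards nothing.\<close>

definition levi :: "(C2 \<Rightarrow> real) \<Rightarrow> C2 \<Rightarrow> C2 \<Rightarrow> real" where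
  "levi \<rho> p v = (let r = (\<lambda>q. complex_of_real (\<rho> q)); (a, b) = v in
     Re (d_antihol e1 (d_hol e1 r) p * a * cnj a + d_antihol e2 (d_hol e1 r) p * a * cnj b
       + d_antihol e1 (d_hol e2 r) p * b * cnj a + d_antihol e2 (d_hol e2 r) p * b * cnj b))"

definition defining_function :: "C2 set \<Rightarrow> (C2 \<Rightarrow> real) \<Rightarrow> bool" where
  "defining_function Z \<rho> \<longleftrightarrow>
     (\<exists>N. smooth_on N \<rho> \<and> Z = {p \<in> N. \<rho> p = 0}) \<and>
     (\<forall>p\<in>Z. \<exists>v. frechet_derivative \<rho> (at p) v \<noteq> 0)"

text \<open>Positivity of the Levi form on the complex tangent spaces also fixes the sign of \<open>\<rho>\<close>.\<close>

definition spc_defining_function :: "C2 set \<Rightarrow> (C2 \<Rightarrow> real) \<Rightarrow> bool" where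
  "spc_defining_function Z \<rho> \<longleftrightarrow> defining_function Z \<rho> \<and>
     (\<forall>p\<in>Z. \<forall>a b. (a, b) \<noteq> (0, 0) \<longrightarrow>
        d_hol e1 (\<lambda>q. complex_of_real (\<rho> q)) p * a
          + d_hol e2 (\<lambda>q. complex_of_real (\<rho> q)) p * b = 0 \<longrightarrow>
        levi \<rho> p (a, b) > 0)"

text \<open>The matrix is Hermitian, so its determinant is real.\<close>

definition fefferman_M :: "(C2 \<Rightarrow> real) \<Rightarrow> C2 \<Rightarrow> real" where
  "fefferman_M \<rho> p = (let r = (\<lambda>q. complex_of_real (\<rho> q)) in
     - Re (det (vector
        [vector [0, d_hol e1 r p, d_hol e2 r p],
         vector [d_antihol e1 r p, d_antihol e1 (d_hol e1 r) p, d_antihol e1 (d_hol e2 r) p],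
         vector [d_antihol e2 r p, d_antihol e2 (d_hol e1 r) p, d_antihol e2 (d_hol e2 r) p]]
        :: complex ^ 3 ^ 3)))"

definition real_coords :: "C2 \<Rightarrow> real ^ 4" where
  "real_coords v = vector [Re (fst v), Im (fst v), Re (snd v), Im (snd v)]"

definition euclidean_volume_form :: "C2 \<Rightarrow> C2 \<Rightarrow> C2 \<Rightarrow> C2 \<Rightarrow> real" where
  "euclidean_volume_form v1 v2 v3 v4 =
     det (vector [real_coords v1, real_coords v2, real_coords v3, real_coords v4] :: real ^ 4 ^ 4)"

definition alternating3 :: "(C2 \<Rightarrow> C2 \<Rightarrow> C2 \<Rightarrow> real) \<Rightarrow> bool" where
  "alternating3 \<sigma> \<longleftrightarrow>
     (\<forall>u v. linear (\<lambda>x. \<sigma> x u v) \<and> linear (\<lambda>x. \<sigma> u x v) \<and> linear (\<lambda>x. \<sigma> u v x)) \<and>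
     (\<forall>u v. \<sigma> u u v = 0 \<and> \<sigma> u v v = 0 \<and> \<sigma> u v u = 0)"

definition wedge31 :: "(C2 \<Rightarrow> C2 \<Rightarrow> C2 \<Rightarrow> real) \<Rightarrow> (C2 \<Rightarrow> real) \<Rightarrow> C2 \<Rightarrow> C2 \<Rightarrow> C2 \<Rightarrow> C2 \<Rightarrow> real" where
  "wedge31 \<sigma> \<alpha> v1 v2 v3 v4 =
     \<sigma> v1 v2 v3 * \<alpha> v4 - \<sigma> v1 v2 v4 * \<alpha> v3 + \<sigma> v1 v3 v4 * \<alpha> v2 - \<sigma> v2 v3 v4 * \<alpha> v1"

text \<open>A 3-form on \<open>Z\<close> is represented by an alternating 3-form on the ambient space at each point
  of \<open>Z\<close>. The equation below determines it only up to multiples of \<open>d\<rho>\<close>, i.e. exactly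
  determines its restriction to the tangent spaces of \<open>Z\<close>, and only that restriction is used
  later on.\<close>

definition fefferman_form :: "C2 set \<Rightarrow> (C2 \<Rightarrow> real) \<Rightarrow> (C2 \<Rightarrow> C2 \<Rightarrow> C2 \<Rightarrow> C2 \<Rightarrow> real) \<Rightarrow> bool" where
  "fefferman_form Z \<rho> \<sigma> \<longleftrightarrow> (\<forall>p\<in>Z. alternating3 (\<sigma> p) \<and>
     (\<forall>v1 v2 v3 v4.
        wedge31 (\<sigma> p) (frechet_derivative \<rho> (at p)) v1 v2 v3 v4
        = 2 powr (4/3) * root 3 (fefferman_M \<rho> p) * euclidean_volume_form v1 v2 v3 v4))"

definition pullback_density ::
  "(C2 \<Rightarrow> C2 \<Rightarrow> C2 \<Rightarrow> C2 \<Rightarrow> real) \<Rightarrow> (real ^ 3 \<Rightarrow> C2) \<Rightarrow> real ^ 3 \<Rightarrow> real" where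
  "pullback_density \<sigma> \<phi> u = \<sigma> (\<phi> u)
     (frechet_derivative \<phi> (at u) (axis 1 1))
     (frechet_derivative \<phi> (at u) (axis 2 1))
     (frechet_derivative \<phi> (at u) (axis 3 1))"

text \<open>\<open>Z\<close> carries the orientation for which \<open>\<sigma>\<close> is positive; the last condition says
  that \<open>\<phi>\<close> is an immersion compatible with this orientation.\<close>

definition positive_parametrization ::
  "C2 set \<Rightarrow> (C2 \<Rightarrow> C2 \<Rightarrow> C2 \<Rightarrow> C2 \<Rightarrow> real) \<Rightarrow> (real ^ 3) set \<Rightarrow> (real ^ 3 \<Rightarrow> C2) \<Rightarrow> bool" where
  "positive_parametrization Z \<sigma> U \<phi> \<longleftrightarrow>
     smooth_on U \<phi> \<and> inj_on \<phi> U \<and> \<phi> ` U \<subseteq> Z \<and> (\<forall>u\<in>U. pullback_density \<sigma> \<phi> u > 0)"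

text \<open>\<open>\<mu>\<close> is the measure \<open>B \<mapsto> \<integral>\<^bsub>B\<^esub> \<sigma>\<close> on \<open>Z\<close> given by integrating the positive 3-form \<open>\<sigma>\<close>:
  in local coordinates, integration of \<open>\<sigma>\<close> is integration of its pullback. As \<open>Z\<close> is covered
  by countably many parametrized pieces, this determines \<open>\<mu>\<close>.\<close>

definition integration_measure :: "C2 set \<Rightarrow> (C2 \<Rightarrow> C2 \<Rightarrow> C2 \<Rightarrow> C2 \<Rightarrow> real) \<Rightarrow> C2 measure \<Rightarrow> bool" where
  "integration_measure Z \<sigma> \<mu> \<longleftrightarrow>
     sets \<mu> = sets borel \<and> emeasure \<mu> (- Z) = 0 \<and>
     (\<forall>U \<phi> B. positive_parametrization Z \<sigma> U \<phi> \<longrightarrow> B \<in> sets borel \<longrightarrow> B \<subseteq> \<phi> ` U \<longrightarrow>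
        emeasure \<mu> B
        = (\<integral>\<^sup>+ u \<in> {u \<in> U. \<phi> u \<in> B}. ennreal (pullback_density \<sigma> \<phi> u) \<partial>lborel))"

definition fefferman_area :: "C2 set \<Rightarrow> real" where
  "fefferman_area Z = (THE m. \<exists>\<rho> \<sigma> \<mu>. spc_defining_function Z \<rho> \<and> fefferman_form Z \<rho> \<sigma> \<and>
     integration_measure Z \<sigma> \<mu> \<and> m = measure \<mu> Z)"

text \<open>If \<open>Z\<close> is connected and is the frontier of a bounded domain, as compact strongly
  pseudoconvex boundaries are, then \<open>inside Z\<close> is that domain.\<close>

definition enclosed_volume :: "C2 set \<Rightarrow> real" where
  "enclosed_volume Z = measure lebesgue (inside Z)"

definition iso_quotient :: "C2 set \<Rightarrow> real" where
  "iso_quotient Z = fefferman_area Z powr (3/2) / enclosed_volume Z"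

definition radial_direction :: "(C2 \<Rightarrow> real) \<Rightarrow> bool" where
  "radial_direction G \<longleftrightarrow> smooth_on (- {0}) G \<and> (\<forall>p t. p \<noteq> 0 \<longrightarrow> t > 0 \<longrightarrow> G (t *\<^sub>R p) = G p)"

definition perturbed_sphere :: "(C2 \<Rightarrow> real) \<Rightarrow> real \<Rightarrow> C2 set" where
  "perturbed_sphere G \<epsilon> =
     {(z, w). exp (\<epsilon> * G (z, w)) * ((cmod z)\<^sup>2 + (cmod w)\<^sup>2) = 1}"

definition has_second_derivative :: "(real \<Rightarrow> real) \<Rightarrow> real \<Rightarrow> real \<Rightarrow> bool" where
  "has_second_derivative f D x \<longleftrightarrow>
     (\<exists>f'. (\<forall>\<^sub>F y in nhds x. (f has_real_derivative f' y) (at y)) \<and>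
           (f' has_real_derivative D) (at x))"

text \<open>Every \<open>perturbed_sphere G 0\<close> is the unit sphere.\<close>

definition unit_sphere_saddle_point :: "(C2 set \<Rightarrow> real) \<Rightarrow> bool" where
  "unit_sphere_saddle_point Q \<longleftrightarrow>
     (\<forall>G. radial_direction G \<longrightarrow>
        ((\<lambda>\<epsilon>. Q (perturbed_sphere G \<epsilon>)) has_real_derivative 0) (at 0)) \<and>
     (\<exists>G D. radial_direction G \<and> D > 0 \<and>
        has_second_derivative (\<lambda>\<epsilon>. Q (perturbed_sphere G \<epsilon>)) D 0) \<and>
     (\<exists>G D. radial_direction G \<and> D < 0 \<and>
        has_second_derivative (\<lambda>\<epsilon>. Q (perturbed_sphere G \<epsilon>)) D 0)"

end

theory Submission
  imports Defs
begin

text \<open>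
Put \<open>H = \<epsilon> G\<close>. The function \<open>\<rho> = ln |x|\<^sup>2 + H\<close> defines the perturbed sphere, and \<open>d\<rho>\<close> takes the
value 2 on the radial vector \<open>x\<close>, because \<open>H\<close> is constant along rays. The quaternion units give an
orthogonal frame \<open>x, ix, jx, kx\<close> in which \<open>|x|\<^sup>4 M(\<rho>)\<close> becomes a cubic polynomial
\<open>1 + ma_lin H + ma_quad H + ma_cub H\<close> in the derivatives of \<open>H\<close> along the three rotation fields
(\<open>fefferman_M_log_rho\<close>).

\<^bold>\<open>Area and volume as integrals over the unit ball \<open>B\<close>.\<close> Contracting \<open>\<sigma> \<and> d\<rho>\<close> with the radial vector
expresses \<open>\<sigma>\<close> on tangent vectors by the euclidean volume of the cone over them. So the area of a patch
is the integral over the cone on that patch of a function that is constant along rays. In this way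
the area becomes \<open>2\<^sup>7\<^sup>/\<^sup>3\<close> times the integral over \<open>B\<close> of \<open>exp (-4/3 H)\<close> times the cube root of
\<open>|x|\<^sup>4 M(\<rho>)\<close> (\<open>fefferman_area_eq\<close>), and the volume is the integral over \<open>B\<close> of \<open>exp (-2 H)\<close>
(\<open>enclosed_volume_eq\<close>). For the first formula the push-forward of the weighted
ball is shown to integrate \<open>\<sigma>\<close> in every parametrization, by a change of variables. It is the only
such measure, since eight central projections cover the hypersurface. The choice of defining
function \<open>f\<close> is immaterial because \<open>f\<close> composed with the radial projection vanishes identically;
differentiating this identity twice gives the gradient of \<open>f\<close> and its Hessian on the tangent space as
the same multiple of those of \<open>\<rho>\<close>.

\<^bold>\<open>First variation.\<close> Rotations preserve \<open>B\<close>, so the derivative of a radial function along a rotation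
field has integral 0 (\<open>integral_lie_eq_0\<close>). The part \<open>ma_lin\<close> is a quarter of the sum of the second
derivatives along the fields \<open>jx\<close> and \<open>kx\<close>, so it integrates to 0. At \<open>\<epsilon> = 0\<close> the logarithmic
derivatives of the area and the volume are therefore \<open>-4/3\<close> and \<open>-2\<close> times the mean of \<open>G\<close>, and they
cancel in the quotient because the area enters with the exponent \<open>3/2\<close>.

\<^bold>\<open>Second variation.\<close> If \<open>G\<close> has mean 0, the second derivative is a positive multiple of the integral of
\<open>-4/3 G\<^sup>2 - 4/3 G m\<^sub>1 - 1/3 m\<^sub>1\<^sup>2 + m\<^sub>2\<close> with \<open>m\<^sub>1 = ma_lin G\<close> and \<open>m\<^sub>2 = ma_quad G\<close>.
On \<open>G = Re (z\<^sup>2 w\<^sup>*\<^sup>2) / |x|\<^sup>4\<close>, where \<open>w\<^sup>*\<close> is the conjugate of \<open>w\<close>, one finds \<open>m\<^sub>1 = -6 G\<close> and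
\<open>m\<^sub>2 = 0\<close>, which leaves \<open>-16/3\<close> times the integral of \<open>G\<^sup>2\<close>. On
\<open>G = Re z\<^sup>2 / |x|\<^sup>2\<close> one finds \<open>m\<^sub>1 = -G\<close>, and \<open>m\<^sub>2\<close> is at least a quarter of the squared derivative of \<open>G\<close>
along \<open>ix\<close>, whose integral is that of \<open>G\<^sup>2\<close>; this leaves at least \<open>2/3\<close> of the integral of \<open>G\<^sup>2\<close>.
\<close>

section \<open>Calculus of smooth functions\<close>

abbreviation DD :: "('a::real_normed_vector \<Rightarrow> 'b::real_normed_vector) \<Rightarrow> 'a \<Rightarrow> 'a \<Rightarrow> 'b" where
  "DD f x \<equiv> frechet_derivative f (at x)"

lemma DD_eqI: "(f has_derivative f') (at x) \<Longrightarrow> DD f x = f'"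
  by (metis frechet_derivative_at)

lemma has_derivative_DD: "f differentiable (at x) \<Longrightarrow> (f has_derivative DD f x) (at x)"
  by (simp add: frechet_derivative_works)

lemma Ck_on_cong:
  assumes "open S" "\<And>x. x \<in> S \<Longrightarrow> f x = g x"
  shows "Ck_on k S f \<longleftrightarrow> Ck_on k S g"
  using assms(2)
proof (induction k arbitrary: f g)
  case 0
  then show ?case by (auto cong: continuous_on_cong)
next
  case (Suc k)
  have diff: "f differentiable (at x) \<longleftrightarrow> g differentiable (at x)" if "x \<in> S" for x
    using Suc.prems that assms(1)
    unfolding differentiable_def
    using has_derivative_transform_within_open[OF _ assms(1) that, of f _ UNIV g]
      has_derivative_transform_within_open[OF _ assms(1) that, of g _ UNIV f] Suc.prems by metis
  show ?case
  proof (cases "\<forall>x\<in>S. f differentiable (at x)")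
    case True
    have "DD f x = DD g x" if "x \<in> S" for x
      using True Suc.prems assms(1) that by (intro frechet_derivative_transform_within_open) auto
    then have "Ck_on k S (\<lambda>x. DD f x v) \<longleftrightarrow> Ck_on k S (\<lambda>x. DD g x v)" for v
      by (intro Suc.IH) simp
    then show ?thesis using diff by simp
  next
    case False
    then show ?thesis using diff unfolding Ck_on.simps by blast
  qed
qed

lemma Ck_on_continuous:
  assumes "Ck_on k S f"
  shows "continuous_on S f"
proof (cases k)
  case 0
  then show ?thesis using assms by simp
next
  case (Suc n)
  then have "\<forall>x\<in>S. isCont f x" using assms
    by (auto intro: differentiable_imp_continuous_within)
  then show ?thesis by (simp add: continuous_at_imp_continuous_on)
qed

lemma Ck_on_Suc_imp: "Ck_on (Suc k) S f \<Longrightarrow> Ck_on k S f"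
proof (induction k arbitrary: f)
  case 0
  from Ck_on_continuous[OF this] show ?case by simp
next
  case (Suc k)
  then show ?case unfolding Ck_on.simps(2)[of "Suc k"] Ck_on.simps(2)[of k S f] by blast
qed

lemma Ck_on_const: "Ck_on k S (\<lambda>x. c)"
  by (induction k arbitrary: c) (auto simp: )

lemma Ck_on_subset: "Ck_on k S f \<Longrightarrow> T \<subseteq> S \<Longrightarrow> Ck_on k T f"
  by (induction k arbitrary: f) (auto intro: continuous_on_subset)

lemma Ck_on_bounded_linear_compose:
  assumes "open S" "bounded_linear h" "Ck_on k S f"
  shows "Ck_on k S (\<lambda>x. h (f x))"
  using assms(3)
proof (induction k arbitrary: f)
  case 0
  then show ?case using assms(2)
    by (auto intro: bounded_linear.continuous_on)
next
  case (Suc k)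
  have d: "((\<lambda>x. h (f x)) has_derivative (\<lambda>v. h (DD f x v))) (at x)" if "x \<in> S" for x
    using Suc.prems that
    by (intro bounded_linear.has_derivative[OF assms(2)] has_derivative_DD) simp
  have "Ck_on k S (\<lambda>x. DD (\<lambda>x. h (f x)) x v)" for v
    using Suc.IH[of "\<lambda>x. DD f x v"] Suc.prems
    by (subst Ck_on_cong[OF assms(1), where g="\<lambda>x. h (DD f x v)"]) (simp_all add: DD_eqI[OF d])
  then show ?case using d unfolding Ck_on.simps differentiable_def by blast
qed

lemma Ck_on_add:
  assumes "open S" "Ck_on k S f" "Ck_on k S g"
  shows "Ck_on k S (\<lambda>x. f x + g x)"
  using assms(2,3)
proof (induction k arbitrary: f g)
  case 0
  then show ?case by (auto intro: continuous_on_add)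
next
  case (Suc k)
  have d: "((\<lambda>x. f x + g x) has_derivative (\<lambda>v. DD f x v + DD g x v)) (at x)" if "x \<in> S" for x
    using Suc.prems that by (auto intro!: has_derivative_add has_derivative_DD)
  have "Ck_on k S (\<lambda>x. DD (\<lambda>x. f x + g x) x v)" for v
    using Suc.IH[of "\<lambda>x. DD f x v" "\<lambda>x. DD g x v"] Suc.prems
    by (subst Ck_on_cong[OF assms(1), where g="\<lambda>x. DD f x v + DD g x v"]) (auto simp: DD_eqI[OF d])
  then show ?case using d by (auto simp: differentiable_def)
qed

lemma Ck_on_sum:
  assumes "open S" "finite I" "\<And>i. i \<in> I \<Longrightarrow> Ck_on k S (f i)"
  shows "Ck_on k S (\<lambda>x. \<Sum>i\<in>I. f i x)"
  using assms(2,3) by (induction I rule: finite_induct) (auto simp: Ck_on_const intro: Ck_on_add[OF assms(1)])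

lemma Ck_on_bounded_bilinear:
  assumes "open S" "bounded_bilinear bop" "Ck_on k S f" "Ck_on k S g"
  shows "Ck_on k S (\<lambda>x. bop (f x) (g x))"
  using assms(3,4)
proof (induction k arbitrary: f g)
  case 0
  then show ?case using assms(2) by (auto intro: bounded_bilinear.continuous_on)
next
  case (Suc k)
  have d: "((\<lambda>x. bop (f x) (g x)) has_derivative (\<lambda>v. bop (f x) (DD g x v) + bop (DD f x v) (g x))) (at x)"
    if "x \<in> S" for x
    using Suc.prems that
    by (auto intro!: bounded_bilinear.FDERIV[OF assms(2)] has_derivative_DD)
  have "Ck_on k S (\<lambda>x. DD (\<lambda>x. bop (f x) (g x)) x v)" for v
    using Suc.IH[of "\<lambda>x. f x" "\<lambda>x. DD g x v"] Suc.IH[of "\<lambda>x. DD f x v" "\<lambda>x. g x"] Suc.prems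
      Ck_on_Suc_imp[of k S f] Ck_on_Suc_imp[of k S g]
    by (subst Ck_on_cong[OF assms(1), where g="\<lambda>x. bop (f x) (DD g x v) + bop (DD f x v) (g x)"])
      (auto simp: DD_eqI[OF d] intro!: Ck_on_add[OF assms(1)])
  then show ?case using d by (auto simp: differentiable_def)
qed

lemma DD_in_Basis:
  fixes f :: "'a::euclidean_space \<Rightarrow> 'b::real_normed_vector"
  assumes "f differentiable (at x)"
  shows "DD f x v = (\<Sum>b\<in>Basis. (v \<bullet> b) *\<^sub>R DD f x b)"
proof -
  have "DD f x (\<Sum>b\<in>Basis. (v \<bullet> b) *\<^sub>R b) = (\<Sum>b\<in>Basis. (v \<bullet> b) *\<^sub>R DD f x b)"
    using linear_frechet_derivative[OF assms] by (simp add: linear_sum linear_scale)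
  then show ?thesis by (simp add: euclidean_representation)
qed

text \<open>The chain rule is expanded in an orthonormal basis, so that the induction hypothesis applies to each
directional derivative of \<open>g\<close> separately.\<close>

lemma Ck_on_compose:
  fixes f :: "'a::euclidean_space \<Rightarrow> 'b::euclidean_space" and g :: "'b \<Rightarrow> 'c::real_normed_vector"
  assumes "open S" "Ck_on k S f" "Ck_on k T g" "f ` S \<subseteq> T"
  shows "Ck_on k S (\<lambda>x. g (f x))"
  using assms(2,3)
proof (induction k arbitrary: g)
  case 0
  then show ?case using assms(4) by (auto intro: continuous_on_compose2)
next
  case (Suc k)
  have gd: "g differentiable (at (f x))" if "x \<in> S" for x
    using Suc.prems(2) assms(4) that by auto
  have d: "((\<lambda>x. g (f x)) has_derivative (\<lambda>v. DD g (f x) (DD f x v))) (at x)" if "x \<in> S" for x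
    using has_derivative_compose[of f "DD f x" x UNIV g "DD g (f x)"] has_derivative_DD[OF gd[OF that]]
      has_derivative_DD[of f x] Suc.prems(1) that by auto
  have "Ck_on k S (\<lambda>x. \<Sum>b\<in>Basis. (DD f x v \<bullet> b) *\<^sub>R DD g (f x) b)" for v
  proof (rule Ck_on_sum[OF assms(1) finite_Basis])
    fix b :: 'b
    have "Ck_on k S (\<lambda>x. DD f x v \<bullet> b)"
      using Suc.prems(1) by (intro Ck_on_bounded_linear_compose[OF assms(1) bounded_linear_inner_left]) simp
    moreover have "Ck_on k S (\<lambda>x. DD g (f x) b)"
      using Suc.prems Ck_on_Suc_imp[of k S f] by (intro Suc.IH) auto
    ultimately show "Ck_on k S (\<lambda>x. (DD f x v \<bullet> b) *\<^sub>R DD g (f x) b)"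
      by (rule Ck_on_bounded_bilinear[OF assms(1) bounded_bilinear_scaleR])
  qed
  then have "Ck_on k S (\<lambda>x. DD (\<lambda>x. g (f x)) x v)" for v
    by (subst Ck_on_cong[OF assms(1), where g="\<lambda>x. \<Sum>b\<in>Basis. (DD f x v \<bullet> b) *\<^sub>R DD g (f x) b"])
      (auto simp: DD_eqI[OF d] DD_in_Basis[OF gd])
  then show ?case using d by (auto simp: differentiable_def)
qed

lemma smooth_on_DD: "smooth_on S f \<Longrightarrow> smooth_on S (\<lambda>x. DD f x v)"
  unfolding smooth_on_def using Ck_on.simps(2) by blast

lemma smooth_on_differentiable: "smooth_on S f \<Longrightarrow> x \<in> S \<Longrightarrow> f differentiable (at x)"
  unfolding smooth_on_def using Ck_on.simps(2)[of 0 S f] by blast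

lemma smooth_on_has_derivative: "smooth_on S f \<Longrightarrow> x \<in> S \<Longrightarrow> (f has_derivative DD f x) (at x)"
  using smooth_on_differentiable has_derivative_DD by blast

lemma smooth_on_continuous: "smooth_on S f \<Longrightarrow> continuous_on S f"
  unfolding smooth_on_def using Ck_on_continuous by blast

lemma smooth_on_const: "open S \<Longrightarrow> smooth_on S (\<lambda>x. c)"
  by (simp add: smooth_on_def Ck_on_const)

lemma smooth_on_subset: "smooth_on S f \<Longrightarrow> open T \<Longrightarrow> T \<subseteq> S \<Longrightarrow> smooth_on T f"
  unfolding smooth_on_def using Ck_on_subset by blast

lemma smooth_on_cong: "open S \<Longrightarrow> (\<And>x. x \<in> S \<Longrightarrow> f x = g x) \<Longrightarrow> smooth_on S f \<longleftrightarrow> smooth_on S g"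
  unfolding smooth_on_def using Ck_on_cong by blast

lemma smooth_on_bounded_linear:
  assumes "open S" "bounded_linear f"
  shows "smooth_on S f"
proof -
  have "Ck_on k S f" for k
  proof (cases k)
    case 0
    then show ?thesis using assms(2) by (auto intro: linear_continuous_on)
  next
    case (Suc n)
    have "DD f x = f" for x
      by (rule DD_eqI[OF bounded_linear_imp_has_derivative[OF assms(2)]])
    then show ?thesis
      by (simp add: Suc bounded_linear_imp_differentiable assms(2) Ck_on_const)
  qed
  then show ?thesis by (simp add: smooth_on_def assms)
qed

lemma smooth_on_linear_compose: "bounded_linear h \<Longrightarrow> smooth_on S f \<Longrightarrow> smooth_on S (\<lambda>x. h (f x))"
  unfolding smooth_on_def using Ck_on_bounded_linear_compose by blast

lemma smooth_on_add: "smooth_on S f \<Longrightarrow> smooth_on S g \<Longrightarrow> smooth_on S (\<lambda>x. f x + g x)"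
  unfolding smooth_on_def using Ck_on_add by blast

lemma smooth_on_bilinear:
  "bounded_bilinear bop \<Longrightarrow> smooth_on S f \<Longrightarrow> smooth_on S g \<Longrightarrow> smooth_on S (\<lambda>x. bop (f x) (g x))"
  unfolding smooth_on_def using Ck_on_bounded_bilinear by blast

lemmas smooth_on_scaleR = smooth_on_bilinear[OF bounded_bilinear_scaleR]
lemmas smooth_on_mult = smooth_on_bilinear[OF bounded_bilinear_mult]
lemmas smooth_on_inner = smooth_on_bilinear[OF bounded_bilinear_inner]

lemma smooth_on_sum:
  "open S \<Longrightarrow> finite I \<Longrightarrow> (\<And>i. i \<in> I \<Longrightarrow> smooth_on S (f i)) \<Longrightarrow> smooth_on S (\<lambda>x. \<Sum>i\<in>I. f i x)"
  unfolding smooth_on_def using Ck_on_sum[of S I _ f] by blast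

lemma smooth_on_compose:
  fixes f :: "'a::euclidean_space \<Rightarrow> 'b::euclidean_space" and g :: "'b \<Rightarrow> 'c::real_normed_vector"
  shows "smooth_on S f \<Longrightarrow> smooth_on T g \<Longrightarrow> f ` S \<subseteq> T \<Longrightarrow> smooth_on S (\<lambda>x. g (f x))"
  unfolding smooth_on_def using Ck_on_compose[of S _ f T g] by blast

lemma smooth_on_power:
  fixes f :: "'a::euclidean_space \<Rightarrow> 'b::real_normed_algebra_1"
  assumes "smooth_on S f"
  shows "smooth_on S (\<lambda>x. f x ^ n)"
proof (induction n)
  case 0
  then show ?case using assms by (auto simp: smooth_on_def Ck_on_const)
next
  case (Suc n)
  then show ?case using smooth_on_mult[OF assms Suc] by simp
qed

lemma Ck_on_realI:
  fixes f :: "real \<Rightarrow> real"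
  assumes "open S" "\<And>x. x \<in> S \<Longrightarrow> (f has_real_derivative f' x) (at x)" "Ck_on k S f'"
  shows "Ck_on (Suc k) S f"
proof -
  have d: "(f has_derivative (\<lambda>v. f' x * v)) (at x)" if "x \<in> S" for x
    using assms(2)[OF that] by (simp add: has_field_derivative_def)
  have "Ck_on k S (\<lambda>x. f' x * v)" for v
    using Ck_on_bounded_linear_compose[OF assms(1) bounded_linear_mult_left assms(3)] .
  then have "Ck_on k S (\<lambda>x. DD f x v)" for v
    by (subst Ck_on_cong[OF assms(1), where g="\<lambda>x. f' x * v"]) (auto simp: DD_eqI[OF d])
  then show ?thesis using d by (auto simp: differentiable_def)
qed

lemma smooth_on_exp: "smooth_on UNIV (exp :: real \<Rightarrow> real)"
proof -
  have "Ck_on k UNIV (exp :: real \<Rightarrow> real)" for k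
  proof (induction k)
    case 0
    then show ?case by (simp add: continuous_on_exp)
  next
    case (Suc k)
    then show ?case by (intro Ck_on_realI[where f'=exp] DERIV_exp) auto
  qed
  then show ?thesis by (simp add: smooth_on_def)
qed

lemma Ck_on_inverse: "Ck_on k (- {0}) (inverse :: real \<Rightarrow> real)"
proof (induction k)
  case 0
  then show ?case by (auto intro!: continuous_intros)
next
  case (Suc k)
  have "Ck_on k (- {0}) (\<lambda>x::real. - (inverse x * inverse x))"
    by (rule Ck_on_bounded_linear_compose[OF _ bounded_linear_minus[OF bounded_linear_ident]
        Ck_on_bounded_bilinear[OF _ bounded_bilinear_mult Suc Suc]]) auto
  then show ?case
    by (intro Ck_on_realI[where f'="\<lambda>x. - (inverse x * inverse x)"])
      (auto intro!: derivative_eq_intros simp: power2_eq_square)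
qed

lemma smooth_on_inverse:
  assumes "smooth_on S f" "\<And>x. x \<in> S \<Longrightarrow> f x \<noteq> (0::real)"
  shows "smooth_on S (\<lambda>x. inverse (f x))"
proof -
  have "smooth_on (- {0}) (inverse :: real \<Rightarrow> real)"
    using Ck_on_inverse by (simp add: smooth_on_def open_Compl)
  then show ?thesis
    by (rule smooth_on_compose[OF assms(1)]) (use assms(2) in auto)
qed

lemma smooth_on_ln:
  assumes "smooth_on S f" "\<And>x. x \<in> S \<Longrightarrow> f x > (0::real)"
  shows "smooth_on S (\<lambda>x. ln (f x))"
proof -
  have "Ck_on (Suc k) {0<..} (ln :: real \<Rightarrow> real)" for k
  proof (rule Ck_on_realI[where f'=inverse])
    show "Ck_on k {0<..} (inverse :: real \<Rightarrow> real)"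
      by (rule Ck_on_subset[OF Ck_on_inverse]) auto
  qed (auto intro: DERIV_ln)
  then have "smooth_on {0<..} (ln :: real \<Rightarrow> real)"
    unfolding smooth_on_def by (simp only: open_greaterThan Ck_on_Suc_imp simp_thms)
  from smooth_on_compose[OF assms(1) this] assms(2) show ?thesis by auto
qed

lemma smooth_on_exp_compose: "smooth_on S f \<Longrightarrow> smooth_on S (\<lambda>x. exp (f x) :: real)"
  using smooth_on_compose[OF _ smooth_on_exp] by blast

text \<open>Rotation fields have a variable direction. Expanding it in a basis reduces to fixed directions.\<close>

lemma smooth_on_DD_along:
  fixes f :: "'a::euclidean_space \<Rightarrow> 'b::real_normed_vector"
  assumes "smooth_on S f" "smooth_on S a"
  shows "smooth_on S (\<lambda>x. DD f x (a x))"
proof -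
  have op: "open S" using assms by (simp add: smooth_on_def)
  have "smooth_on S (\<lambda>x. \<Sum>b\<in>Basis. (a x \<bullet> b) *\<^sub>R DD f x b)"
    by (rule smooth_on_sum[OF op finite_Basis], rule smooth_on_scaleR)
      (rule smooth_on_linear_compose[OF bounded_linear_inner_left assms(2)] smooth_on_DD[OF assms(1)])+
  then show ?thesis
    by (subst smooth_on_cong[OF op, where g="\<lambda>x. \<Sum>b\<in>Basis. (a x \<bullet> b) *\<^sub>R DD f x b"])
      (auto intro!: DD_in_Basis smooth_on_differentiable[OF assms(1)])
qed

definition D2 :: "('a::real_normed_vector \<Rightarrow> real) \<Rightarrow> 'a \<Rightarrow> 'a \<Rightarrow> 'a \<Rightarrow> real" where
  "D2 f p u v = DD (\<lambda>q. DD f q u) p v"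

lemma has_derivative_DD_along:
  fixes f :: "'a::euclidean_space \<Rightarrow> real"
  assumes f: "smooth_on S f" and x: "g x \<in> S"
    and g: "(g has_derivative g') (at x)" and a: "(a has_derivative a') (at x)"
  shows "((\<lambda>y. DD f (g y) (a y)) has_derivative (\<lambda>v. D2 f (g x) (a x) (g' v) + DD f (g x) (a' v))) (at x)"
proof -
  have op: "open S" using f by (simp add: smooth_on_def)
  have lin: "linear (DD f (g x))"
    by (rule linear_frechet_derivative[OF smooth_on_differentiable[OF f x]])
  have D2sum: "D2 f (g x) u w = (\<Sum>b\<in>Basis. (u \<bullet> b) * D2 f (g x) b w)" for u w
  proof -
    have "((\<lambda>q. \<Sum>b\<in>Basis. (u \<bullet> b) * DD f q b) has_derivative (\<lambda>w. \<Sum>b\<in>Basis. (u \<bullet> b) * D2 f (g x) b w)) (at (g x))"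
      unfolding D2_def
      by (intro has_derivative_sum has_derivative_mult_right smooth_on_has_derivative[OF smooth_on_DD[OF f] x])
    then have "((\<lambda>q. DD f q u) has_derivative (\<lambda>w. \<Sum>b\<in>Basis. (u \<bullet> b) * D2 f (g x) b w)) (at (g x))"
      by (rule has_derivative_transform_within_open[OF _ op x])
        (use DD_in_Basis[OF smooth_on_differentiable[OF f], of _ u] in auto)
    from DD_eqI[OF this] show ?thesis unfolding D2_def by simp
  qed
  have gx: "((\<lambda>y. DD f (g y) b) has_derivative (\<lambda>v. D2 f (g x) b (g' v))) (at x)" for b
    unfolding D2_def
    by (rule has_derivative_compose[OF g smooth_on_has_derivative[OF smooth_on_DD[OF f] x]])
  have *: "((\<lambda>y. \<Sum>b\<in>Basis. (a y \<bullet> b) * DD f (g y) b) has_derivative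
     (\<lambda>v. \<Sum>b\<in>Basis. (a x \<bullet> b) * D2 f (g x) b (g' v) + (a' v \<bullet> b) * DD f (g x) b)) (at x)"
    by (intro has_derivative_sum has_derivative_mult gx has_derivative_inner_left a)
  have eq: "(\<lambda>v. \<Sum>b\<in>Basis. (a x \<bullet> b) * D2 f (g x) b (g' v) + (a' v \<bullet> b) * DD f (g x) b)
      = (\<lambda>v. D2 f (g x) (a x) (g' v) + DD f (g x) (a' v))"
    by (auto simp: sum.distrib D2sum[of "a x"] DD_in_Basis[OF smooth_on_differentiable[OF f x], of "a' _"])
  obtain U where U: "open U" "x \<in> U" "g ` U \<subseteq> S" 
  proof -
    have "\<forall>\<^sub>F y in nhds x. g y \<in> S"
      using has_derivative_continuous[OF g] op x
      by (metis continuous_at topological_tendstoD tendsto_at_iff_tendsto_nhds)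
    then show ?thesis using that unfolding eventually_nhds by auto
  qed
  show ?thesis
    by (rule has_derivative_transform_within_open[OF *[unfolded eq] U(1,2)])
      (use U(3) DD_in_Basis[OF smooth_on_differentiable[OF f]] in \<open>auto simp: image_subset_iff\<close>)
qed

lemma D2_linear_right: 
  fixes f :: "'a::euclidean_space \<Rightarrow> real"
  assumes "smooth_on S f" "x \<in> S" shows "linear (D2 f x u)"
  unfolding D2_def by (rule linear_frechet_derivative[OF smooth_on_differentiable[OF smooth_on_DD]]) (rule assms)+

lemma has_real_derivative_along_line:
  assumes "smooth_on S f" "q + s *\<^sub>R u \<in> S"
  shows "((\<lambda>s. f (q + s *\<^sub>R u)) has_real_derivative DD f (q + s *\<^sub>R u) u) (at s)"
proof -
  have lin: "linear (DD f (q + s *\<^sub>R u))"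
    by (rule linear_frechet_derivative[OF smooth_on_differentiable[OF assms]])
  have "((\<lambda>s. q + s *\<^sub>R u) has_derivative (\<lambda>h. h *\<^sub>R u)) (at s)"
    by (auto intro!: derivative_eq_intros)
  from has_derivative_compose[OF this smooth_on_has_derivative[OF assms]]
  show ?thesis
    by (simp add: has_field_derivative_def linear_scale[OF lin] mult.commute[of _ "DD f (q + s *\<^sub>R u) u"])
qed

text \<open>The mean value theorem, applied first along \<open>u\<close> and then along \<open>v\<close>, turns the second difference into
a value of \<open>D2\<close> at a nearby point. As the second difference is symmetric in \<open>u\<close> and \<open>v\<close>, so is \<open>D2\<close>.\<close>

lemma second_difference_quotient:
  fixes f :: "'a::euclidean_space \<Rightarrow> real"
  assumes f: "smooth_on S f" and p: "p \<in> S" and e: "e > 0"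
  shows "\<exists>d>0. \<forall>t. 0 < t \<and> t < d \<longrightarrow>
    \<bar>(f (p + t *\<^sub>R u + t *\<^sub>R v) - f (p + t *\<^sub>R u) - f (p + t *\<^sub>R v) + f p) / t\<^sup>2 - D2 f p u v\<bar> < e"
proof -
  have op: "open S" using f by (simp add: smooth_on_def)
  have sD: "smooth_on S (\<lambda>q. DD f q u)" by (rule smooth_on_DD[OF f])
  have "continuous_on S (\<lambda>q. D2 f q u v)"
    unfolding D2_def by (rule smooth_on_continuous[OF smooth_on_DD[OF sD]])
  then have "isCont (\<lambda>q. D2 f q u v) p" using op p continuous_on_eq_continuous_at by blast
  then obtain r1 where r1: "r1 > 0" "\<And>q. dist q p < r1 \<Longrightarrow> dist (D2 f q u v) (D2 f p u v) < e"
    using e unfolding continuous_at_eps_delta by blast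
  obtain r2 where r2: "r2 > 0" "\<And>q. dist q p < r2 \<Longrightarrow> q \<in> S"
    using op p unfolding open_dist by blast
  define r where "r = min r1 r2"
  have r: "r > 0" "\<And>q. dist q p < r \<Longrightarrow> q \<in> S \<and> \<bar>D2 f q u v - D2 f p u v\<bar> < e"
    using r1 r2 by (auto simp: r_def dist_real_def)
  define d where "d = r / (norm u + norm v + 1)"
  have pos: "norm u + norm v + 1 > 0" by (simp add: add_nonneg_pos)
  have "d > 0" using r(1) pos by (simp add: d_def)
  moreover have "\<bar>(f (p + t *\<^sub>R u + t *\<^sub>R v) - f (p + t *\<^sub>R u) - f (p + t *\<^sub>R v) + f p) / t\<^sup>2 - D2 f p u v\<bar> < e"
    if t: "0 < t" "t < d" for t
  proof -
    have near: "dist (p + a *\<^sub>R u + b *\<^sub>R v) p < r" if "0 \<le> a" "a \<le> t" "0 \<le> b" "b \<le> t" for a b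
    proof -
      have "dist (p + a *\<^sub>R u + b *\<^sub>R v) p = norm (a *\<^sub>R u + b *\<^sub>R v)" by (simp add: dist_norm add.assoc)
      also have "\<dots> \<le> a * norm u + b * norm v"
        using norm_triangle_ineq[of "a *\<^sub>R u" "b *\<^sub>R v"] that by simp
      also have "\<dots> \<le> t * norm u + t * norm v"
        using that by (intro add_mono mult_right_mono) auto
      also have "\<dots> < t * (norm u + norm v + 1)" using t by (simp add: algebra_simps)
      also have "\<dots> < r" using t pos by (simp add: d_def pos_less_divide_eq)
      finally show ?thesis .
    qed
    have inS: "p + a *\<^sub>R u + b *\<^sub>R v \<in> S" if "0 \<le> a" "a \<le> t" "0 \<le> b" "b \<le> t" for a b
      using near[OF that] r(2) by blast
    define g where "g s = f (p + t *\<^sub>R v + s *\<^sub>R u) - f (p + s *\<^sub>R u)" for s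
    have dg: "(g has_real_derivative DD f (p + t *\<^sub>R v + s *\<^sub>R u) u - DD f (p + s *\<^sub>R u) u) (at s)"
      if "0 \<le> s" "s \<le> t" for s
      unfolding g_def using inS[OF that, of t] inS[OF that, of 0] t
      by (intro DERIV_diff has_real_derivative_along_line[OF f]) (auto simp: add_ac)
    obtain a where a: "0 < a" "a < t"
      "g t - g 0 = (t - 0) * (DD f (p + t *\<^sub>R v + a *\<^sub>R u) u - DD f (p + a *\<^sub>R u) u)"
      using MVT2[OF t(1) dg] by blast
    have dh: "((\<lambda>s. DD f (p + a *\<^sub>R u + s *\<^sub>R v) u) has_real_derivative D2 f (p + a *\<^sub>R u + s *\<^sub>R v) u v) (at s)"
      if "0 \<le> s" "s \<le> t" for s
      unfolding D2_def using inS[of a s] that a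
      by (intro has_real_derivative_along_line[OF sD]) auto
    obtain b where b: "0 < b" "b < t"
      "DD f (p + a *\<^sub>R u + t *\<^sub>R v) u - DD f (p + a *\<^sub>R u + 0 *\<^sub>R v) u = (t - 0) * D2 f (p + a *\<^sub>R u + b *\<^sub>R v) u v"
      using MVT2[OF t(1) dh] by blast
    have "f (p + t *\<^sub>R u + t *\<^sub>R v) - f (p + t *\<^sub>R u) - f (p + t *\<^sub>R v) + f p = g t - g 0"
      by (simp add: g_def add_ac)
    also have "\<dots> = t\<^sup>2 * D2 f (p + a *\<^sub>R u + b *\<^sub>R v) u v"
      using a(3) b(3) by (simp add: power2_eq_square add_ac)
    finally have "(f (p + t *\<^sub>R u + t *\<^sub>R v) - f (p + t *\<^sub>R u) - f (p + t *\<^sub>R v) + f p) / t\<^sup>2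
        = D2 f (p + a *\<^sub>R u + b *\<^sub>R v) u v" using t by simp
    then show ?thesis using r(2)[OF near[of a b]] a b by simp
  qed
  ultimately show ?thesis by blast
qed

lemma D2_sym:
  fixes f :: "'a::euclidean_space \<Rightarrow> real"
  assumes f: "smooth_on S f" and p: "p \<in> S"
  shows "D2 f p u v = D2 f p v u"
proof (rule ccontr)
  assume ne: "D2 f p u v \<noteq> D2 f p v u"
  define e where "e = \<bar>D2 f p u v - D2 f p v u\<bar> / 2"
  have e: "e > 0" using ne by (simp add: e_def)
  obtain d1 where d1: "d1 > 0" "\<And>t. 0 < t \<and> t < d1 \<Longrightarrow>
    \<bar>(f (p + t *\<^sub>R u + t *\<^sub>R v) - f (p + t *\<^sub>R u) - f (p + t *\<^sub>R v) + f p) / t\<^sup>2 - D2 f p u v\<bar> < e"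
    using second_difference_quotient[OF f p e, of u v] by blast
  obtain d2 where d2: "d2 > 0" "\<And>t. 0 < t \<and> t < d2 \<Longrightarrow>
    \<bar>(f (p + t *\<^sub>R v + t *\<^sub>R u) - f (p + t *\<^sub>R v) - f (p + t *\<^sub>R u) + f p) / t\<^sup>2 - D2 f p v u\<bar> < e"
    using second_difference_quotient[OF f p e, of v u] by blast
  define t where "t = min d1 d2 / 2"
  have t: "0 < t" "t < d1" "t < d2" using d1(1) d2(1) by (auto simp: t_def)
  define F where "F = (f (p + t *\<^sub>R u + t *\<^sub>R v) - f (p + t *\<^sub>R u) - f (p + t *\<^sub>R v) + f p) / t\<^sup>2"
  have swap: "f (p + t *\<^sub>R v + t *\<^sub>R u) = f (p + t *\<^sub>R u + t *\<^sub>R v)" by (simp add: add_ac)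
  have F': "(f (p + t *\<^sub>R v + t *\<^sub>R u) - f (p + t *\<^sub>R v) - f (p + t *\<^sub>R u) + f p) / t\<^sup>2 = F"
    unfolding swap F_def by (simp add: algebra_simps)
  have "\<bar>F - D2 f p u v\<bar> < e"
    using d1(2)[of t] t unfolding F_def by blast
  moreover have "\<bar>F - D2 f p v u\<bar> < e"
    using d2(2)[of t] t unfolding F' by blast
  moreover have "\<bar>D2 f p u v - D2 f p v u\<bar> \<le> \<bar>F - D2 f p u v\<bar> + \<bar>F - D2 f p v u\<bar>"
    by linarith
  moreover have "\<bar>D2 f p u v - D2 f p v u\<bar> = 2 * e" by (simp add: e_def)
  ultimately show False by linarith
qed

lemma D2_linear_left:
  fixes f :: "'a::euclidean_space \<Rightarrow> real"
  assumes "smooth_on S f" "x \<in> S" shows "linear (\<lambda>u. D2 f x u v)"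
  using D2_linear_right[OF assms, of v] by (simp add: D2_sym[OF assms, of _ v])

section \<open>The Levi form and the Monge-Ampere determinant in real terms\<close>

lemma bounded_linear_mult_i: "bounded_linear mult_i"
  unfolding mult_i_def
  by (intro bounded_linear_Pair bounded_linear_const_mult bounded_linear_fst bounded_linear_snd)

lemma mult_i_mult_i [simp]: "mult_i (mult_i v) = - v"
  by (simp add: mult_i_def prod_eq_iff mult.assoc[symmetric])

lemma linear_C2_expand:
  assumes "linear L"
  shows "L (a, b) = Re a * L e1 + Im a * L (mult_i e1) + Re b * L e2 + (Im b * L (mult_i e2) :: real)"
proof -
  have "(a, b) = Re a *\<^sub>R e1 + Im a *\<^sub>R mult_i e1 + Re b *\<^sub>R e2 + Im b *\<^sub>R mult_i e2"
    by (simp add: e1_def e2_def mult_i_def complex_eq_iff)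
  then show ?thesis using assms by (simp add: linear_add linear_scale)
qed

lemma DD_of_real:
  assumes "f differentiable (at p)"
  shows "DD (\<lambda>q. complex_of_real (f q)) p = (\<lambda>v. complex_of_real (DD f p v))"
  by (intro DD_eqI has_derivative_of_real has_derivative_DD assms)

lemma d_hol_real:
  assumes "f differentiable (at p)"
  shows "d_hol e (\<lambda>q. complex_of_real (f q)) p = Complex (DD f p e / 2) (- DD f p (mult_i e) / 2)"
    and "d_antihol e (\<lambda>q. complex_of_real (f q)) p = Complex (DD f p e / 2) (DD f p (mult_i e) / 2)"
  by (simp_all add: d_hol_def d_antihol_def DD_of_real[OF assms] complex_eq_iff)

lemma d_antihol_d_hol_real:
  assumes "smooth_on S f" "p \<in> S"
  shows "d_antihol e' (d_hol e (\<lambda>q. complex_of_real (f q))) p =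
    Complex ((D2 f p e e' + D2 f p (mult_i e) (mult_i e')) / 4)
      ((D2 f p e (mult_i e') - D2 f p (mult_i e) e') / 4)"
proof -
  have op: "open S" using assms by (simp add: smooth_on_def)
  have "((\<lambda>q. (complex_of_real (DD f q e) - \<i> * complex_of_real (DD f q (mult_i e))) / 2) has_derivative
    (\<lambda>v. (complex_of_real (D2 f p e v) - \<i> * complex_of_real (D2 f p (mult_i e) v)) / 2)) (at p)"
    unfolding D2_def
    by (intro bounded_linear.has_derivative[OF bounded_linear_divide] has_derivative_diff
        has_derivative_mult_right has_derivative_of_real
        smooth_on_has_derivative[OF smooth_on_DD[OF assms(1)] assms(2)])
  then have "(d_hol e (\<lambda>q. complex_of_real (f q)) has_derivative
    (\<lambda>v. (complex_of_real (D2 f p e v) - \<i> * complex_of_real (D2 f p (mult_i e) v)) / 2)) (at p)"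
    by (rule has_derivative_transform_within_open[OF _ op assms(2)])
      (simp add: d_hol_def DD_of_real[OF smooth_on_differentiable[OF assms(1)]])
  from DD_eqI[OF this] show ?thesis
    by (simp add: d_antihol_def complex_eq_iff field_simps)
qed

text \<open>The Levi form is the part of the real Hessian that is invariant under multiplication by \<open>i\<close>, which the
sum over \<open>v\<close> and \<open>iv\<close> extracts; each of the two complex derivatives contributes a factor 1/2.\<close>

lemma levi_eq_D2:
  assumes f: "smooth_on S f" "p \<in> S"
  shows "levi f p v = (D2 f p v v + D2 f p (mult_i v) (mult_i v)) / 4"
proof -
  obtain a b where v: "v = (a, b)" by (cases v)
  have iv: "mult_i (a, b) = (\<i> * a, \<i> * b)" by (simp add: mult_i_def)
  have expand: "D2 f p (a, b) w =
     Re a * D2 f p e1 w + Im a * D2 f p (mult_i e1) w + Re b * D2 f p e2 w + Im b * D2 f p (mult_i e2) w"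
    for a b w by (rule linear_C2_expand[OF D2_linear_left[OF f]])
  have expand2: "D2 f p u (c, d) =
     Re c * D2 f p u e1 + Im c * D2 f p u (mult_i e1) + Re d * D2 f p u e2 + Im d * D2 f p u (mult_i e2)"
    for u c d by (rule linear_C2_expand[OF D2_linear_right[OF f]])
  show ?thesis
    unfolding v iv levi_def Let_def prod.case d_antihol_d_hol_real[OF f] expand expand2
    by (simp add: field_simps)
qed

text \<open>Cofactor expansion. The vector \<open>(\<rho>\<^sub>w, -\<rho>\<^sub>z)\<close> spans the complex tangent line, which is why the sign
of \<open>M\<close> decides strong pseudoconvexity.\<close>

lemma fefferman_M_eq_levi:
  assumes f: "smooth_on S f" "p \<in> S"
  shows "fefferman_M f p = levi f p (d_hol e2 (\<lambda>q. complex_of_real (f q)) p, - d_hol e1 (\<lambda>q. complex_of_real (f q)) p)"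
  unfolding fefferman_M_def levi_def Let_def prod.case d_antihol_d_hol_real[OF f] det_3 vector_3
    d_hol_real[OF smooth_on_differentiable[OF f]]
  by (simp add: field_simps)

section \<open>Rotation fields and radial functions\<close>

text \<open>With \<open>mult_i\<close> these are the quaternion units acting on \<open>\<complex>\<^sup>2\<close>: \<open>x, ix, jx, kx\<close> is an orthogonal real
frame, and \<open>x, jx\<close> is a complex frame. Each unit generates a one-parameter group of rotations.\<close>

definition mult_j :: "C2 \<Rightarrow> C2" where "mult_j v = (cnj (snd v), - cnj (fst v))"
definition mult_k :: "C2 \<Rightarrow> C2" where "mult_k v = mult_i (mult_j v)"

definition lie :: "(C2 \<Rightarrow> C2) \<Rightarrow> (C2 \<Rightarrow> real) \<Rightarrow> C2 \<Rightarrow> real" where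
  "lie A f x = DD f x (A x)"

lemma bounded_linear_mult_j: "bounded_linear mult_j"
  unfolding mult_j_def
  by (intro bounded_linear_Pair bounded_linear_minus bounded_linear_compose[OF bounded_linear_cnj]
      bounded_linear_fst bounded_linear_snd)

lemma bounded_linear_mult_k: "bounded_linear mult_k"
  unfolding mult_k_def
  by (rule bounded_linear_compose[OF bounded_linear_mult_i bounded_linear_mult_j])

lemma quaternion_relations [simp]:
  "mult_j (mult_j v) = - v" "mult_k (mult_k v) = - v"
  "mult_i (mult_j v) = mult_k v" "mult_j (mult_i v) = - mult_k v"
  "mult_i (mult_k v) = - mult_j v" "mult_k (mult_i v) = mult_j v"
  "mult_j (mult_k v) = mult_i v" "mult_k (mult_j v) = - mult_i v"
  by (simp_all add: mult_i_def mult_j_def mult_k_def prod_eq_iff complex_eq_iff)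

lemma inner_quaternion [simp]:
  "x \<bullet> mult_i x = 0" "x \<bullet> mult_j x = 0" "x \<bullet> mult_k x = 0"
  "mult_i x \<bullet> x = 0" "mult_j x \<bullet> x = 0" "mult_k x \<bullet> x = 0"
  "mult_i x \<bullet> mult_i y = x \<bullet> y" "mult_j x \<bullet> mult_j y = x \<bullet> y" "mult_k x \<bullet> mult_k y = x \<bullet> y"
  "mult_i x \<bullet> mult_j x = 0" "mult_i x \<bullet> mult_k x = 0" "mult_j x \<bullet> mult_k x = 0"
  "mult_j x \<bullet> mult_i x = 0" "mult_k x \<bullet> mult_i x = 0" "mult_k x \<bullet> mult_j x = 0"
  by (simp_all add: mult_i_def mult_j_def mult_k_def inner_prod_def inner_complex_def algebra_simps)

lemma lie_lie:
  assumes f: "smooth_on S f" "x \<in> S" and B: "bounded_linear B"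
  shows "lie A (lie B f) x = D2 f x (B x) (A x) + DD f x (B (A x))"
proof -
  have "((\<lambda>y. DD f y (B y)) has_derivative (\<lambda>v. D2 f x (B x) v + DD f x (B v))) (at x)"
    by (rule has_derivative_DD_along[OF f(1) f(2) has_derivative_ident bounded_linear_imp_has_derivative[OF B]])
  then show ?thesis unfolding lie_def by (simp add: DD_eqI)
qed

lemma smooth_on_lie:
  assumes f: "smooth_on S f" and B: "bounded_linear B"
  shows "smooth_on S (lie B f)"
proof -
  have "open S" using f by (simp add: smooth_on_def)
  then show ?thesis unfolding lie_def
    by (intro smooth_on_DD_along[OF f] smooth_on_bounded_linear B)
qed

lemma open_punctured: "open (- {0::C2})" by (simp add: open_Compl)

lemma radial_smooth: "radial_direction G \<Longrightarrow> smooth_on (- {0}) G"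
  by (simp add: radial_direction_def)

lemma radial_scale: "radial_direction G \<Longrightarrow> t > 0 \<Longrightarrow> G (t *\<^sub>R p) = G p"
  unfolding radial_direction_def by (cases "p = 0") (simp, blast)

lemma DD_radial_self:
  assumes "radial_direction G" "x \<noteq> 0"
  shows "DD G x x = 0"
proof -
  have "((\<lambda>s. G (0 + s *\<^sub>R x)) has_real_derivative DD G (0 + 1 *\<^sub>R x) x) (at 1)"
    using assms by (intro has_real_derivative_along_line[OF radial_smooth]) auto
  then have "((\<lambda>s. G (s *\<^sub>R x)) has_real_derivative DD G x x) (at 1)" by simp
  moreover have "((\<lambda>s. G (s *\<^sub>R x)) has_real_derivative 0) (at 1)"
    by (rule has_field_derivative_transform_within_open[where f="\<lambda>_. G x" and S="{0<..}"])
      (auto simp: radial_scale[OF assms(1)])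
  ultimately show ?thesis by (rule DERIV_unique)
qed

text \<open>Differentiate the Euler relation \<open>DD G y y = 0\<close>.\<close>

lemma D2_radial_self:
  assumes G: "radial_direction G" "x \<noteq> 0"
  shows "D2 G x x v = - DD G x v" "D2 G x v x = - DD G x v"
proof -
  have x: "x \<in> - {0}" using G by simp
  have "((\<lambda>y. DD G y y) has_derivative (\<lambda>v. D2 G x x v + DD G x v)) (at x)"
    by (rule has_derivative_DD_along[OF radial_smooth[OF G(1)] x has_derivative_ident has_derivative_ident])
  moreover have "((\<lambda>y. DD G y y) has_derivative (\<lambda>v. 0)) (at x)"
    by (rule has_derivative_transform_within_open[where f="\<lambda>_. 0", OF _ open_punctured x])
      (auto simp: DD_radial_self[OF G(1)])
  ultimately have "(\<lambda>v. D2 G x x v + DD G x v) = (\<lambda>v. 0)" by (rule has_derivative_unique)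
  then show "D2 G x x v = - DD G x v" by (metis eq_neg_iff_add_eq_0)
  then show "D2 G x v x = - DD G x v" using D2_sym[OF radial_smooth[OF G(1)] x] by simp
qed

lemma DD_radial_scale:
  assumes G: "radial_direction G" and x: "x \<noteq> 0" and t: "t > 0"
  shows "DD G (t *\<^sub>R x) (t *\<^sub>R v) = DD G x v"
proof -
  have tx: "t *\<^sub>R x \<in> - {0}" using x t by simp
  have "((\<lambda>y. G (t *\<^sub>R y)) has_derivative (\<lambda>v. DD G (t *\<^sub>R x) (t *\<^sub>R v))) (at x)"
    by (rule has_derivative_compose[where f="\<lambda>y. t *\<^sub>R y" and g=G, 
          OF has_derivative_scaleR_right[OF has_derivative_ident]])
      (rule smooth_on_has_derivative[OF radial_smooth[OF G] tx])
  then have "(G has_derivative (\<lambda>v. DD G (t *\<^sub>R x) (t *\<^sub>R v))) (at x)"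
    using radial_scale[OF G t] by simp
  from DD_eqI[OF this] show ?thesis by simp
qed

lemma radial_lie:
  assumes G: "radial_direction G" and B: "bounded_linear B"
  shows "radial_direction (lie B G)"
  unfolding radial_direction_def
proof (intro conjI allI impI)
  show "smooth_on (- {0}) (lie B G)" by (rule smooth_on_lie[OF radial_smooth[OF G] B])
  fix p :: C2 and t :: real assume "p \<noteq> 0" "t > 0"
  then show "lie B G (t *\<^sub>R p) = lie B G p"
    unfolding lie_def using DD_radial_scale[OF G, of p t "B p"]
    by (simp add: linear_scale[OF bounded_linear.linear[OF B]])
qed

lemma radial_mult: "radial_direction F \<Longrightarrow> radial_direction G \<Longrightarrow> radial_direction (\<lambda>x. F x * G x)"
  and radial_add: "radial_direction F \<Longrightarrow> radial_direction G \<Longrightarrow> radial_direction (\<lambda>x. F x + G x)"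
  and radial_const: "radial_direction (\<lambda>x. c)"
  unfolding radial_direction_def by (simp_all add: smooth_on_mult smooth_on_add smooth_on_const open_punctured)

lemma radial_cmult: "radial_direction F \<Longrightarrow> radial_direction (\<lambda>x. c * F x)"
  by (rule radial_mult[OF radial_const])

lemma radial_diff: "radial_direction F \<Longrightarrow> radial_direction G \<Longrightarrow> radial_direction (\<lambda>x. F x - G x)"
  using radial_add[OF _ radial_cmult[of G "-1"]] by simp

lemma radial_power: "radial_direction F \<Longrightarrow> radial_direction (\<lambda>x. F x ^ n)"
  unfolding radial_direction_def by (simp add: smooth_on_power)

lemma radial_divide: "radial_direction F \<Longrightarrow> radial_direction (\<lambda>x. F x / c)"
  using radial_cmult[of F "inverse c"] by (simp add: divide_inverse mult.commute)

lemma lie_cmult: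
  assumes "smooth_on (- {0}) f" "x \<noteq> 0"
  shows "lie A (\<lambda>x. c * f x) x = c * lie A f x"
proof -
  have "((\<lambda>x. c * f x) has_derivative (\<lambda>v. c * DD f x v)) (at x)"
    using assms by (intro has_derivative_mult_right smooth_on_has_derivative[OF assms(1)]) simp
  from DD_eqI[OF this] show ?thesis by (simp add: lie_def)
qed

lemma lie_cong:
  assumes "smooth_on (- {0}) f" "\<And>y. y \<noteq> 0 \<Longrightarrow> f y = g y" "x \<noteq> 0"
  shows "lie A f x = lie A g x"
proof -
  have "DD f x = DD g x"
    by (rule frechet_derivative_transform_within_open[OF _ open_punctured])
      (use assms smooth_on_differentiable[OF assms(1)] in auto)
  then show ?thesis by (simp add: lie_def)
qed

lemma lie_lie_cmult:
  assumes "smooth_on (- {0}) f" "x \<noteq> 0" "bounded_linear B"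
  shows "lie A (lie B (\<lambda>x. c * f x)) x = c * lie A (lie B f) x"
proof -
  have s: "smooth_on (- {0}) (\<lambda>x. c * f x)"
    by (rule smooth_on_mult[OF smooth_on_const[OF open_punctured] assms(1)])
  have "lie A (lie B (\<lambda>x. c * f x)) x = lie A (\<lambda>x. c * lie B f x) x"
    by (rule lie_cong[OF smooth_on_lie[OF s assms(3)] _ assms(2)]) (simp add: lie_cmult[OF assms(1)])
  also have "\<dots> = c * lie A (lie B f) x"
    by (rule lie_cmult[OF smooth_on_lie[OF assms(1,3)] assms(2)])
  finally show ?thesis .
qed

section \<open>The Monge-Ampere determinant of a perturbed sphere\<close>

text \<open>With the logarithm, scaling a point adds a constant to this defining function, so that its
differential takes the value 2 on every radial vector.\<close>

definition log_rho :: "(C2 \<Rightarrow> real) \<Rightarrow> C2 \<Rightarrow> real" where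
  "log_rho H x = ln (x \<bullet> x) + H x"

text \<open>The parts of degree 1, 2 and 3 in \<open>H\<close> of \<open>|x|\<^sup>4 M(log_rho H)\<close>. Derivatives along rotation fields keep a radial
function radial, so all of these are bounded.\<close>

definition ma_lin :: "(C2 \<Rightarrow> real) \<Rightarrow> C2 \<Rightarrow> real" where
  "ma_lin H x = (lie mult_j (lie mult_j H) x + lie mult_k (lie mult_k H) x) / 4"

definition ma_quad :: "(C2 \<Rightarrow> real) \<Rightarrow> C2 \<Rightarrow> real" where
  "ma_quad H x = (lie mult_i H x ^ 2 + lie mult_k H x * lie mult_j (lie mult_i H) x
     - lie mult_j H x * lie mult_k (lie mult_i H) x) / 4"

definition ma_cub :: "(C2 \<Rightarrow> real) \<Rightarrow> C2 \<Rightarrow> real" where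
  "ma_cub H x = (4 * lie mult_i H x ^ 2 * ma_lin H x
     + (lie mult_j H x ^ 2 + lie mult_k H x ^ 2) * lie mult_i (lie mult_i H) x
     - 2 * lie mult_i H x * (lie mult_j H x * lie mult_j (lie mult_i H) x
        + lie mult_k H x * lie mult_k (lie mult_i H) x)) / 16"

definition ma_det :: "(C2 \<Rightarrow> real) \<Rightarrow> C2 \<Rightarrow> real" where
  "ma_det H x = 1 + ma_lin H x + ma_quad H x + ma_cub H x"

lemmas bounded_linear_ijk = bounded_linear_mult_i bounded_linear_mult_j bounded_linear_mult_k

lemma radial_ma_lin: "radial_direction H \<Longrightarrow> radial_direction (ma_lin H)"
  unfolding ma_lin_def by (intro radial_divide radial_add radial_lie bounded_linear_ijk)

lemma radial_ma_quad: "radial_direction H \<Longrightarrow> radial_direction (ma_quad H)"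
  unfolding ma_quad_def
  by (intro radial_divide radial_add radial_diff radial_mult radial_power radial_lie bounded_linear_ijk)

lemma radial_ma_cub: "radial_direction H \<Longrightarrow> radial_direction (ma_cub H)"
  unfolding ma_cub_def
  by (intro radial_divide radial_add radial_diff radial_mult radial_power radial_const radial_lie
      radial_ma_lin bounded_linear_ijk)

lemma radial_ma_det: "radial_direction H \<Longrightarrow> radial_direction (ma_det H)"
  unfolding ma_det_def by (intro radial_add radial_const radial_ma_lin radial_ma_quad radial_ma_cub)

lemma ma_det_cmult:
  assumes "radial_direction G" "x \<noteq> 0"
  shows "ma_det (\<lambda>x. c * G x) x = 1 + c * ma_lin G x + c^2 * ma_quad G x + c^3 * ma_cub G x"
  unfolding ma_det_def ma_lin_def ma_quad_def ma_cub_def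
    lie_lie_cmult[OF radial_smooth[OF assms(1)] assms(2) bounded_linear_mult_i]
    lie_lie_cmult[OF radial_smooth[OF assms(1)] assms(2) bounded_linear_mult_j]
    lie_lie_cmult[OF radial_smooth[OF assms(1)] assms(2) bounded_linear_mult_k]
    lie_cmult[OF radial_smooth[OF assms(1)] assms(2)]
  by (simp add: field_simps power2_eq_square power3_eq_cube)

lemma smooth_log_norm: "smooth_on (- {0}) (\<lambda>x::C2. ln (x \<bullet> x))"
  by (intro smooth_on_ln smooth_on_inner smooth_on_bounded_linear open_punctured bounded_linear_ident) auto

lemma smooth_log_rho: "radial_direction H \<Longrightarrow> smooth_on (- {0}) (log_rho H)"
  unfolding log_rho_def by (intro smooth_on_add smooth_log_norm radial_smooth)

lemma has_derivative_log_norm: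
  "x \<noteq> 0 \<Longrightarrow> ((\<lambda>x::C2. ln (x \<bullet> x)) has_derivative (\<lambda>v. 2 * (x \<bullet> v) / (x \<bullet> x))) (at x)"
  by (auto intro!: derivative_eq_intros simp: inner_commute divide_inverse)

lemma DD_log_rho:
  assumes H: "radial_direction H" and x: "x \<noteq> 0"
  shows "DD (log_rho H) x v = 2 * (x \<bullet> v) / (x \<bullet> x) + DD H x v"
proof -
  have "(log_rho H has_derivative (\<lambda>v. 2 * (x \<bullet> v) / (x \<bullet> x) + DD H x v)) (at x)"
    unfolding log_rho_def
    by (intro has_derivative_add has_derivative_log_norm smooth_on_has_derivative[OF radial_smooth] assms)
      (use x in simp)
  from DD_eqI[OF this] show ?thesis by simp
qed

lemma D2_log_rho:
  assumes H: "radial_direction H" and x: "x \<noteq> 0"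
  shows "D2 (log_rho H) x u v = 2 * (u \<bullet> v) / (x \<bullet> x) - 4 * (x \<bullet> u) * (x \<bullet> v) / (x \<bullet> x)\<^sup>2 + D2 H x u v"
proof -
  have x': "x \<in> - {0}" using x by simp
  have 1: "((\<lambda>x. 2 * (x \<bullet> u) / (x \<bullet> x)) has_derivative
    (\<lambda>v. 2 * (u \<bullet> v) / (x \<bullet> x) - 4 * (x \<bullet> u) * (x \<bullet> v) / (x \<bullet> x)\<^sup>2)) (at x)"
    by (rule has_derivative_eq_rhs, (rule derivative_intros)+)
      (use x in \<open>auto simp: fun_eq_iff field_simps power2_eq_square inner_commute\<close>)
  have "((\<lambda>x. 2 * (x \<bullet> u) / (x \<bullet> x) + DD H x u) has_derivative
    (\<lambda>v. 2 * (u \<bullet> v) / (x \<bullet> x) - 4 * (x \<bullet> u) * (x \<bullet> v) / (x \<bullet> x)\<^sup>2 + D2 H x u v)) (at x)"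
    unfolding D2_def
    by (rule has_derivative_add[OF 1 smooth_on_has_derivative[OF smooth_on_DD[OF radial_smooth[OF H]] x']])
  then have "((\<lambda>x. DD (log_rho H) x u) has_derivative
    (\<lambda>v. 2 * (u \<bullet> v) / (x \<bullet> x) - 4 * (x \<bullet> u) * (x \<bullet> v) / (x \<bullet> x)\<^sup>2 + D2 H x u v)) (at x)"
    by (rule has_derivative_transform_within_open[OF _ open_punctured x']) (auto simp: DD_log_rho[OF H])
  from DD_eqI[OF this] show ?thesis by (simp add: D2_def)
qed

lemma levi_cmult: "levi f p (c * a, c * b) = (cmod c)\<^sup>2 * levi f p (a, b)"
proof -
  have c: "complex_of_real ((cmod c)\<^sup>2) = c * cnj c" by (rule complex_norm_square)
  have scale: "Re (complex_of_real s * X) = s * Re X" for s X by simp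
  have "levi f p (c * a, c * b) = Re (complex_of_real ((cmod c)\<^sup>2) * 
     (d_antihol e1 (d_hol e1 (\<lambda>q. complex_of_real (f q))) p * a * cnj a + d_antihol e2 (d_hol e1 (\<lambda>q. complex_of_real (f q))) p * a * cnj b
       + d_antihol e1 (d_hol e2 (\<lambda>q. complex_of_real (f q))) p * b * cnj a + d_antihol e2 (d_hol e2 (\<lambda>q. complex_of_real (f q))) p * b * cnj b))"
    unfolding c by (simp add: levi_def Let_def algebra_simps)
  also have "\<dots> = (cmod c)\<^sup>2 * levi f p (a, b)" unfolding scale by (simp add: levi_def Let_def)
  finally show ?thesis .
qed

text \<open>The complex tangent vector \<open>(f\<^sub>w, -f\<^sub>z)\<close>, scaled by \<open>|x|\<^sup>2\<close>, in the complex frame \<open>x, jx\<close>: its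
coefficients are half the derivatives of \<open>f\<close> along the frame.\<close>

lemma frame_tangent:
  assumes f: "f differentiable (at x)"
  defines "a \<equiv> d_hol e1 (\<lambda>q. complex_of_real (f q)) x" and "b \<equiv> d_hol e2 (\<lambda>q. complex_of_real (f q)) x"
  shows "(complex_of_real (x \<bullet> x) * b, complex_of_real (x \<bullet> x) * - a) =
    (1/2) *\<^sub>R (DD f x x *\<^sub>R mult_j x - DD f x (mult_i x) *\<^sub>R mult_k x
      - DD f x (mult_j x) *\<^sub>R x + DD f x (mult_k x) *\<^sub>R mult_i x)"
proof -
  obtain z w where x: "x = (z, w)" by (cases x)
  have lin: "linear (DD f x)" by (rule linear_frechet_derivative[OF f])
  have expand: "DD f x (c, d) =
     Re c * DD f x e1 + Im c * DD f x (mult_i e1) + Re d * DD f x e2 + Im d * DD f x (mult_i e2)" for c d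
    by (rule linear_C2_expand[OF lin])
  have fr: "mult_i x = (\<i> * z, \<i> * w)" "mult_j x = (cnj w, - cnj z)" "mult_k x = (\<i> * cnj w, - \<i> * cnj z)"
    by (simp_all add: x mult_i_def mult_j_def mult_k_def)
  have xx: "DD f x x = DD f x (z, w)" by (simp add: x)
  show ?thesis
    unfolding a_def b_def d_hol_real[OF f] fr xx expand
    by (simp add: x complex_eq_iff inner_complex_def algebra_simps)
qed

text \<open>The vector of \<open>frame_tangent\<close> is here \<open>m = jx + (terms linear in dH)\<close>. On \<open>m\<close> and \<open>im\<close> together the
Hessian of \<open>ln |x|\<^sup>2\<close> contributes \<open>1\<close> plus a square, and that of \<open>H\<close> contributes the remaining linear to
cubic terms; its entry in the directions \<open>jx, kx\<close> cancels between \<open>m\<close> and \<open>im\<close>.\<close>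

proposition fefferman_M_log_rho:
  assumes H: "radial_direction H" and x: "x \<noteq> 0"
  shows "(x \<bullet> x)\<^sup>2 * fefferman_M (log_rho H) x = ma_det H x"
proof -
  have x': "x \<in> - {0}" using x by simp
  have xx: "x \<bullet> x \<noteq> 0" using x by simp
  note sm = smooth_log_rho[OF H]
  define t j k where "t = lie mult_i H x" and "j = lie mult_j H x" and "k = lie mult_k H x"
  define m where "m = mult_j x - (t/2) *\<^sub>R mult_k x - (j/2) *\<^sub>R x + (k/2) *\<^sub>R mult_i x"
  have im: "mult_i m = mult_k x + (t/2) *\<^sub>R mult_j x - (j/2) *\<^sub>R mult_i x - (k/2) *\<^sub>R x"
    unfolding m_def using bounded_linear.linear[OF bounded_linear_mult_i]
    by (simp add: linear_add linear_diff linear_scale)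
  have "(x \<bullet> x)\<^sup>2 * fefferman_M (log_rho H) x = levi (log_rho H) x m"
  proof -
    have "DD (log_rho H) x x = 2" "DD (log_rho H) x (mult_i x) = t"
      "DD (log_rho H) x (mult_j x) = j" "DD (log_rho H) x (mult_k x) = k"
      using xx by (simp_all add: DD_log_rho[OF H x] DD_radial_self[OF H x] t_def j_def k_def lie_def)
    then have "m = (complex_of_real (x \<bullet> x) * d_hol e2 (\<lambda>q. complex_of_real (log_rho H q)) x,
       complex_of_real (x \<bullet> x) * - d_hol e1 (\<lambda>q. complex_of_real (log_rho H q)) x)"
      unfolding frame_tangent[OF smooth_on_differentiable[OF sm x']] m_def
      by (simp add: scaleR_right_diff_distrib scaleR_right_distrib)
    then show ?thesis
      unfolding fefferman_M_eq_levi[OF sm x'] by (simp only: levi_cmult) simp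
  qed
  also have "\<dots> = (D2 (log_rho H) x m m + D2 (log_rho H) x (mult_i m) (mult_i m)) / 4"
    by (rule levi_eq_D2[OF sm x'])
  also have "\<dots> = 1 + t\<^sup>2 / 4 + (D2 H x m m + D2 H x (mult_i m) (mult_i m)) / 4"
  proof -
    have i1: "m \<bullet> m = (x \<bullet> x) * (1 + t\<^sup>2/4 + j\<^sup>2/4 + k\<^sup>2/4)"
      unfolding m_def by (simp add: inner_add_left inner_add_right inner_diff_left inner_diff_right power2_eq_square field_simps)
    have i2: "x \<bullet> m = - j/2 * (x \<bullet> x)" "x \<bullet> mult_i m = - k/2 * (x \<bullet> x)"
      unfolding m_def im[unfolded m_def] by (simp_all add: inner_add_right inner_diff_right)
    show ?thesis
      unfolding D2_log_rho[OF H x] i2 inner_quaternion i1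
      using xx by (simp add: field_simps power2_eq_square)
  qed
  also have "\<dots> = ma_det H x"
  proof -
    have S: "linear (D2 H x u)" "linear (\<lambda>u. D2 H x u v)" for u v
      by (rule D2_linear_right[OF radial_smooth[OF H] x'] D2_linear_left[OF radial_smooth[OF H] x'])+
    have dm: "DD H x (- v) = - DD H x v" for v
      by (rule linear_neg[OF linear_frechet_derivative[OF smooth_on_differentiable[OF radial_smooth[OF H] x']]])
    note D = linear_add[OF S(1)] linear_diff[OF S(1)] linear_scale[OF S(1)] 
       linear_add[OF S(2)] linear_diff[OF S(2)] linear_scale[OF S(2)]
    note L = lie_lie[OF radial_smooth[OF H] x']
    define TT JT KT where "TT = lie mult_i (lie mult_i H) x" and "JT = lie mult_j (lie mult_i H) x"
      and "KT = lie mult_k (lie mult_i H) x"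
    have s1: "D2 H x (mult_j x) (mult_j x) + D2 H x (mult_k x) (mult_k x) = 4 * ma_lin H x"
      unfolding ma_lin_def L[OF bounded_linear_mult_j] L[OF bounded_linear_mult_k]
      by (simp add: dm DD_radial_self[OF H x])
    have s2: "D2 H x (mult_i x) (mult_i x) = TT"
      unfolding TT_def L[OF bounded_linear_mult_i] by (simp add: dm DD_radial_self[OF H x])
    have s3: "D2 H x (mult_i x) (mult_j x) = JT - k" "D2 H x (mult_i x) (mult_k x) = KT + j"
      unfolding JT_def KT_def L[OF bounded_linear_mult_i] by (simp_all add: dm j_def k_def lie_def)
    have s4: "D2 H x (mult_j x) (mult_i x) = JT - k" "D2 H x (mult_k x) (mult_i x) = KT + j"
      "D2 H x (mult_k x) (mult_j x) = D2 H x (mult_j x) (mult_k x)"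
      using s3 D2_sym[OF radial_smooth[OF H] x'] by metis+
    have s5: "D2 H x x (mult_i x) = - t" "D2 H x x (mult_j x) = - j" "D2 H x x (mult_k x) = - k"
      "D2 H x (mult_i x) x = - t" "D2 H x (mult_j x) x = - j" "D2 H x (mult_k x) x = - k" "D2 H x x x = 0"
      by (simp_all add: D2_radial_self[OF H x] t_def j_def k_def lie_def DD_radial_self[OF H x])
    have s6: "D2 H x (mult_j x) (mult_j x) = 4 * ma_lin H x - D2 H x (mult_k x) (mult_k x)"
      using s1 by simp
    show ?thesis
      unfolding im unfolding m_def D s2 s3 s4 s5 s6
      unfolding ma_det_def ma_quad_def ma_cub_def t_def[symmetric] j_def[symmetric] k_def[symmetric]
        TT_def[symmetric] JT_def[symmetric] KT_def[symmetric]
      by (simp add: field_simps power2_eq_square)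
  qed
  finally show ?thesis .
qed

section \<open>The euclidean volume form\<close>

lemma vector_4 [simp]:
  "(vector [x, y, z, w] :: 'a::zero ^ 4) $ 1 = x"
  "(vector [x, y, z, w] :: 'a::zero ^ 4) $ 2 = y"
  "(vector [x, y, z, w] :: 'a::zero ^ 4) $ 3 = z"
  "(vector [x, y, z, w] :: 'a::zero ^ 4) $ 4 = w"
  unfolding vector_def by simp_all

lemma det_4:
  "det (A::'a::comm_ring_1^4^4) =
     A$1$1 * (A$2$2 * (A$3$3 * A$4$4 - A$3$4 * A$4$3) - A$2$3 * (A$3$2 * A$4$4 - A$3$4 * A$4$2) + A$2$4 * (A$3$2 * A$4$3 - A$3$3 * A$4$2))
   - A$1$2 * (A$2$1 * (A$3$3 * A$4$4 - A$3$4 * A$4$3) - A$2$3 * (A$3$1 * A$4$4 - A$3$4 * A$4$1) + A$2$4 * (A$3$1 * A$4$3 - A$3$3 * A$4$1))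
   + A$1$3 * (A$2$1 * (A$3$2 * A$4$4 - A$3$4 * A$4$2) - A$2$2 * (A$3$1 * A$4$4 - A$3$4 * A$4$1) + A$2$4 * (A$3$1 * A$4$2 - A$3$2 * A$4$1))
   - A$1$4 * (A$2$1 * (A$3$2 * A$4$3 - A$3$3 * A$4$2) - A$2$2 * (A$3$1 * A$4$3 - A$3$3 * A$4$1) + A$2$3 * (A$3$1 * A$4$2 - A$3$2 * A$4$1))"
proof -
  have f1234: "finite {2::4, 3, 4}" "1 \<notin> {2::4, 3, 4}" by auto
  have f234: "finite {3::4, 4}" "2 \<notin> {3::4, 4}" by auto
  have f34: "finite {4::4}" "3 \<notin> {4::4}" by auto
  show ?thesis
    unfolding det_def UNIV_4
    unfolding sum_over_permutations_insert[OF f1234]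
    unfolding sum_over_permutations_insert[OF f234]
    unfolding sum_over_permutations_insert[OF f34]
    unfolding permutes_sing
    by (simp add: sign_swap_id permutation_swap_id permutation_compose sign_compose sign_id swap_id_eq algebra_simps)
qed

lemma bounded_linear_real_coords: "bounded_linear real_coords"
proof -
  have "linear real_coords"
    by (intro linearI) (simp_all add: real_coords_def vec_eq_iff forall_4)
  then show ?thesis by (simp add: linear_conv_bounded_linear)
qed

abbreviation vol4 :: "C2 \<Rightarrow> C2 \<Rightarrow> C2 \<Rightarrow> C2 \<Rightarrow> real" where
  "vol4 \<equiv> euclidean_volume_form"

lemma real_coords_nth [simp]:
  "real_coords v $ 1 = Re (fst v)" "real_coords v $ 2 = Im (fst v)"
  "real_coords v $ 3 = Re (snd v)" "real_coords v $ 4 = Im (snd v)"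
  by (simp_all add: real_coords_def)

lemmas vol4_expand = euclidean_volume_form_def det_4 vector_4 real_coords_nth

lemma linear_vol4:
  "linear (\<lambda>v. vol4 v b c d)" "linear (\<lambda>v. vol4 a v c d)" "linear (\<lambda>v. vol4 a b v d)" "linear (\<lambda>v. vol4 a b c v)"
  by (intro linearI; simp add: vol4_expand algebra_simps)+

lemma vol4_alternating:
  "vol4 a a c d = 0" "vol4 a b a d = 0" "vol4 a b c a = 0" "vol4 a b b d = 0" "vol4 a b c b = 0" "vol4 a b c c = 0"
  by (simp_all add: vol4_expand algebra_simps)

text \<open>Five vectors of a four-dimensional space are dependent, so the alternating sum over the five slots
vanishes. Hence contracting the volume form with a vector \<open>p\<close>, and dividing by \<open>L p\<close>, solves
\<open>\<sigma> \<and> L = vol\<close>.\<close>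

lemma vol4_five_vectors:
  assumes L: "linear (L :: C2 \<Rightarrow> real)"
  shows "vol4 a b c p * L d - vol4 a b d p * L c + vol4 a c d p * L b - vol4 b c d p * L a = L p * vol4 a b c d"
proof -
  have expand: "L v = Re (fst v) * L e1 + Im (fst v) * L (mult_i e1) + Re (snd v) * L e2 + Im (snd v) * L (mult_i e2)" for v
    using linear_C2_expand[OF L, of "fst v" "snd v"] by simp
  define l1 l2 l3 l4 where l: "l1 = L e1" "l2 = L (mult_i e1)" "l3 = L e2" "l4 = L (mult_i e2)"
  have 1: "vol4 a b c p * Re (fst d) - vol4 a b d p * Re (fst c) + vol4 a c d p * Re (fst b) - vol4 b c d p * Re (fst a) = Re (fst p) * vol4 a b c d"
    unfolding vol4_expand by algebra
  have 2: "vol4 a b c p * Im (fst d) - vol4 a b d p * Im (fst c) + vol4 a c d p * Im (fst b) - vol4 b c d p * Im (fst a) = Im (fst p) * vol4 a b c d"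
    unfolding vol4_expand by algebra
  have 3: "vol4 a b c p * Re (snd d) - vol4 a b d p * Re (snd c) + vol4 a c d p * Re (snd b) - vol4 b c d p * Re (snd a) = Re (snd p) * vol4 a b c d"
    unfolding vol4_expand by algebra
  have 4: "vol4 a b c p * Im (snd d) - vol4 a b d p * Im (snd c) + vol4 a c d p * Im (snd b) - vol4 b c d p * Im (snd a) = Im (snd p) * vol4 a b c d"
    unfolding vol4_expand by algebra
  have "L p * vol4 a b c d = l1 * (Re (fst p) * vol4 a b c d) + l2 * (Im (fst p) * vol4 a b c d)
     + l3 * (Re (snd p) * vol4 a b c d) + l4 * (Im (snd p) * vol4 a b c d)"
    unfolding expand[of p] l by (simp add: algebra_simps)
  also have "\<dots> = vol4 a b c p * L d - vol4 a b d p * L c + vol4 a c d p * L b - vol4 b c d p * L a"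
    unfolding 1[symmetric] 2[symmetric] 3[symmetric] 4[symmetric] expand[of a] expand[of b] expand[of c] expand[of d] l
    by (simp add: algebra_simps)
  finally show ?thesis by simp
qed

section \<open>The perturbed sphere as a radial graph\<close>

abbreviation sph :: "(C2 \<Rightarrow> real) \<Rightarrow> C2 set" where
  "sph H \<equiv> perturbed_sphere H 1"

lemma perturbed_sphere_cmult: "perturbed_sphere G e = sph (\<lambda>x. e * G x)"
  by (simp add: perturbed_sphere_def)

lemma mem_sph: "p \<in> sph H \<longleftrightarrow> exp (H p) * (p \<bullet> p) = 1"
  by (cases p) (simp add: perturbed_sphere_def power2_norm_eq_inner)

lemma mem_sph_log: "p \<in> sph H \<longleftrightarrow> p \<noteq> 0 \<and> log_rho H p = 0"
proof (cases "p = 0")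
  case False
  then have "exp (log_rho H p) = exp (H p) * (p \<bullet> p)"
    by (simp add: log_rho_def exp_add)
  then show ?thesis using False by (metis exp_eq_one_iff mem_sph)
qed (simp add: mem_sph)

text \<open>The radial projection onto \<open>sph H\<close>; the factor is forced by \<open>log_rho H (t x) = log_rho H x + 2 ln t\<close>.\<close>

definition proj :: "(C2 \<Rightarrow> real) \<Rightarrow> C2 \<Rightarrow> C2" where
  "proj H x = exp (- log_rho H x / 2) *\<^sub>R x"

lemma log_rho_scale:
  assumes "radial_direction H" "x \<noteq> 0" "t > 0"
  shows "log_rho H (t *\<^sub>R x) = log_rho H x + 2 * ln t"
  using assms by (simp add: log_rho_def radial_scale ln_mult)

lemma proj_in_sph: "radial_direction H \<Longrightarrow> x \<noteq> 0 \<Longrightarrow> proj H x \<in> sph H"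
  by (simp add: mem_sph_log proj_def log_rho_scale)

lemma proj_sph: "p \<in> sph H \<Longrightarrow> proj H p = p"
  by (simp add: mem_sph_log proj_def)

lemma proj_scale: "radial_direction H \<Longrightarrow> t > 0 \<Longrightarrow> proj H (t *\<^sub>R x) = proj H x"
proof (cases "x = 0")
  case False
  assume "radial_direction H" "t > 0"
  have half: "- (log_rho H x + 2 * ln t) / 2 = - log_rho H x / 2 - ln t" by (simp add: field_simps)
  have "exp (- (log_rho H x + 2 * ln t) / 2) * t = exp (- log_rho H x / 2)"
    unfolding half exp_diff exp_ln[OF \<open>t > 0\<close>] using \<open>t > 0\<close> by simp
  then show ?thesis
    unfolding proj_def log_rho_scale[OF \<open>radial_direction H\<close> False \<open>t > 0\<close>] scaleR_scaleR by simp
qed (simp add: proj_def)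

lemma smooth_proj: "radial_direction H \<Longrightarrow> smooth_on (- {0}) (proj H)"
proof -
  assume H: "radial_direction H"
  have "smooth_on (- {0}) (\<lambda>x. (-1/2) * log_rho H x)"
    by (rule smooth_on_mult[OF smooth_on_const[OF open_punctured] smooth_log_rho[OF H]])
  from smooth_on_scaleR[OF smooth_on_exp_compose[OF this] smooth_on_bounded_linear[OF open_punctured bounded_linear_ident]]
  show ?thesis unfolding proj_def by simp
qed

lemma has_derivative_proj:
  assumes H: "radial_direction H" and x: "x \<noteq> 0"
  shows "(proj H has_derivative
    (\<lambda>v. exp (- log_rho H x / 2) *\<^sub>R (v - (DD (log_rho H) x v / 2) *\<^sub>R x))) (at x)"
proof -
  have d: "(log_rho H has_derivative DD (log_rho H) x) (at x)"
    using smooth_on_has_derivative[OF smooth_log_rho[OF H]] x by simp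
  have "((\<lambda>x. exp (- log_rho H x / 2) *\<^sub>R x) has_derivative
     (\<lambda>v. exp (- log_rho H x / 2) *\<^sub>R v + (- DD (log_rho H) x v / 2 * exp (- log_rho H x / 2)) *\<^sub>R x)) (at x)"
    using has_derivative_scaleR[OF has_derivative_exp[OF has_derivative_mult_right[OF d, of "- 1 / 2"]] has_derivative_ident]
    by (simp add: mult.commute)
  then show ?thesis unfolding proj_def
    by (rule has_derivative_eq_rhs) (simp add: fun_eq_iff scaleR_right_diff_distrib mult.commute)
qed

lemma DD_log_rho_self:
  assumes "radial_direction H" "x \<noteq> 0" shows "DD (log_rho H) x x = 2"
  using assms by (simp add: DD_log_rho DD_radial_self)

section \<open>Independence of the defining function\<close>

text \<open>The function \<open>f \<circ> proj H\<close> vanishes identically; this is its derivative.\<close>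

lemma gradient_of_defining_function:
  assumes H: "radial_direction H" and f: "smooth_on N f" and Z: "sph H = {p \<in> N. f p = 0}" and x: "x \<noteq> 0"
  shows "DD f (proj H x) v = DD (log_rho H) x v / 2 * DD f (proj H x) x"
proof -
  have pN: "proj H y \<in> N" "f (proj H y) = 0" if "y \<noteq> 0" for y
    using proj_in_sph[OF H that] Z by auto
  have lin: "linear (DD f (proj H x))"
    by (rule linear_frechet_derivative[OF smooth_on_differentiable[OF f pN(1)[OF x]]])
  have "((\<lambda>y. f (proj H y)) has_derivative
     (\<lambda>v. DD f (proj H x) (exp (- log_rho H x / 2) *\<^sub>R (v - (DD (log_rho H) x v / 2) *\<^sub>R x)))) (at x)"
    by (rule has_derivative_compose[OF has_derivative_proj[OF H x] smooth_on_has_derivative[OF f pN(1)[OF x]]])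
  moreover have "((\<lambda>y. f (proj H y)) has_derivative (\<lambda>v. 0)) (at x)"
    by (rule has_derivative_transform_within_open[where f="\<lambda>_. 0", OF _ open_punctured])
      (use x pN in auto)
  ultimately have "(\<lambda>v. DD f (proj H x) (exp (- log_rho H x / 2) *\<^sub>R (v - (DD (log_rho H) x v / 2) *\<^sub>R x))) = (\<lambda>v. 0)"
    by (rule has_derivative_unique)
  then have "DD f (proj H x) (exp (- log_rho H x / 2) *\<^sub>R (v - (DD (log_rho H) x v / 2) *\<^sub>R x)) = 0" by metis
  then show ?thesis by (simp add: linear_scale[OF lin] linear_diff[OF lin])
qed

text \<open>Differentiating \<open>gradient_of_defining_function\<close> once more along a tangent vector \<open>v\<close>. The unknown
derivative of the second factor is multiplied by \<open>DD (log_rho H) p v = 0\<close>.\<close>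

lemma hessian_of_defining_function:
  assumes H: "radial_direction H" and f: "smooth_on N f" and Z: "sph H = {p \<in> N. f p = 0}" and p: "p \<in> sph H"
    and v: "DD (log_rho H) p v = 0"
  shows "D2 f p v v = DD f p p / 2 * D2 (log_rho H) p v v"
proof -
  have p0: "p \<noteq> 0" and pp: "proj H p = p" and lp: "log_rho H p = 0" using p by (auto simp: mem_sph_log proj_sph)
  have pN: "proj H p \<in> N" using p Z pp by auto
  have p': "p \<in> - {0}" using p0 by simp
  note dp = has_derivative_proj[OF H p0]
  have 1: "((\<lambda>x. DD f (proj H x) v) has_derivative
      (\<lambda>w. D2 f p v (w - (DD (log_rho H) p w / 2) *\<^sub>R p))) (at p)"
  proof -
    have "linear (DD f p)" using linear_frechet_derivative[OF smooth_on_differentiable[OF f pN]] pp by simp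
    then show ?thesis
      using has_derivative_DD_along[OF f pN dp has_derivative_const[of v]] lp by (simp add: pp linear_0)
  qed
  obtain E where 2: "((\<lambda>x. DD f (proj H x) x) has_derivative E) (at p)"
    using has_derivative_DD_along[OF f pN dp has_derivative_ident] by blast
  have 3: "((\<lambda>x. DD (log_rho H) x v) has_derivative D2 (log_rho H) p v) (at p)"
    unfolding D2_def by (rule smooth_on_has_derivative[OF smooth_on_DD[OF smooth_log_rho[OF H]] p'])
  have "((\<lambda>x. DD f (proj H x) v - 1/2 * (DD (log_rho H) x v * DD f (proj H x) x)) has_derivative
     (\<lambda>w. D2 f p v (w - (DD (log_rho H) p w / 2) *\<^sub>R p) - 1/2 * (DD (log_rho H) p v * E w + D2 (log_rho H) p v w * DD f (proj H p) p))) (at p)"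
    by (rule has_derivative_diff[OF 1 has_derivative_mult_right[OF has_derivative_mult[OF 3 2]]])
  moreover have "((\<lambda>x. DD f (proj H x) v - 1/2 * (DD (log_rho H) x v * DD f (proj H x) x)) has_derivative (\<lambda>w. 0)) (at p)"
    by (rule has_derivative_transform_within_open[where f="\<lambda>_. 0", OF _ open_punctured p'])
      (use gradient_of_defining_function[OF H f Z] in auto)
  ultimately have "(\<lambda>w. D2 f p v (w - (DD (log_rho H) p w / 2) *\<^sub>R p) - 1/2 * (DD (log_rho H) p v * E w + D2 (log_rho H) p v w * DD f (proj H p) p)) = (\<lambda>w. 0)"
    by (rule has_derivative_unique)
  from fun_cong[OF this, of v] show ?thesis by (simp add: v pp)
qed

lemma complex_gradient:
  assumes "f differentiable (at p)"
  shows "d_hol e1 (\<lambda>q. complex_of_real (f q)) p * a + d_hol e2 (\<lambda>q. complex_of_real (f q)) p * b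
     = Complex (DD f p (a, b) / 2) (- DD f p (mult_i (a, b)) / 2)"
proof -
  have lin: "linear (DD f p)" by (rule linear_frechet_derivative[OF assms])
  have iv: "mult_i (a, b) = (\<i> * a, \<i> * b)" by (simp add: mult_i_def)
  show ?thesis unfolding d_hol_real[OF assms] iv linear_C2_expand[OF lin]
    by (simp add: complex_eq_iff field_simps)
qed

text \<open>A spanning vector of the complex tangent line, on which the Levi form equals \<open>M\<close>.\<close>

definition hol_tangent :: "(C2 \<Rightarrow> real) \<Rightarrow> C2 \<Rightarrow> C2" where
  "hol_tangent f p = (d_hol e2 (\<lambda>q. complex_of_real (f q)) p, - d_hol e1 (\<lambda>q. complex_of_real (f q)) p)"

lemma DD_hol_tangent:
  assumes "f differentiable (at p)"
  shows "DD f p (hol_tangent f p) = 0" "DD f p (mult_i (hol_tangent f p)) = 0"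
  using complex_gradient[OF assms, of "fst (hol_tangent f p)" "snd (hol_tangent f p)"]
  by (simp_all add: hol_tangent_def complex_eq_iff)

lemma hol_tangent_eq_0:
  assumes "f differentiable (at p)" "hol_tangent f p = 0"
  shows "DD f p v = 0"
  using complex_gradient[OF assms(1), of "fst v" "snd v"] assms(2)
  by (simp add: hol_tangent_def complex_eq_iff prod_eq_iff)

lemma hol_tangent_spans:
  assumes f: "f differentiable (at p)" and t: "hol_tangent f p \<noteq> 0"
    and ab: "d_hol e1 (\<lambda>q. complex_of_real (f q)) p * a + d_hol e2 (\<lambda>q. complex_of_real (f q)) p * b = 0"
  obtains c where "a = c * fst (hol_tangent f p)" "b = c * snd (hol_tangent f p)"
proof -
  define f1 f2 where ff: "f1 = d_hol e1 (\<lambda>q. complex_of_real (f q)) p" "f2 = d_hol e2 (\<lambda>q. complex_of_real (f q)) p"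
  have t: "f1 \<noteq> 0 \<or> f2 \<noteq> 0" using t by (auto simp: hol_tangent_def ff prod_eq_iff)
  have ab: "f1 * a + f2 * b = 0" using ab by (simp add: ff)
  show ?thesis
  proof (cases "f2 = 0")
    case False
    have "f2 * b = - (f1 * a)" using ab by (simp add: add_eq_0_iff)
    then have "b = - (f1 * a) / f2" using False by (metis nonzero_mult_div_cancel_left)
    with False show ?thesis using that[of "a / f2"] by (simp add: hol_tangent_def ff)
  next
    case True
    then show ?thesis using that[of "- b / f1"] t ab by (simp add: hol_tangent_def ff)
  qed
qed

text \<open>The division by 2 is the value of \<open>d(log_rho H)\<close> on the radial vector, with which \<open>std_form\<close> contracts.\<close>

definition fef_density :: "(C2 \<Rightarrow> real) \<Rightarrow> C2 \<Rightarrow> real" where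
  "fef_density H p = 2 powr (4/3) * root 3 (fefferman_M (log_rho H) p) / 2"

definition std_form :: "(C2 \<Rightarrow> real) \<Rightarrow> C2 \<Rightarrow> C2 \<Rightarrow> C2 \<Rightarrow> C2 \<Rightarrow> real" where
  "std_form H p u v w = fef_density H p * vol4 u v w p"

lemma fefferman_M_pos:
  assumes "radial_direction H" "\<And>x. x \<noteq> 0 \<Longrightarrow> ma_det H x > 0" "x \<noteq> 0"
  shows "fefferman_M (log_rho H) x > 0"
proof -
  have "(x \<bullet> x)\<^sup>2 * fefferman_M (log_rho H) x > 0"
    using fefferman_M_log_rho[OF assms(1,3)] assms(2)[OF assms(3)] by simp
  then show ?thesis by (simp add: zero_less_mult_iff)
qed

lemma spc_log_rho:
  assumes H: "radial_direction H" and pos: "\<And>x. x \<noteq> 0 \<Longrightarrow> ma_det H x > 0"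
  shows "spc_defining_function (sph H) (log_rho H)"
  unfolding spc_defining_function_def defining_function_def
proof (intro conjI ballI allI impI)
  show "\<exists>N. smooth_on N (log_rho H) \<and> sph H = {p \<in> N. log_rho H p = 0}"
    using smooth_log_rho[OF H] by (intro exI[of _ "- {0}"]) (auto simp: mem_sph_log)
next
  fix p assume "p \<in> sph H"
  then have p: "p \<noteq> 0" by (simp add: mem_sph_log)
  then show "\<exists>v. DD (log_rho H) p v \<noteq> 0" using DD_log_rho_self[OF H p] by (metis zero_neq_numeral)
next
  fix p and a b :: complex assume "p \<in> sph H" and ab: "(a, b) \<noteq> (0, 0)"
   and t: "d_hol e1 (\<lambda>q. complex_of_real (log_rho H q)) p * a + d_hol e2 (\<lambda>q. complex_of_real (log_rho H q)) p * b = 0"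
  then have p: "p \<noteq> 0" "p \<in> - {0}" by (simp_all add: mem_sph_log)
  have d: "log_rho H differentiable (at p)" by (rule smooth_on_differentiable[OF smooth_log_rho[OF H] p(2)])
  have "hol_tangent (log_rho H) p \<noteq> 0"
    using hol_tangent_eq_0[OF d] DD_log_rho_self[OF H p(1)] by (metis zero_neq_numeral)
  from hol_tangent_spans[OF d this t] obtain c where
    c: "a = c * fst (hol_tangent (log_rho H) p)" "b = c * snd (hol_tangent (log_rho H) p)" .
  have "levi (log_rho H) p (a, b) = (cmod c)\<^sup>2 * fefferman_M (log_rho H) p"
    unfolding c levi_cmult fefferman_M_eq_levi[OF smooth_log_rho[OF H] p(2)] hol_tangent_def by simp
  moreover have "c \<noteq> 0" using ab c by auto
  ultimately show "levi (log_rho H) p (a, b) > 0" using fefferman_M_pos[OF H pos p(1)] by simp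
qed

lemma fefferman_form_std:
  assumes H: "radial_direction H"
  shows "fefferman_form (sph H) (log_rho H) (std_form H)"
  unfolding fefferman_form_def
proof (intro ballI conjI allI)
  fix p assume "p \<in> sph H"
  then have p: "p \<noteq> 0" "p \<in> - {0}" by (simp_all add: mem_sph_log)
  show "alternating3 (std_form H p)"
    unfolding alternating3_def std_form_def
    by (auto simp: vol4_alternating intro!: linear_compose_scale_right[where 'a=C2 and 'b=real, simplified] linear_vol4)
  fix v1 v2 v3 v4
  have lin: "linear (DD (log_rho H) p)"
    by (rule linear_frechet_derivative[OF smooth_on_differentiable[OF smooth_log_rho[OF H] p(2)]])
  show "wedge31 (std_form H p) (DD (log_rho H) p) v1 v2 v3 v4
        = 2 powr (4/3) * root 3 (fefferman_M (log_rho H) p) * euclidean_volume_form v1 v2 v3 v4"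
  proof -
    have "wedge31 (std_form H p) (DD (log_rho H) p) v1 v2 v3 v4 = fef_density H p *
      (vol4 v1 v2 v3 p * DD (log_rho H) p v4 - vol4 v1 v2 v4 p * DD (log_rho H) p v3
        + vol4 v1 v3 v4 p * DD (log_rho H) p v2 - vol4 v2 v3 v4 p * DD (log_rho H) p v1)"
      unfolding wedge31_def std_form_def by (simp add: algebra_simps)
    also have "\<dots> = fef_density H p * (2 * vol4 v1 v2 v3 v4)"
      unfolding vol4_five_vectors[OF lin] DD_log_rho_self[OF H p(1)] ..
    finally show ?thesis by (simp add: fef_density_def)
  qed
qed

text \<open>Passing from \<open>log_rho H\<close> to \<open>f\<close> multiplies the gradient and the Levi form on the complex tangent line
by the same number \<open>h\<close>, hence \<open>M\<close> by \<open>h\<^sup>3\<close>. The cube root of \<open>M\<close> is multiplied by \<open>h\<close>, which cancels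
in \<open>\<sigma> \<and> df\<close>.\<close>

lemma fefferman_form_unique:
  assumes H: "radial_direction H" and pos: "\<And>x. x \<noteq> 0 \<Longrightarrow> ma_det H x > 0"
    and f: "spc_defining_function (sph H) f" and s: "fefferman_form (sph H) f s"
    and p: "p \<in> sph H"
    and u: "DD (log_rho H) p u = 0" and v: "DD (log_rho H) p v = 0" and w: "DD (log_rho H) p w = 0"
  shows "s p u v w = std_form H p u v w"
proof -
  obtain N where N: "smooth_on N f" "sph H = {p \<in> N. f p = 0}"
    and reg: "\<And>p. p \<in> sph H \<Longrightarrow> \<exists>v. DD f p v \<noteq> 0"
    using f unfolding spc_defining_function_def defining_function_def by blast
  have p0: "p \<noteq> 0" "p \<in> - {0}" using p by (simp_all add: mem_sph_log)
  have pN: "p \<in> N" using p N(2) by simp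
  have df: "f differentiable (at p)" by (rule smooth_on_differentiable[OF N(1) pN])
  have dl: "log_rho H differentiable (at p)" by (rule smooth_on_differentiable[OF smooth_log_rho[OF H] p0(2)])
  define h where "h = DD f p p / 2"
  have grad: "DD f p v = h * DD (log_rho H) p v" for v
    using gradient_of_defining_function[OF H N p0(1), of v] by (simp add: proj_sph[OF p] h_def)
  define t where "t = hol_tangent (log_rho H) p"
  have t: "DD (log_rho H) p t = 0" "DD (log_rho H) p (mult_i t) = 0"
    unfolding t_def by (rule DD_hol_tangent[OF dl])+
  have tf: "hol_tangent f p = (complex_of_real h * fst t, complex_of_real h * snd t)"
    unfolding hol_tangent_def t_def d_hol_real[OF df] d_hol_real[OF dl] grad by (simp add: complex_eq_iff)
  have lev: "levi f p t = h * levi (log_rho H) p t"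
    unfolding levi_eq_D2[OF N(1) pN] levi_eq_D2[OF smooth_log_rho[OF H] p0(2)]
      hessian_of_defining_function[OF H N p t(1)] hessian_of_defining_function[OF H N p t(2)] h_def
    by (simp add: field_simps)
  have lM: "levi (log_rho H) p t = fefferman_M (log_rho H) p"
    unfolding t_def hol_tangent_def by (rule fefferman_M_eq_levi[OF smooth_log_rho[OF H] p0(2), symmetric])
  have Mpos: "fefferman_M (log_rho H) p > 0" by (rule fefferman_M_pos[OF H pos p0(1)])
  \<comment> \<open>Both Levi forms are positive on the complex tangent line, so the two functions increase on the same side.\<close>
  have h0: "h > 0"
  proof -
    have "t \<noteq> 0"
      using hol_tangent_eq_0[OF dl] DD_log_rho_self[OF H p0(1)] unfolding t_def by (metis zero_neq_numeral)
    moreover have "d_hol e1 (\<lambda>q. complex_of_real (f q)) p * fst t + d_hol e2 (\<lambda>q. complex_of_real (f q)) p * snd t = 0"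
      using complex_gradient[OF df, of "fst t" "snd t"] t by (simp add: grad complex_eq_iff)
    ultimately have "levi f p (fst t, snd t) > 0"
      using f p unfolding spc_defining_function_def by (metis prod.collapse zero_prod_def)
    then have "h * fefferman_M (log_rho H) p > 0" using lev lM by simp
    then show ?thesis using Mpos by (simp add: zero_less_mult_iff)
  qed
  have "fefferman_M f p = levi f p (hol_tangent f p)"
    unfolding hol_tangent_def by (rule fefferman_M_eq_levi[OF N(1) pN])
  also have "\<dots> = h\<^sup>2 * (h * fefferman_M (log_rho H) p)"
    unfolding tf levi_cmult using lev lM by simp
  finally have "root 3 (fefferman_M f p) = root 3 (h ^ 3 * fefferman_M (log_rho H) p)"
    by (simp add: power3_eq_cube power2_eq_square mult.assoc)
  also have "\<dots> = h * root 3 (fefferman_M (log_rho H) p)"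
    using h0 by (simp add: real_root_mult real_root_power_cancel)
  finally have root: "root 3 (fefferman_M f p) = h * root 3 (fefferman_M (log_rho H) p)" .
  have "wedge31 (s p) (DD f p) u v w p = 2 powr (4/3) * root 3 (fefferman_M f p) * vol4 u v w p"
    using s p unfolding fefferman_form_def by blast
  then have "s p u v w * (2 * h) = 2 powr (4/3) * (h * root 3 (fefferman_M (log_rho H) p)) * vol4 u v w p"
    unfolding wedge31_def root by (simp add: grad u v w DD_log_rho_self[OF H p0(1)] mult.commute)
  then show ?thesis using h0 unfolding std_form_def fef_density_def by (simp add: field_simps)
qed

lemma tangent_to_sph:
  assumes H: "radial_direction H" and f: "smooth_on U f" "f ` U \<subseteq> sph H" "u \<in> U"
  shows "DD (log_rho H) (f u) (DD f u v) = 0"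
proof -
  have op: "open U" using f by (simp add: smooth_on_def)
  have fu: "f u \<in> - {0}" using f by (auto simp: mem_sph_log)
  have "((\<lambda>u. log_rho H (f u)) has_derivative (\<lambda>v. DD (log_rho H) (f u) (DD f u v))) (at u)"
    by (rule has_derivative_compose[OF smooth_on_has_derivative[OF f(1,3)] smooth_on_has_derivative[OF smooth_log_rho[OF H] fu]])
  moreover have "((\<lambda>u. log_rho H (f u)) has_derivative (\<lambda>v. 0)) (at u)"
    by (rule has_derivative_transform_within_open[where f="\<lambda>_. 0", OF _ op f(3)])
      (use f(2) in \<open>auto simp: mem_sph_log image_subset_iff\<close>)
  ultimately have "(\<lambda>v. DD (log_rho H) (f u) (DD f u v)) = (\<lambda>v. 0)" by (rule has_derivative_unique)
  then show ?thesis by metis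
qed

text \<open>Forms are compared on tangent vectors only, and these are all that a pullback along a
parametrization of the hypersurface sees.\<close>

lemma integration_measure_unique_form:
  assumes H: "radial_direction H" and pos: "\<And>x. x \<noteq> 0 \<Longrightarrow> ma_det H x > 0"
    and f: "spc_defining_function (sph H) f" and s: "fefferman_form (sph H) f s"
  shows "integration_measure (sph H) s = integration_measure (sph H) (std_form H)"
proof -
  have pd: "pullback_density s \<phi> u = pullback_density (std_form H) \<phi> u"
    if "smooth_on U \<phi>" "\<phi> ` U \<subseteq> sph H" "u \<in> U" for U \<phi> u
    unfolding pullback_density_def
    by (rule fefferman_form_unique[OF H pos f s]) (use that tangent_to_sph[OF H that] in auto)
  have "positive_parametrization (sph H) s U \<phi> = positive_parametrization (sph H) (std_form H) U \<phi>" for U \<phi>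
    unfolding positive_parametrization_def using pd[of U \<phi>] by auto
  moreover have "(\<integral>\<^sup>+ u \<in> {u \<in> U. \<phi> u \<in> B}. ennreal (pullback_density s \<phi> u) \<partial>lborel)
     = (\<integral>\<^sup>+ u \<in> {u \<in> U. \<phi> u \<in> B}. ennreal (pullback_density (std_form H) \<phi> u) \<partial>lborel)"
    if "positive_parametrization (sph H) (std_form H) U \<phi>" for U \<phi> B
    using pd[of U \<phi>] that unfolding positive_parametrization_def
    by (intro nn_integral_cong) (auto simp: indicator_def)
  ultimately show ?thesis
    unfolding integration_measure_def fun_eq_iff by (auto)
qed

lemma fefferman_area_sph:
  assumes H: "radial_direction H" and pos: "\<And>x. x \<noteq> 0 \<Longrightarrow> ma_det H x > 0"
  shows "fefferman_area (sph H) = (THE m. \<exists>\<mu>. integration_measure (sph H) (std_form H) \<mu> \<and> m = measure \<mu> (sph H))"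
proof -
  have "(\<exists>f s \<mu>. spc_defining_function (sph H) f \<and> fefferman_form (sph H) f s \<and>
     integration_measure (sph H) s \<mu> \<and> m = measure \<mu> (sph H)) \<longleftrightarrow>
     (\<exists>\<mu>. integration_measure (sph H) (std_form H) \<mu> \<and> m = measure \<mu> (sph H))" for m
    using integration_measure_unique_form[OF H pos] spc_log_rho[OF H pos] fefferman_form_std[OF H] by metis
  then show ?thesis unfolding fefferman_area_def by simp
qed

section \<open>Change of variables\<close>

text \<open>Used to identify \<open>\<complex>\<^sup>2\<close>, \<open>\<real>\<^sup>4\<close> and \<open>\<real>\<^sup>3 \<times> \<real>\<close> as measure spaces.\<close>

lemma lborel_basis_isometry:
  fixes L :: "'a::euclidean_space \<Rightarrow> 'b::euclidean_space"
  assumes L: "bounded_linear L" and b: "bij_betw L Basis Basis"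
  shows "distr lborel borel L = lborel"
proof (rule lborel_eqI[symmetric])
  have lin: "linear L" by (rule bounded_linear.linear[OF L])
  have [measurable]: "L \<in> borel_measurable borel"
    by (rule borel_measurable_continuous_onI[OF linear_continuous_on[OF L]])
  have LB: "L c \<in> Basis" if "c \<in> Basis" for c using b that by (auto simp: bij_betw_def)
  have LL: "L x \<bullet> L c = x \<bullet> c" if "c \<in> Basis" for x c
  proof -
    have "L x = (\<Sum>d\<in>Basis. (x \<bullet> d) *\<^sub>R L d)"
      using euclidean_representation[of x] lin by (metis (no_types, lifting) linear_scale linear_sum sum.cong)
    then have "L x \<bullet> L c = (\<Sum>d\<in>Basis. (x \<bullet> d) * (L d \<bullet> L c))" by (simp add: inner_sum_left)
    also have "\<dots> = (\<Sum>d\<in>Basis. if d = c then x \<bullet> c else 0)"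
      using LB b that by (intro sum.cong refl) (auto simp: inner_Basis bij_betw_def dest: inj_onD)
    finally show ?thesis using that by simp
  qed
  fix l u :: 'b assume lu: "\<And>b. b \<in> Basis \<Longrightarrow> l \<bullet> b \<le> u \<bullet> b"
  define adj where "adj y = (\<Sum>c\<in>Basis. (y \<bullet> L c) *\<^sub>R c)" for y
  have adj: "adj y \<bullet> c = y \<bullet> L c" if "c \<in> Basis" for y c
    using that by (simp add: adj_def inner_sum_left inner_Basis if_distrib cong: if_cong)
  have "L -` box l u = box (adj l) (adj u)"
  proof -
    have "(\<forall>b\<in>Basis. l \<bullet> b < L x \<bullet> b \<and> L x \<bullet> b < u \<bullet> b) \<longleftrightarrow> (\<forall>c\<in>Basis. l \<bullet> L c < L x \<bullet> L c \<and> L x \<bullet> L c < u \<bullet> L c)" for x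
      using b by (auto simp: bij_betw_def) (metis imageE)+
    then show ?thesis by (auto simp: box_def LL adj)
  qed
  then have "emeasure (distr lborel borel L) (box l u) = emeasure lborel (box (adj l) (adj u))"
    by (simp add: emeasure_distr)
  also have "\<dots> = (\<Prod>c\<in>Basis. (adj u - adj l) \<bullet> c)"
    using lu LB by (intro emeasure_lborel_box) (simp add: adj)
  also have "\<dots> = (\<Prod>c\<in>Basis. (u - l) \<bullet> L c)"
    by (simp add: adj inner_diff_left)
  also have "\<dots> = (\<Prod>b\<in>Basis. (u - l) \<bullet> b)"
    using prod.reindex_bij_betw[OF b, of "\<lambda>b. (u - l) \<bullet> b"] by simp
  finally show "emeasure (distr lborel borel L) (box l u) = (\<Prod>b\<in>Basis. (u - l) \<bullet> b)" .
qed simp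

lemma nn_integral_basis_isometry:
  fixes L :: "'a::euclidean_space \<Rightarrow> 'b::euclidean_space"
  assumes L: "bounded_linear L" "bij_betw L Basis Basis" and f: "f \<in> borel_measurable borel"
  shows "(\<integral>\<^sup>+y. f y \<partial>lborel) = (\<integral>\<^sup>+x. f (L x) \<partial>lborel)"
proof -
  have [measurable]: "L \<in> borel_measurable borel"
    by (rule borel_measurable_continuous_onI[OF linear_continuous_on[OF L(1)]])
  have "(\<integral>\<^sup>+y. f y \<partial>lborel) = (\<integral>\<^sup>+y. f y \<partial>distr lborel borel L)" by (simp only: lborel_basis_isometry[OF L])
  also have "\<dots> = (\<integral>\<^sup>+x. f (L x) \<partial>lborel)" using f by (intro nn_integral_distr) auto
  finally show ?thesis .
qed

lemma Basis_real4: "(Basis :: (real^4) set) = {axis 1 1, axis 2 1, axis 3 1, axis 4 1}"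
  by (auto simp: Basis_vec_def UNIV_4)

lemma Basis_real3: "(Basis :: (real^3) set) = {axis 1 1, axis 2 1, axis 3 1}"
  by (auto simp: Basis_vec_def UNIV_3)

definition C2_of :: "real ^ 4 \<Rightarrow> C2" where
  "C2_of y = (Complex (y $ 1) (y $ 2), Complex (y $ 3) (y $ 4))"

lemma C2_of_real_coords [simp]: "C2_of (real_coords v) = v" "real_coords (C2_of y) = y"
  by (simp_all add: C2_of_def vec_eq_iff forall_4 prod_eq_iff)

lemma bounded_linear_C2_of: "bounded_linear C2_of"
proof -
  have "linear C2_of" by (intro linearI) (simp_all add: C2_of_def complex_eq_iff)
  then show ?thesis by (simp add: linear_conv_bounded_linear)
qed

lemma C2_of_axis:
  "C2_of (axis 1 1) = e1" "C2_of (axis 2 1) = mult_i e1" "C2_of (axis 3 1) = e2" "C2_of (axis 4 1) = mult_i e2"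
  by (simp_all add: C2_of_def axis_def e1_def e2_def mult_i_def complex_eq_iff)

lemma Basis_C2: "(Basis :: C2 set) = {e1, mult_i e1, e2, mult_i e2}"
  by (auto simp: Basis_prod_def Basis_complex_def e1_def e2_def mult_i_def)

lemma inj_imp_bij_betw_Basis:
  assumes "inj L" "L ` Basis = Basis"
  shows "bij_betw L Basis Basis"
  using assms by (auto simp: bij_betw_def inj_on_def)

lemma bij_C2_of: "bij_betw C2_of Basis Basis"
proof (rule inj_imp_bij_betw_Basis)
  show "inj C2_of" by (metis injI C2_of_real_coords(2))
  show "C2_of ` Basis = Basis" by (simp add: Basis_real4 Basis_C2 C2_of_axis)
qed

lemma bij_real_coords: "bij_betw real_coords Basis Basis"
proof (rule inj_imp_bij_betw_Basis)
  show "inj real_coords" by (metis injI C2_of_real_coords(1))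
  show "real_coords ` Basis = Basis"
  proof -
    have "real_coords e1 = axis 1 1" "real_coords (mult_i e1) = axis 2 1"
      "real_coords e2 = axis 3 1" "real_coords (mult_i e2) = axis 4 1"
      by (metis C2_of_axis C2_of_real_coords(2))+
    then show ?thesis unfolding Basis_C2 Basis_real4 by simp
  qed
qed

text \<open>The isometry \<open>L\<close> is a system of coordinates on the domain. Transporting both sides by \<open>L\<close> and
\<open>real_coords\<close> turns the claim into the change of variables formula on \<open>\<real>\<^sup>4\<close>.\<close>

lemma emeasure_image_C2:
  fixes \<Phi> :: "'a::euclidean_space \<Rightarrow> C2" and L :: "real ^ 4 \<Rightarrow> 'a"
  assumes L: "bounded_linear L" "bij_betw L Basis Basis" "surj L" "inj L"
    and S: "S \<in> sets borel" and der: "\<And>x. x \<in> S \<Longrightarrow> (\<Phi> has_derivative \<Phi>' x) (at x)" and inj: "inj_on \<Phi> S"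
    and T: "\<Phi> ` S \<in> sets borel" "bounded (\<Phi> ` S)"
    and J: "\<And>x. x \<in> S \<Longrightarrow> J x = \<bar>vol4 (\<Phi>' x (L (axis 1 1))) (\<Phi>' x (L (axis 2 1))) (\<Phi>' x (L (axis 3 1))) (\<Phi>' x (L (axis 4 1)))\<bar>"
    and Jm: "(\<lambda>x. ennreal (J x) * indicator S x) \<in> borel_measurable borel"
  shows "emeasure lborel (\<Phi> ` S) = (\<integral>\<^sup>+x\<in>S. ennreal (J x) \<partial>lborel)"
proof -
  have m [measurable]: "L \<in> borel_measurable borel" "C2_of \<in> borel_measurable borel" "real_coords \<in> borel_measurable borel"
    by (rule borel_measurable_continuous_onI[OF linear_continuous_on], rule L bounded_linear_C2_of bounded_linear_real_coords)+
  define S' where "S' = L -` S"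
  have S': "S' \<in> sets borel" unfolding S'_def by (rule measurable_sets_borel[OF m(1) S])
  define g where "g y = real_coords (\<Phi> (L y))" for y
  have dg: "(g has_derivative (\<lambda>v. real_coords (\<Phi>' (L y) (L v)))) (at y within S')" if "y \<in> S'" for y
  proof -
    have 1: "((\<lambda>y. \<Phi> (L y)) has_derivative (\<lambda>v. \<Phi>' (L y) (L v))) (at y)"
      by (rule has_derivative_compose[OF bounded_linear_imp_has_derivative[OF L(1)] der]) (use that in \<open>simp add: S'_def\<close>)
    show ?thesis unfolding g_def
      by (rule has_derivative_at_withinI[OF bounded_linear.has_derivative[OF bounded_linear_real_coords 1]])
  qed
  have injg: "inj_on g S'"
  proof (rule inj_onI)
    fix x y assume xy: "x \<in> S'" "y \<in> S'" "g x = g y"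
    then have "\<Phi> (L x) = \<Phi> (L y)" unfolding g_def by (metis C2_of_real_coords(1))
    then have "L x = L y" using inj xy by (auto simp: S'_def inj_on_def)
    then show "x = y" using L(4) by (simp add: inj_eq)
  qed
  have img: "g ` S' = real_coords ` (\<Phi> ` S)"
  proof -
    have "L ` S' = S" unfolding S'_def using L(3) by (simp add: surj_image_vimage_eq)
    then show ?thesis unfolding g_def by (metis image_image)
  qed
  have img2: "real_coords ` (\<Phi> ` S) = C2_of -` (\<Phi> ` S)" by (auto simp: image_iff) (metis C2_of_real_coords(2))
  have T': "g ` S' \<in> sets borel" unfolding img img2 by (rule measurable_sets_borel[OF m(2) T(1)])
  have bd: "bounded (g ` S')" unfolding img by (rule bounded_linear_image[OF T(2) bounded_linear_real_coords])
  have fin: "emeasure lborel (g ` S') < \<infinity>" by (rule emeasure_bounded_finite[OF bd])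
  then have lm: "g ` S' \<in> lmeasurable" using T' by (simp add: fmeasurable_def)
  have det: "\<bar>det (matrix (\<lambda>v. real_coords (\<Phi>' (L y) (L v))))\<bar> = J (L y)" if "y \<in> S'" for y
  proof -
    have "transpose (matrix (\<lambda>v. real_coords (\<Phi>' (L y) (L v)))) =
       vector [real_coords (\<Phi>' (L y) (L (axis 1 1))), real_coords (\<Phi>' (L y) (L (axis 2 1))),
         real_coords (\<Phi>' (L y) (L (axis 3 1))), real_coords (\<Phi>' (L y) (L (axis 4 1)))]"
      by (simp add: vec_eq_iff forall_4 transpose_def matrix_def)
    then have "det (matrix (\<lambda>v. real_coords (\<Phi>' (L y) (L v)))) =
       vol4 (\<Phi>' (L y) (L (axis 1 1))) (\<Phi>' (L y) (L (axis 2 1))) (\<Phi>' (L y) (L (axis 3 1))) (\<Phi>' (L y) (L (axis 4 1)))"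
      unfolding euclidean_volume_form_def by (metis det_transpose)
    then show ?thesis using J[of "L y"] that by (simp add: S'_def)
  qed
  have S'l: "S' \<in> sets lebesgue" using S' by simp
  have "((\<lambda>y. \<bar>det (matrix (\<lambda>v. real_coords (\<Phi>' (L y) (L v))))\<bar>) has_integral measure lebesgue (g ` S')) S'"
    using has_measure_differentiable_image[OF S'l dg injg, of "measure lebesgue (g ` S')"] lm by blast
  then have "((\<lambda>y. J (L y)) has_integral measure lebesgue (g ` S')) S'"
    by (rule has_integral_eq[rotated]) (simp add: det)
  then have "(\<integral>\<^sup>+y. ennreal (J (L y)) * indicator S' y \<partial>lborel) = ennreal (measure lebesgue (g ` S'))"
    by (intro nn_integral_has_integral_lebesgue') (simp_all flip: det)
  also have "\<dots> = emeasure lborel (g ` S')"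
    using fin T' by (simp add: measure_def)
  also have "\<dots> = emeasure (distr lborel borel real_coords) (g ` S')"
    by (simp only: lborel_basis_isometry[OF bounded_linear_real_coords bij_real_coords])
  also have "\<dots> = emeasure lborel (real_coords -` (g ` S'))" using T' by (simp add: emeasure_distr)
  also have "real_coords -` (g ` S') = \<Phi> ` S" unfolding img by (auto simp: image_iff) (metis C2_of_real_coords(1))
  finally have "emeasure lborel (\<Phi> ` S) = (\<integral>\<^sup>+y. ennreal (J (L y)) * indicator S (L y) \<partial>lborel)"
    by (simp add: S'_def indicator_def vimage_def)
  then show ?thesis using nn_integral_basis_isometry[OF L(1,2) Jm] by simp
qed

text \<open>By \<open>emeasure_image_C2\<close>, the push-forward of the Jacobian density and the restriction of Lebesgue
measure to the image are the same measure; integrate \<open>f\<close> against both.\<close>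

proposition nn_integral_change_of_variables_C2:
  fixes \<Phi> :: "'a::euclidean_space \<Rightarrow> C2" and L :: "real ^ 4 \<Rightarrow> 'a" and f :: "C2 \<Rightarrow> ennreal"
  assumes L: "bounded_linear L" "bij_betw L Basis Basis" "surj L" "inj L"
    and S: "S \<in> sets borel" and der: "\<And>x. x \<in> S \<Longrightarrow> (\<Phi> has_derivative \<Phi>' x) (at x)" and inj: "inj_on \<Phi> S"
    and T: "\<Phi> ` S \<in> sets borel" "bounded (\<Phi> ` S)"
    and J: "\<And>x. x \<in> S \<Longrightarrow> J x = \<bar>vol4 (\<Phi>' x (L (axis 1 1))) (\<Phi>' x (L (axis 2 1))) (\<Phi>' x (L (axis 3 1))) (\<Phi>' x (L (axis 4 1)))\<bar>"
    and Jc: "continuous_on S J"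
    and f: "f \<in> borel_measurable borel"
  shows "(\<integral>\<^sup>+y\<in>\<Phi> ` S. f y \<partial>lborel) = (\<integral>\<^sup>+x\<in>S. f (\<Phi> x) * ennreal (J x) \<partial>lborel)"
proof -
  have Jm [measurable]: "(\<lambda>x. ennreal (J x) * indicator S x) \<in> borel_measurable borel"
  proof -
    have "(\<lambda>x. ennreal (indicator S x *\<^sub>R J x)) \<in> borel_measurable borel"
      using borel_measurable_continuous_on_indicator[OF S Jc] by measurable
    also have "(\<lambda>x. ennreal (indicator S x *\<^sub>R J x)) = (\<lambda>x. ennreal (J x) * indicator S x)"
      by (auto simp: fun_eq_iff indicator_def)
    finally show ?thesis .
  qed
  define \<Phi>0 where "\<Phi>0 x = indicator S x *\<^sub>R \<Phi> x" for x
  have "continuous_on S \<Phi>"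
    by (rule continuous_at_imp_continuous_on) (use der has_derivative_continuous in blast)
  then have m0 [measurable]: "\<Phi>0 \<in> borel_measurable borel"
    unfolding \<Phi>0_def by (rule borel_measurable_continuous_on_indicator[OF S])
  have m0': "\<Phi>0 \<in> lborel \<rightarrow>\<^sub>M borel" using m0 by simp
  have [measurable]: "\<Phi> ` S \<in> sets borel" "S \<in> sets borel" "f \<in> borel_measurable borel" by fact+
  have "distr (density lborel (\<lambda>x. ennreal (J x) * indicator S x)) borel \<Phi>0 = density lborel (indicator (\<Phi> ` S))"
  proof (rule measure_eqI)
    fix B assume "B \<in> sets (distr (density lborel (\<lambda>x. ennreal (J x) * indicator S x)) borel \<Phi>0)"
    then have B [measurable]: "B \<in> sets borel" by simp
    define SB where "SB = S \<inter> \<Phi>0 -` B"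
    have SB: "SB \<in> sets borel" unfolding SB_def using m0 by (simp add: measurable_sets_borel S)
    have im: "\<Phi> ` SB = \<Phi> ` S \<inter> B" by (auto simp: SB_def \<Phi>0_def)
    have "emeasure (distr (density lborel (\<lambda>x. ennreal (J x) * indicator S x)) borel \<Phi>0) B
      = (\<integral>\<^sup>+x. ennreal (J x) * indicator S x * indicator (\<Phi>0 -` B) x \<partial>lborel)"
      by (simp add: emeasure_distr emeasure_density measurable_sets_borel[OF m0])
    also have "\<dots> = (\<integral>\<^sup>+x\<in>SB. ennreal (J x) \<partial>lborel)"
      by (intro nn_integral_cong) (auto simp: SB_def indicator_def)
    also have "\<dots> = emeasure lborel (\<Phi> ` SB)"
    proof (rule emeasure_image_C2[OF L SB der, symmetric])
      have "(\<lambda>x. (ennreal (J x) * indicator S x) * indicator SB x) \<in> borel_measurable borel"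
        using SB by measurable
      also have "(\<lambda>x. (ennreal (J x) * indicator S x) * indicator SB x) = (\<lambda>x. ennreal (J x) * indicator SB x)"
        by (auto simp: fun_eq_iff SB_def indicator_def)
      finally show "(\<lambda>x. ennreal (J x) * indicator SB x) \<in> borel_measurable borel" .
      show "\<Phi> ` SB \<in> sets borel" unfolding im by simp
      show "bounded (\<Phi> ` SB)" unfolding im using T(2) bounded_Int by blast
      show "inj_on \<Phi> SB" using inj by (auto simp: SB_def inj_on_def)
    qed (use J in \<open>auto simp: SB_def\<close>)
    also have "\<dots> = emeasure (density lborel (indicator (\<Phi> ` S))) B"
      unfolding im by (simp add: emeasure_density indicator_inter_arith[symmetric])
    finally show "emeasure (distr (density lborel (\<lambda>x. ennreal (J x) * indicator S x)) borel \<Phi>0) B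
       = emeasure (density lborel (indicator (\<Phi> ` S))) B" .
  qed simp
  then have "(\<integral>\<^sup>+y. f y \<partial>density lborel (indicator (\<Phi> ` S))) =
     (\<integral>\<^sup>+y. f y \<partial>distr (density lborel (\<lambda>x. ennreal (J x) * indicator S x)) borel \<Phi>0)" by simp
  also have "\<dots> = (\<integral>\<^sup>+x. ennreal (J x) * indicator S x * f (\<Phi>0 x) \<partial>lborel)"
    using m0' by (simp add: nn_integral_distr nn_integral_density)
  also have "\<dots> = (\<integral>\<^sup>+x\<in>S. f (\<Phi> x) * ennreal (J x) \<partial>lborel)"
    by (intro nn_integral_cong) (auto simp: indicator_def \<Phi>0_def mult.commute)
  also have "(\<integral>\<^sup>+y. f y \<partial>density lborel (indicator (\<Phi> ` S))) = (\<integral>\<^sup>+y\<in>\<Phi> ` S. f y \<partial>lborel)"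
    by (simp add: nn_integral_density mult.commute)
  finally show ?thesis .
qed

definition split_last :: "real ^ 4 \<Rightarrow> (real ^ 3) \<times> real" where
  "split_last y = (vector [y $ 1, y $ 2, y $ 3], y $ 4)"

lemma split_last_iso:
  "bounded_linear split_last" "bij_betw split_last Basis Basis" "surj split_last" "inj split_last"
proof -
  have "linear split_last"
    by (intro linearI) (simp_all add: split_last_def vec_eq_iff forall_3)
  then show "bounded_linear split_last" by (simp add: linear_conv_bounded_linear)
  show inj: "inj split_last"
    by (intro injI) (simp add: split_last_def vec_eq_iff forall_3 forall_4)
  show "surj split_last"
  proof (rule surjI)
    fix x show "split_last (vector [fst x $ 1, fst x $ 2, fst x $ 3, snd x]) = x"
      by (simp add: split_last_def prod_eq_iff vec_eq_iff forall_3)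
  qed
  have "split_last ` Basis = Basis"
    unfolding Basis_real4 Basis_prod_def Basis_real3
    by (simp add: split_last_def axis_def vec_eq_iff forall_3 image_insert) (auto simp: vec_eq_iff forall_3 axis_def)
  then show "bij_betw split_last Basis Basis" by (rule inj_imp_bij_betw_Basis[OF inj])
qed

lemma split_last_axis:
  "split_last (axis 1 1) = (axis 1 1, 0)" "split_last (axis 2 1) = (axis 2 1, 0)"
  "split_last (axis 3 1) = (axis 3 1, 0)" "split_last (axis 4 1) = (0, 1)"
  by (simp_all add: split_last_def axis_def vec_eq_iff forall_3)

lemma C2_of_iso: "surj C2_of" "inj C2_of"
  by (metis surjI C2_of_real_coords(1)) (metis injI C2_of_real_coords(2))

abbreviation cone_jacobian :: "(real ^ 3 \<Rightarrow> C2) \<Rightarrow> real ^ 3 \<Rightarrow> real" where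
  "cone_jacobian \<phi> u \<equiv> vol4 (DD \<phi> u (axis 1 1)) (DD \<phi> u (axis 2 1)) (DD \<phi> u (axis 3 1)) (\<phi> u)"

text \<open>The map \<open>(u, t) \<mapsto> t \<phi>(u)\<close> has Jacobian \<open>t\<^sup>3\<close> times \<open>cone_jacobian\<close>. The ray through \<open>\<phi>(u)\<close> leaves the
unit ball at \<open>t = 1 / |\<phi>(u)|\<close>, and the integral of \<open>t\<^sup>3\<close> up to there is \<open>1 / (4 |\<phi>(u)|\<^sup>4)\<close>.\<close>

proposition nn_integral_cone:
  fixes \<phi> :: "real ^ 3 \<Rightarrow> C2" and f :: "C2 \<Rightarrow> ennreal"
  assumes U: "U \<in> sets borel" and d: "\<And>u. u \<in> U \<Longrightarrow> (\<phi> has_derivative DD \<phi> u) (at u)"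
    and c: "\<And>i. continuous_on U (\<lambda>u. DD \<phi> u (axis i 1))"
    and nz: "\<And>u. u \<in> U \<Longrightarrow> \<phi> u \<noteq> 0"
    and inj: "\<And>u v t. u \<in> U \<Longrightarrow> v \<in> U \<Longrightarrow> t > 0 \<Longrightarrow> \<phi> u = t *\<^sub>R \<phi> v \<Longrightarrow> u = v"
    and T: "T = {t *\<^sub>R \<phi> u | u t. u \<in> U \<and> 0 < t \<and> t * norm (\<phi> u) < 1}" "T \<in> sets borel"
    and f: "f \<in> borel_measurable borel" and rad: "\<And>u t. u \<in> U \<Longrightarrow> t > 0 \<Longrightarrow> f (t *\<^sub>R \<phi> u) = f (\<phi> u)"
  shows "(\<integral>\<^sup>+y\<in>T. f y \<partial>lborel) =
    (\<integral>\<^sup>+u\<in>U. f (\<phi> u) * ennreal (\<bar>cone_jacobian \<phi> u\<bar> / (4 * norm (\<phi> u) ^ 4)) \<partial>lborel)"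
proof -
  define S where "S = {(u, t). u \<in> U \<and> 0 < t \<and> t * norm (\<phi> u) < 1}"
  define \<Phi> where "\<Phi> = (\<lambda>(u, t). t *\<^sub>R \<phi> u)"
  define V where "V u = \<bar>cone_jacobian \<phi> u\<bar>" for u
  have contp: "continuous_on U \<phi>"
    by (rule continuous_at_imp_continuous_on) (use d has_derivative_continuous in blast)
  have mp: "(\<lambda>u. indicator U u *\<^sub>R \<phi> u) \<in> borel_measurable borel"
    by (rule borel_measurable_continuous_on_indicator[OF U contp])
  have S: "S \<in> sets borel"
  proof -
    have "S = (U \<times> UNIV) \<inter> {p. 0 < snd p \<and> snd p * norm (indicator U (fst p) *\<^sub>R \<phi> (fst p)) < 1}"
      by (auto simp: S_def)
    moreover have "{p \<in> space (borel \<Otimes>\<^sub>M borel). 0 < snd p \<and> snd p * norm (indicator U (fst p) *\<^sub>R \<phi> (fst p)) < (1::real)} \<in> sets (borel \<Otimes>\<^sub>M borel)"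
      using mp by measurable
    ultimately show ?thesis using U by (auto simp: borel_prod[symmetric] space_pair_measure)
  qed
  have img: "\<Phi> ` S = T" unfolding T(1) \<Phi>_def S_def by force
  have injP: "inj_on \<Phi> S"
  proof (rule inj_onI, clarsimp simp: S_def \<Phi>_def)
    fix u s v t assume uv: "u \<in> U" "v \<in> U" "0 < s" "0 < t" "s *\<^sub>R \<phi> u = t *\<^sub>R \<phi> v"
    have "\<phi> u = (inverse s * s) *\<^sub>R \<phi> u" using uv by simp
    also have "\<dots> = (inverse s * t) *\<^sub>R \<phi> v" using uv(5) by (metis scaleR_scaleR)
    finally have "u = v" using inj[of u v "inverse s * t"] uv by simp
    then show "u = v \<and> s = t" using uv nz by simp
  qed
  define \<Phi>' where "\<Phi>' p h = snd p *\<^sub>R DD \<phi> (fst p) (fst h) + snd h *\<^sub>R \<phi> (fst p)" for p h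
  have der: "(\<Phi> has_derivative \<Phi>' p) (at p)" if "p \<in> S" for p
  proof -
    have "((\<lambda>p. \<phi> (fst p)) has_derivative (\<lambda>h. DD \<phi> (fst p) (fst h))) (at p)"
      by (rule has_derivative_compose[OF has_derivative_fst[OF has_derivative_ident] d]) (use that in \<open>auto simp: S_def\<close>)
    from has_derivative_scaleR[OF has_derivative_snd[OF has_derivative_ident] this]
    show ?thesis unfolding \<Phi>_def \<Phi>'_def by (simp add: case_prod_unfold)
  qed
  have bd: "bounded (\<Phi> ` S)"
    unfolding bounded_iff by (rule exI[of _ 1]) (auto simp: S_def \<Phi>_def)
  have J: "snd p ^ 3 * V (fst p) = \<bar>vol4 (\<Phi>' p (split_last (axis 1 1))) (\<Phi>' p (split_last (axis 2 1))) (\<Phi>' p (split_last (axis 3 1))) (\<Phi>' p (split_last (axis 4 1)))\<bar>"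
    if "p \<in> S" for p
  proof -
    have lin: "linear (DD \<phi> (fst p))"
      using d[of "fst p"] that by (auto simp: S_def has_derivative_linear)
    have "vol4 (\<Phi>' p (split_last (axis 1 1))) (\<Phi>' p (split_last (axis 2 1))) (\<Phi>' p (split_last (axis 3 1))) (\<Phi>' p (split_last (axis 4 1)))
      = snd p ^ 3 * vol4 (DD \<phi> (fst p) (axis 1 1)) (DD \<phi> (fst p) (axis 2 1)) (DD \<phi> (fst p) (axis 3 1)) (\<phi> (fst p))"
      unfolding split_last_axis \<Phi>'_def
      by (simp add: linear_0[OF lin] linear_scale[OF linear_vol4(1)] linear_scale[OF linear_vol4(2)]
          linear_scale[OF linear_vol4(3)] power3_eq_cube)
    then show ?thesis using that by (auto simp: V_def abs_mult S_def)
  qed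
  have contV: "continuous_on U V"
    unfolding V_def vol4_expand
    by (intro continuous_intros c contp)
  have "continuous_on S (\<lambda>p. V (fst p))"
    by (rule continuous_on_compose2[OF contV]) (auto intro: continuous_intros simp: S_def)
  then have Jc: "continuous_on S (\<lambda>p. snd p ^ 3 * V (fst p))" by (intro continuous_intros)
  have "(\<integral>\<^sup>+y\<in>T. f y \<partial>lborel) = (\<integral>\<^sup>+p\<in>S. f (\<Phi> p) * ennreal (snd p ^ 3 * V (fst p)) \<partial>lborel)"
    using nn_integral_change_of_variables_C2[OF split_last_iso S der injP _ bd J Jc f] T(2) unfolding img by blast
  also have "\<dots> = (\<integral>\<^sup>+p. f (indicator U (fst p) *\<^sub>R \<phi> (fst p)) * (ennreal (indicator U (fst p) *\<^sub>R V (fst p)) * ennreal (snd p ^ 3)) * indicator S p \<partial>(lborel \<Otimes>\<^sub>M lborel))"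
    unfolding lborel_prod
    by (intro nn_integral_cong) (auto simp: indicator_def S_def \<Phi>_def rad ennreal_mult[symmetric] mult.commute V_def)
  also have "\<dots> = (\<integral>\<^sup>+u. \<integral>\<^sup>+t. f (indicator U u *\<^sub>R \<phi> u) * (ennreal (indicator U u *\<^sub>R V u) * ennreal (t ^ 3)) * indicator S (u, t) \<partial>lborel \<partial>lborel)"
  proof (subst lborel.nn_integral_fst[symmetric])
    have [measurable]: "(\<lambda>u. indicator U u *\<^sub>R V u) \<in> borel_measurable borel"
      by (rule borel_measurable_continuous_on_indicator[OF U contV])
    note mp [measurable] f [measurable] S [measurable]
    have [measurable]: "S \<in> sets (lborel \<Otimes>\<^sub>M lborel)" 
    proof -
      have "sets (lborel \<Otimes>\<^sub>M lborel :: ((real ^ 3) \<times> real) measure) = sets (borel \<Otimes>\<^sub>M borel)"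
        by (rule sets_pair_measure_cong) simp_all
      then show ?thesis using S[folded borel_prod] by simp
    qed
    show "(\<lambda>p. f (indicator U (fst p) *\<^sub>R \<phi> (fst p)) * (ennreal (indicator U (fst p) *\<^sub>R V (fst p)) * ennreal (snd p ^ 3)) * indicator S p) \<in> borel_measurable (lborel \<Otimes>\<^sub>M lborel)"
      by measurable
  qed simp
  also have "\<dots> = (\<integral>\<^sup>+u\<in>U. f (\<phi> u) * ennreal (V u / (4 * norm (\<phi> u) ^ 4)) \<partial>lborel)"
  proof (rule nn_integral_cong)
    fix u :: "real ^ 3"
    show "(\<integral>\<^sup>+t. f (indicator U u *\<^sub>R \<phi> u) * (ennreal (indicator U u *\<^sub>R V u) * ennreal (t ^ 3)) * indicator S (u, t) \<partial>lborel)
       = f (\<phi> u) * ennreal (V u / (4 * norm (\<phi> u) ^ 4)) * indicator U u"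
    proof (cases "u \<in> U")
      case True
      define a where "a = 1 / norm (\<phi> u)"
      have a: "a > 0" using nz[OF True] by (simp add: a_def)
      have Sa: "indicator S (u, t) = (indicator {0<..<a} t :: ennreal)" for t
        using True nz[OF True] by (auto simp: S_def a_def indicator_def pos_less_divide_eq)
      have "((\<lambda>t::real. t ^ 3) has_integral (a ^ 4 / 4 - 0 ^ 4 / 4)) {0..a}"
        by (rule fundamental_theorem_of_calculus)
          (use a in \<open>auto intro!: derivative_eq_intros simp flip: has_real_derivative_iff_has_vector_derivative\<close>)
      then have "((\<lambda>t::real. t ^ 3) has_integral (a ^ 4 / 4)) {0<..<a}"
        using has_integral_Icc_iff_Ioo by (metis diff_zero power_zero_numeral div_0)
      then have int: "(\<integral>\<^sup>+t. ennreal (t ^ 3) * indicator {0<..<a} t \<partial>lborel) = ennreal (a ^ 4 / 4)"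
        by (intro nn_integral_has_integral_lebesgue') auto
      have "(\<integral>\<^sup>+t. f (indicator U u *\<^sub>R \<phi> u) * (ennreal (indicator U u *\<^sub>R V u) * ennreal (t ^ 3)) * indicator S (u, t) \<partial>lborel)
        = (\<integral>\<^sup>+t. (f (\<phi> u) * ennreal (V u)) * (ennreal (t ^ 3) * indicator {0<..<a} t) \<partial>lborel)"
        unfolding Sa using True by (simp add: mult.assoc)
      also have "\<dots> = f (\<phi> u) * ennreal (V u) * ennreal (a ^ 4 / 4)"
        by (subst nn_integral_cmult) (simp_all add: int)
      also have "\<dots> = f (\<phi> u) * ennreal (V u / (4 * norm (\<phi> u) ^ 4))"
        by (simp add: mult.assoc ennreal_mult[symmetric] V_def a_def power_divide mult.commute[of 4])
      finally show ?thesis using True by simp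
    qed simp
  qed
  finally show ?thesis unfolding V_def .
qed

section \<open>Fefferman's measure on a perturbed sphere\<close>

lemma radial_bounded:
  assumes "radial_direction G"
  obtains C where "C > 0" "\<And>x. x \<noteq> 0 \<Longrightarrow> \<bar>G x\<bar> \<le> C"
proof -
  have "continuous_on (sphere 0 1) G"
    by (rule continuous_on_subset[OF smooth_on_continuous[OF radial_smooth[OF assms]]]) auto
  then have "compact (G ` sphere 0 1)" by (rule compact_continuous_image) simp
  then obtain C where C: "C > 0" "\<And>y. y \<in> G ` sphere 0 1 \<Longrightarrow> norm y \<le> C"
    using compact_imp_bounded bounded_pos by metis
  have "\<bar>G x\<bar> \<le> C" if "x \<noteq> 0" for x
  proof -
    have "G ((1 / norm x) *\<^sub>R x) = G x" using that by (intro radial_scale[OF assms]) simp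
    moreover have "(1 / norm x) *\<^sub>R x \<in> sphere 0 1" using that by simp
    ultimately show ?thesis using C(2) by (metis imageI real_norm_def)
  qed
  then show ?thesis using that C(1) by blast
qed

lemma borel_measurable_punctured:
  fixes f :: "C2 \<Rightarrow> 'b::topological_space"
  shows "continuous_on (- {0}) f \<Longrightarrow> f \<in> borel_measurable borel"
  by (rule borel_measurable_continuous_countable_exceptions[of "{0}"]) auto

lemma radial_measurable: "radial_direction G \<Longrightarrow> G \<in> borel_measurable borel"
  by (rule borel_measurable_punctured[OF smooth_on_continuous[OF radial_smooth]])

lemma proj_measurable: "radial_direction H \<Longrightarrow> proj H \<in> borel_measurable borel"
  by (rule borel_measurable_punctured[OF smooth_on_continuous[OF smooth_proj]])

lemma sph_borel: "radial_direction H \<Longrightarrow> sph H \<in> sets borel"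
proof -
  assume "radial_direction H"
  note [measurable] = radial_measurable[OF this]
  have "sph H = {p \<in> space borel. exp (H p) * (p \<bullet> p) = 1}" by (auto simp: mem_sph)
  also have "\<dots> \<in> sets borel" by measurable
  finally show ?thesis .
qed

definition punctured_ball :: "C2 set" where "punctured_ball = ball 0 1 - {0}"

lemma mem_punctured_ball: "x \<in> punctured_ball \<longleftrightarrow> x \<noteq> 0 \<and> norm x < 1"
  by (auto simp: punctured_ball_def)

lemma punctured_ball_borel [measurable, simp]: "punctured_ball \<in> sets borel"
  by (simp add: punctured_ball_def)

text \<open>The ray-constant function whose integral over the cone on a patch is the area of the patch. The
exponent \<open>7/3\<close> comes from \<open>4 \<cdot> 2\<^sup>4\<^sup>/\<^sup>3 / 2\<close>: the 4 undoes the integral of \<open>t\<^sup>3\<close>, and the 2 is the value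
of \<open>d(log_rho H)\<close> on the radial vector.\<close>

definition cone_weight :: "(C2 \<Rightarrow> real) \<Rightarrow> C2 \<Rightarrow> real" where
  "cone_weight H x = 2 powr (7/3) * exp (- (4/3) * H x) * root 3 (ma_det H x)"

lemma cone_weight_measurable:
  assumes H: "radial_direction H" shows "cone_weight H \<in> borel_measurable borel"
  unfolding cone_weight_def
  by (intro borel_measurable_punctured continuous_intros smooth_on_continuous radial_smooth radial_ma_det H)

lemma cone_weight_scale: "radial_direction H \<Longrightarrow> t > 0 \<Longrightarrow> cone_weight H (t *\<^sub>R x) = cone_weight H x"
  by (simp add: cone_weight_def radial_scale radial_ma_det)

lemma cone_weight_sph:
  assumes H: "radial_direction H" and p: "p \<in> sph H"
  shows "cone_weight H p = 4 * fef_density H p * norm p ^ 4"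
proof -
  have p0: "p \<noteq> 0" using p by (simp add: mem_sph_log)
  have pp: "p \<bullet> p = exp (- H p)" using p by (simp add: mem_sph exp_minus field_simps)
  have "root 3 (ma_det H p) = root 3 ((p \<bullet> p)\<^sup>2) * root 3 (fefferman_M (log_rho H) p)"
    unfolding fefferman_M_log_rho[OF H p0, symmetric] by (simp add: real_root_mult)
  also have "(p \<bullet> p)\<^sup>2 = exp (- (2/3) * H p) ^ 3"
    unfolding pp by (simp flip: exp_of_nat_mult)
  also have "root 3 \<dots> = exp (- (2/3) * H p)" by (rule real_root_power_cancel) simp_all
  finally have r: "root 3 (ma_det H p) = exp (- (2/3) * H p) * root 3 (fefferman_M (log_rho H) p)" .
  have n4: "norm p ^ 4 = exp (- (4/3) * H p) * exp (- (2/3) * H p)"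
  proof -
    have "norm p ^ 4 = (p \<bullet> p)\<^sup>2" by (simp add: power2_norm_eq_inner[symmetric])
    also have "\<dots> = exp (- (4/3) * H p) * exp (- (2/3) * H p)"
      unfolding pp by (simp flip: exp_of_nat_mult exp_add)
    finally show ?thesis .
  qed
  have two: "(2::real) powr (7/3) = 2 * 2 powr (4/3)"
    using powr_add[of "2::real" 1 "4/3"] by simp
  show ?thesis unfolding cone_weight_def r n4 fef_density_def two by simp
qed

definition fef_measure :: "(C2 \<Rightarrow> real) \<Rightarrow> C2 measure" where
  "fef_measure H = distr (density lborel (\<lambda>x. ennreal (cone_weight H x) * indicator punctured_ball x)) borel (proj H)"

lemma emeasure_fef_measure:
  assumes H: "radial_direction H" and B: "B \<in> sets borel"
  shows "emeasure (fef_measure H) B = (\<integral>\<^sup>+x\<in>punctured_ball \<inter> proj H -` B. ennreal (cone_weight H x) \<partial>lborel)"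
proof -
  note [measurable] = proj_measurable[OF H] cone_weight_measurable[OF H] B
  have PB: "proj H -` B \<in> sets borel" by (rule measurable_sets_borel[OF proj_measurable[OF H] B])
  have "emeasure (fef_measure H) B = (\<integral>\<^sup>+x. ennreal (cone_weight H x) * indicator punctured_ball x * indicator (proj H -` B) x \<partial>lborel)"
    unfolding fef_measure_def using PB by (simp add: emeasure_distr emeasure_density)
  also have "\<dots> = (\<integral>\<^sup>+x\<in>punctured_ball \<inter> proj H -` B. ennreal (cone_weight H x) \<partial>lborel)"
    by (intro nn_integral_cong) (auto simp: indicator_def)
  finally show ?thesis .
qed

lemma fef_density_pos:
  assumes "radial_direction H" "\<And>x. x \<noteq> 0 \<Longrightarrow> ma_det H x > 0" "p \<in> sph H"
  shows "fef_density H p > 0"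
  using fefferman_M_pos[OF assms(1,2)] assms(3) by (simp add: fef_density_def mem_sph_log)

text \<open>The part of the ball that projects into \<open>B\<close> is the cone on the parametrized piece, so
\<open>nn_integral_cone\<close> applies to every parametrization at once.\<close>

proposition integration_measure_fef_measure:
  assumes H: "radial_direction H" and pos: "\<And>x. x \<noteq> 0 \<Longrightarrow> ma_det H x > 0"
  shows "integration_measure (sph H) (std_form H) (fef_measure H)"
  unfolding integration_measure_def
proof (intro conjI allI impI)
  show "sets (fef_measure H) = sets borel" by (simp add: fef_measure_def)
  have c: "- sph H \<in> sets borel" using sph_borel[OF H] by (simp add: Compl_in_sets_lebesgue borel_comp)
  have "proj H x \<in> sph H" if "x \<in> punctured_ball" for x
    using proj_in_sph[OF H] that by (simp add: mem_punctured_ball)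
  then have "punctured_ball \<inter> proj H -` (- sph H) = {}" by blast
  then show "emeasure (fef_measure H) (- sph H) = 0"
    unfolding emeasure_fef_measure[OF H c] by simp
next
  fix U \<phi> B
  assume par: "positive_parametrization (sph H) (std_form H) U \<phi>" and B: "B \<in> sets borel" and BU: "B \<subseteq> \<phi> ` U"
  have sm: "smooth_on U \<phi>" and inj: "inj_on \<phi> U" and im: "\<phi> ` U \<subseteq> sph H"
    and dens: "\<And>u. u \<in> U \<Longrightarrow> pullback_density (std_form H) \<phi> u > 0"
    using par by (auto simp: positive_parametrization_def)
  have U: "U \<in> sets borel" using sm by (simp add: smooth_on_def)
  define U' where "U' = {u \<in> U. \<phi> u \<in> B}"
  have U': "U' \<in> sets borel"
  proof -
    have "U' = U \<inter> (\<lambda>u. indicator U u *\<^sub>R \<phi> u) -` B" by (auto simp: U'_def)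
    also have "\<dots> \<in> sets borel"
      by (intro sets.Int U measurable_sets_borel[OF borel_measurable_continuous_on_indicator[OF U smooth_on_continuous[OF sm]] B])
    finally show ?thesis .
  qed
  have phi: "\<phi> u \<in> sph H" "\<phi> u \<noteq> 0" "proj H (\<phi> u) = \<phi> u" if "u \<in> U" for u
    using im that by (auto simp: mem_sph_log proj_sph)
  define T where "T = punctured_ball \<inter> proj H -` B"
  have T: "T = {t *\<^sub>R \<phi> u | u t. u \<in> U' \<and> 0 < t \<and> t * norm (\<phi> u) < 1}"
  proof (intro equalityI subsetI)
    fix x assume "x \<in> T"
    then have x: "x \<noteq> 0" "norm x < 1" "proj H x \<in> B" by (auto simp: T_def punctured_ball_def)
    then obtain u where u: "u \<in> U" "proj H x = \<phi> u" using BU by auto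
    define t where "t = exp (log_rho H x / 2)"
    have xt: "x = t *\<^sub>R \<phi> u"
      unfolding u(2)[symmetric] by (simp add: proj_def t_def flip: exp_add)
    moreover have "u \<in> U'" using u x by (simp add: U'_def)
    moreover have "0 < t" by (simp add: t_def)
    moreover have "t * norm (\<phi> u) < 1" using x(2) \<open>0 < t\<close> unfolding xt by simp
    ultimately show "x \<in> {t *\<^sub>R \<phi> u | u t. u \<in> U' \<and> 0 < t \<and> t * norm (\<phi> u) < 1}" by blast
  next
    fix x assume "x \<in> {t *\<^sub>R \<phi> u | u t. u \<in> U' \<and> 0 < t \<and> t * norm (\<phi> u) < 1}"
    then obtain u t where u: "u \<in> U'" "0 < t" "t * norm (\<phi> u) < 1" and x: "x = t *\<^sub>R \<phi> u" by blast
    then have "u \<in> U" "\<phi> u \<in> B" by (auto simp: U'_def)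
    then show "x \<in> T" using u phi by (auto simp: T_def punctured_ball_def x proj_scale[OF H])
  qed
  have Tb: "T \<in> sets borel"
    unfolding T_def by (intro sets.Int measurable_sets_borel[OF proj_measurable[OF H] B]) simp
  have "emeasure (fef_measure H) B = (\<integral>\<^sup>+x\<in>T. ennreal (cone_weight H x) \<partial>lborel)"
    unfolding T_def by (rule emeasure_fef_measure[OF H B])
  also have "\<dots> = (\<integral>\<^sup>+u\<in>U'. ennreal (cone_weight H (\<phi> u)) *
     ennreal (\<bar>cone_jacobian \<phi> u\<bar> / (4 * norm (\<phi> u) ^ 4)) \<partial>lborel)"
  proof (rule nn_integral_cone[OF U' _ _ _ _ T Tb])
    show "(\<phi> has_derivative DD \<phi> u) (at u)" if "u \<in> U'" for u
      using smooth_on_has_derivative[OF sm] that by (simp add: U'_def)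
    show "continuous_on U' (\<lambda>u. DD \<phi> u (axis i 1))" for i
      by (rule continuous_on_subset[OF smooth_on_continuous[OF smooth_on_DD[OF sm]]]) (auto simp: U'_def)
    show "\<phi> u \<noteq> 0" if "u \<in> U'" for u using phi that by (simp add: U'_def)
    show "u = v" if "u \<in> U'" "v \<in> U'" "t > 0" "\<phi> u = t *\<^sub>R \<phi> v" for u v t
    proof -
      have uv: "u \<in> U" "v \<in> U" using that by (auto simp: U'_def)
      have "\<phi> u = proj H (t *\<^sub>R \<phi> v)" using phi(3)[OF uv(1)] that(4) by simp
      also have "\<dots> = \<phi> v" using proj_scale[OF H that(3)] phi(3)[OF uv(2)] by simp
      finally show ?thesis using inj uv by (auto dest: inj_onD)
    qed
    show "(\<lambda>x. ennreal (cone_weight H x)) \<in> borel_measurable borel" using cone_weight_measurable[OF H] by measurable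
    show "ennreal (cone_weight H (t *\<^sub>R \<phi> u)) = ennreal (cone_weight H (\<phi> u))" if "t > 0" for u t
      by (simp add: cone_weight_scale[OF H that])
  qed
  also have "\<dots> = (\<integral>\<^sup>+ u \<in> {u \<in> U. \<phi> u \<in> B}. ennreal (pullback_density (std_form H) \<phi> u) \<partial>lborel)"
  proof (unfold U'_def[symmetric], intro nn_integral_cong)
    fix u :: "real ^ 3"
    have "ennreal (cone_weight H (\<phi> u)) *
       ennreal (\<bar>cone_jacobian \<phi> u\<bar> / (4 * norm (\<phi> u) ^ 4))
       = ennreal (pullback_density (std_form H) \<phi> u)" if "u \<in> U'"
    proof -
      have u: "u \<in> U" using that by (simp add: U'_def)
      define V where "V = cone_jacobian \<phi> u"
      have d: "pullback_density (std_form H) \<phi> u = fef_density H (\<phi> u) * V"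
        by (simp add: pullback_density_def std_form_def V_def)
      have k: "fef_density H (\<phi> u) > 0" by (rule fef_density_pos[OF H pos phi(1)[OF u]])
      have "V > 0" using dens[OF u] k unfolding d by (simp add: zero_less_mult_iff)
      then have "cone_weight H (\<phi> u) * (\<bar>V\<bar> / (4 * norm (\<phi> u) ^ 4)) = fef_density H (\<phi> u) * V"
        using phi(2)[OF u] unfolding cone_weight_sph[OF H phi(1)[OF u]] by simp
      moreover have "cone_weight H (\<phi> u) \<ge> 0"
        using k unfolding cone_weight_sph[OF H phi(1)[OF u]] by simp
      ultimately show ?thesis unfolding d V_def[symmetric] by (simp add: ennreal_mult[symmetric])
    qed
    then show "ennreal (cone_weight H (\<phi> u)) *
       ennreal (\<bar>cone_jacobian \<phi> u\<bar> / (4 * norm (\<phi> u) ^ 4)) * indicator U' u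
       = ennreal (pullback_density (std_form H) \<phi> u) * indicator U' u"
      by (cases "u \<in> U'") auto
  qed
  finally show "emeasure (fef_measure H) B = (\<integral>\<^sup>+ u \<in> {u \<in> U. \<phi> u \<in> B}. ennreal (pullback_density (std_form H) \<phi> u) \<partial>lborel)" .
qed

text \<open>The affine hyperplane through \<open>a\<close> orthogonal to \<open>a\<close>; projected radially, it charts the half of the
hypersurface on the side of \<open>a\<close>. The order \<open>j, i, k\<close> of the directions makes the chart positive
(\<open>vol4_frame\<close>).\<close>

definition plane_chart :: "C2 \<Rightarrow> real ^ 3 \<Rightarrow> C2" where
  "plane_chart a u = a + (u $ 1) *\<^sub>R mult_j a + (u $ 2) *\<^sub>R mult_i a + (u $ 3) *\<^sub>R mult_k a"

lemma vol4_frame: "vol4 (mult_j a) (mult_i a) (mult_k a) a = (a \<bullet> a)\<^sup>2"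
  by (cases a) (simp add: vol4_expand mult_i_def mult_j_def mult_k_def inner_prod_def inner_complex_def
      power2_eq_square algebra_simps)

lemma frame_expansion:
  "(a \<bullet> a) *\<^sub>R p = (p \<bullet> a) *\<^sub>R a + (p \<bullet> mult_j a) *\<^sub>R mult_j a + (p \<bullet> mult_i a) *\<^sub>R mult_i a + (p \<bullet> mult_k a) *\<^sub>R mult_k a"
  by (cases a, cases p) (simp add: mult_i_def mult_j_def mult_k_def inner_prod_def inner_complex_def
      prod_eq_iff complex_eq_iff algebra_simps)

lemma inner_plane_chart:
  assumes "a \<bullet> a = 1"
  shows "plane_chart a u \<bullet> a = 1" "plane_chart a u \<bullet> mult_j a = u $ 1"
    "plane_chart a u \<bullet> mult_i a = u $ 2" "plane_chart a u \<bullet> mult_k a = u $ 3"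
  using assms by (simp_all add: plane_chart_def inner_add_left)

lemma has_derivative_plane_chart:
  "(plane_chart a has_derivative (\<lambda>h. (h $ 1) *\<^sub>R mult_j a + (h $ 2) *\<^sub>R mult_i a + (h $ 3) *\<^sub>R mult_k a)) (at u)"
  unfolding plane_chart_def
  by (auto intro!: derivative_eq_intros bounded_linear_imp_has_derivative[OF bounded_linear_vec_nth])

lemma smooth_plane_chart: "smooth_on UNIV (plane_chart a)"
  unfolding plane_chart_def
  by (intro smooth_on_add smooth_on_const smooth_on_scaleR smooth_on_bounded_linear bounded_linear_vec_nth open_UNIV)

lemma positive_parametrization_chart:
  assumes H: "radial_direction H" and pos: "\<And>x. x \<noteq> 0 \<Longrightarrow> ma_det H x > 0" and a: "a \<bullet> a = 1"
  shows "positive_parametrization (sph H) (std_form H) UNIV (\<lambda>u. proj H (plane_chart a u))"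
  unfolding positive_parametrization_def
proof (intro conjI ballI)
  have nz: "plane_chart a u \<noteq> 0" for u using inner_plane_chart(1)[OF a, of u] by auto
  show "smooth_on UNIV (\<lambda>u. proj H (plane_chart a u))"
    by (rule smooth_on_compose[OF smooth_plane_chart smooth_proj[OF H]]) (use nz in auto)
  show "(\<lambda>u. proj H (plane_chart a u)) ` UNIV \<subseteq> sph H"
    using proj_in_sph[OF H nz] by auto
  show "inj (\<lambda>u. proj H (plane_chart a u))"
  proof (rule injI)
    fix u v assume eq: "proj H (plane_chart a u) = proj H (plane_chart a v)"
    define s t where "s = exp (- log_rho H (plane_chart a u) / 2)" and "t = exp (- log_rho H (plane_chart a v) / 2)"
    have st: "s *\<^sub>R plane_chart a u = t *\<^sub>R plane_chart a v" using eq by (simp add: proj_def s_def t_def)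
    have "(s *\<^sub>R plane_chart a u) \<bullet> a = s" "(t *\<^sub>R plane_chart a v) \<bullet> a = t" by (simp_all add: inner_plane_chart(1)[OF a])
    then have "s = t" using st by metis
    moreover have "t > 0" by (simp add: t_def)
    ultimately have "plane_chart a u = plane_chart a v" using st by simp
    then show "u = v" using inner_plane_chart(2-4)[OF a] by (metis (no_types, lifting) exhaust_3 vec_eq_iff)
  qed
  fix u :: "real ^ 3"
  define y where "y = plane_chart a u"
  define l where "l = exp (- log_rho H y / 2)"
  define c where "c v = DD (log_rho H) y v / 2" for v
  have y0: "y \<noteq> 0" using nz by (simp add: y_def)
  have DDp: "DD (\<lambda>u. proj H (plane_chart a u)) u = (\<lambda>h. l *\<^sub>R (((h $ 1) *\<^sub>R mult_j a + (h $ 2) *\<^sub>R mult_i a + (h $ 3) *\<^sub>R mult_k a)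
      - c ((h $ 1) *\<^sub>R mult_j a + (h $ 2) *\<^sub>R mult_i a + (h $ 3) *\<^sub>R mult_k a) *\<^sub>R y))"
    unfolding l_def c_def y_def
    by (rule DD_eqI[OF has_derivative_compose[OF has_derivative_plane_chart has_derivative_proj[OF H nz]]])
  have D1: "DD (\<lambda>u. proj H (plane_chart a u)) u (axis 1 1) = l *\<^sub>R (mult_j a - c (mult_j a) *\<^sub>R y)"
    and D2: "DD (\<lambda>u. proj H (plane_chart a u)) u (axis 2 1) = l *\<^sub>R (mult_i a - c (mult_i a) *\<^sub>R y)"
    and D3: "DD (\<lambda>u. proj H (plane_chart a u)) u (axis 3 1) = l *\<^sub>R (mult_k a - c (mult_k a) *\<^sub>R y)"
    unfolding DDp by (simp_all add: axis_def)
  have pl: "proj H (plane_chart a u) = l *\<^sub>R y" by (simp add: proj_def l_def y_def)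
  note lin = linear_scale[OF linear_vol4(1)] linear_scale[OF linear_vol4(2)] linear_scale[OF linear_vol4(3)] linear_scale[OF linear_vol4(4)]
    linear_diff[OF linear_vol4(1)] linear_diff[OF linear_vol4(2)] linear_diff[OF linear_vol4(3)]
    linear_add[OF linear_vol4(4)]
  have "vol4 (mult_j a) (mult_i a) (mult_k a) y = 1"
    unfolding y_def plane_chart_def by (simp add: lin vol4_alternating vol4_frame a)
  then have "vol4 (l *\<^sub>R (mult_j a - c (mult_j a) *\<^sub>R y)) (l *\<^sub>R (mult_i a - c (mult_i a) *\<^sub>R y))
     (l *\<^sub>R (mult_k a - c (mult_k a) *\<^sub>R y)) (l *\<^sub>R y) = l ^ 4"
    by (simp add: lin vol4_alternating power_def numeral_eq_Suc)
  moreover have "l > 0" by (simp add: l_def)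
  moreover have "fef_density H (proj H (plane_chart a u)) > 0"
    by (rule fef_density_pos[OF H pos proj_in_sph[OF H nz]])
  ultimately show "pullback_density (std_form H) (\<lambda>u. proj H (plane_chart a u)) u > 0"
    unfolding pullback_density_def std_form_def D1 D2 D3 by (simp add: pl)
qed

lemma half_sphere_chart:
  assumes H: "radial_direction H" and a: "a \<bullet> a = 1" and p: "p \<in> sph H" "p \<bullet> a > 0"
  shows "p \<in> range (\<lambda>u. proj H (plane_chart a u))"
proof -
  define u :: "real ^ 3" where "u = vector [(p \<bullet> mult_j a) / (p \<bullet> a), (p \<bullet> mult_i a) / (p \<bullet> a), (p \<bullet> mult_k a) / (p \<bullet> a)]"
  have "(p \<bullet> a) *\<^sub>R plane_chart a u = p"
    using frame_expansion[of a p] p(2) a by (simp add: plane_chart_def u_def scaleR_right_distrib)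
  then have "proj H (plane_chart a u) = p"
    using proj_scale[OF H p(2), of "plane_chart a u"] proj_sph[OF p(1)] by simp
  then show ?thesis by (metis rangeI)
qed

text \<open>The charts centred at plus and minus the four standard basis vectors cover the hypersurface, and two
measures that agree on the subsets of finitely many sets agree on the subsets of their union.\<close>

proposition integration_measure_unique:
  assumes H: "radial_direction H" and pos: "\<And>x. x \<noteq> 0 \<Longrightarrow> ma_det H x > 0"
    and m1: "integration_measure (sph H) (std_form H) \<mu>1" and m2: "integration_measure (sph H) (std_form H) \<mu>2"
  shows "emeasure \<mu>1 (sph H) = emeasure \<mu>2 (sph H)"
proof -
  have agree: "emeasure \<mu>1 B = emeasure \<mu>2 B"
    if "finite F" "\<forall>a\<in>F. a \<bullet> a = 1" "B \<in> sets borel" "B \<subseteq> {p \<in> sph H. \<exists>a\<in>F. p \<bullet> a > 0}" for F B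
    using that
  proof (induction F arbitrary: B rule: finite_induct)
    case (insert a F)
    have s: "sets \<mu>1 = sets borel" "sets \<mu>2 = sets borel" using m1 m2 by (auto simp: integration_measure_def)
    define B1 where "B1 = B \<inter> {p. p \<bullet> a > 0}"
    have op: "{p. p \<bullet> a > 0} \<in> sets borel" by (intro borel_open open_Collect_less continuous_intros)
    have B1: "B1 \<in> sets borel" "B - B1 \<in> sets borel" using insert.prems(2) op by (auto simp: B1_def)
    have "B1 \<subseteq> range (\<lambda>u. proj H (plane_chart a u))"
      using half_sphere_chart[OF H, of a] insert.prems by (auto simp: B1_def)
    then have "emeasure \<mu>1 B1 = emeasure \<mu>2 B1"
      using m1 m2 positive_parametrization_chart[OF H pos, of a] B1(1) insert.prems(1)
      unfolding integration_measure_def by simp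
    moreover have "emeasure \<mu>1 (B - B1) = emeasure \<mu>2 (B - B1)"
      using insert.prems B1 by (intro insert.IH) (auto simp: B1_def)
    moreover have "emeasure \<mu> B = emeasure \<mu> B1 + emeasure \<mu> (B - B1)" if "sets \<mu> = sets borel" for \<mu> :: "C2 measure"
      using plus_emeasure[of B1 \<mu> "B - B1"] B1 that by (simp add: B1_def Un_Diff_Int Int_absorb2 sup.absorb2)
    ultimately show ?case using s by metis
  qed simp
  define F where "F = (Basis :: C2 set) \<union> uminus ` Basis"
  have "\<exists>a\<in>F. p \<bullet> a > 0" if "p \<in> sph H" for p
  proof -
    have "p \<noteq> 0" using that by (simp add: mem_sph_log)
    then obtain b where "b \<in> Basis" "p \<bullet> b \<noteq> 0" using euclidean_all_zero_iff[of p] by blast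
    then show ?thesis unfolding F_def
      by (cases "p \<bullet> b > 0") (auto intro: bexI[of _ b] bexI[of _ "- b"])
  qed
  moreover have "a \<bullet> a = 1" if "a \<in> F" for a
    using that unfolding F_def by (elim UnE imageE) (simp_all add: inner_Basis)
  moreover have "finite F" by (simp add: F_def)
  ultimately show ?thesis
    by (intro agree[of F] sph_borel[OF H]) blast+
qed

definition ball_measure :: "C2 measure" where
  "ball_measure = restrict_space lborel punctured_ball"

proposition fefferman_area_eq:
  assumes H: "radial_direction H" and pos: "\<And>x. x \<noteq> 0 \<Longrightarrow> ma_det H x > 0"
  shows "fefferman_area (sph H) = (LINT x|ball_measure. cone_weight H x)"
proof -
  have "fefferman_area (sph H) = (THE m. \<exists>\<mu>. integration_measure (sph H) (std_form H) \<mu> \<and> m = measure \<mu> (sph H))"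
    by (rule fefferman_area_sph[OF H pos])
  also have "\<dots> = measure (fef_measure H) (sph H)"
  proof (rule the_equality)
    show "\<exists>\<mu>. integration_measure (sph H) (std_form H) \<mu> \<and> measure (fef_measure H) (sph H) = measure \<mu> (sph H)"
      using integration_measure_fef_measure[OF H pos] by blast
    fix m assume "\<exists>\<mu>. integration_measure (sph H) (std_form H) \<mu> \<and> m = measure \<mu> (sph H)"
    then obtain \<mu> where \<mu>: "integration_measure (sph H) (std_form H) \<mu>" "m = measure \<mu> (sph H)" by blast
    show "m = measure (fef_measure H) (sph H)"
      unfolding \<mu>(2) measure_def
      using integration_measure_unique[OF H pos \<mu>(1) integration_measure_fef_measure[OF H pos]] by simp
  qed
  also have "\<dots> = enn2real (\<integral>\<^sup>+x\<in>punctured_ball. ennreal (cone_weight H x) \<partial>lborel)"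
  proof -
    have "proj H x \<in> sph H" if "x \<in> punctured_ball" for x
      using proj_in_sph[OF H] that by (simp add: mem_punctured_ball)
    then have "punctured_ball \<inter> proj H -` sph H = punctured_ball" by blast
    then show ?thesis by (simp add: measure_def emeasure_fef_measure[OF H sph_borel[OF H]])
  qed
  also have "\<dots> = enn2real (\<integral>\<^sup>+x. ennreal (cone_weight H x) \<partial>ball_measure)"
    unfolding ball_measure_def by (subst nn_integral_restrict_space) simp_all
  also have "\<dots> = (LINT x|ball_measure. cone_weight H x)"
  proof (rule integral_eq_nn_integral[symmetric])
    show "cone_weight H \<in> borel_measurable ball_measure"
      unfolding ball_measure_def using cone_weight_measurable[OF H] by (simp add: measurable_restrict_space1)
    show "AE x in ball_measure. 0 \<le> cone_weight H x"
      unfolding ball_measure_def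
    proof (rule AE_I2)
      fix x assume "x \<in> space (restrict_space lborel punctured_ball)"
      then have "x \<noteq> 0" by (simp add: space_restrict_space punctured_ball_def)
      then show "0 \<le> cone_weight H x" using pos[of x] by (simp add: cone_weight_def less_imp_le)
    qed
  qed
  finally show ?thesis .
qed

section \<open>The enclosed volume\<close>

text \<open>The Minkowski functional of the enclosed star-shaped domain. Since \<open>H\<close> is bounded, it is continuous
at the origin too.\<close>

definition sph_gauge :: "(C2 \<Rightarrow> real) \<Rightarrow> C2 \<Rightarrow> real" where
  "sph_gauge H x = exp (H x / 2) * norm x"

lemma gauge_sq: "(sph_gauge H x)\<^sup>2 = exp (H x) * (x \<bullet> x)"
  by (simp add: sph_gauge_def power_mult_distrib power2_norm_eq_inner flip: exp_of_nat_mult)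

lemma gauge_sph: "x \<in> sph H \<longleftrightarrow> sph_gauge H x = 1"
proof -
  have "sph_gauge H x \<ge> 0" by (simp add: sph_gauge_def)
  then show ?thesis unfolding mem_sph gauge_sq[symmetric] by (simp add: power2_eq_1_iff)
qed

lemma continuous_gauge:
  assumes H: "radial_direction H" shows "continuous_on UNIV (sph_gauge H)"
proof -
  obtain C where C: "\<And>x. x \<noteq> 0 \<Longrightarrow> \<bar>H x\<bar> \<le> C" using radial_bounded[OF H] by blast
  have "isCont (sph_gauge H) x" for x
  proof (cases "x = 0")
    case True
    have "(sph_gauge H \<longlongrightarrow> 0) (at 0)"
    proof (rule Lim_null_comparison)
      show "\<forall>\<^sub>F x in at 0. norm (sph_gauge H x) \<le> exp (C / 2) * norm x"
        unfolding eventually_at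
        using C by (intro exI[of _ 1]) (fastforce simp: sph_gauge_def abs_le_iff intro!: mult_right_mono)
      show "((\<lambda>x. exp (C / 2) * norm x) \<longlongrightarrow> 0) (at (0::C2))"
        by (rule tendsto_eq_intros | simp)+
    qed
    then show ?thesis using True by (simp add: isCont_def sph_gauge_def)
  next
    case False
    have "continuous_on (- {0}) (sph_gauge H)" unfolding sph_gauge_def
      by (intro continuous_intros smooth_on_continuous[OF radial_smooth[OF H]]) auto
    then show ?thesis using False by (simp add: continuous_on_eq_continuous_at open_punctured)
  qed
  then show ?thesis by (simp add: continuous_at_imp_continuous_on)
qed

text \<open>The gauge cannot pass the value 1 along a connected set that avoids the hypersurface, and outside
the domain the rest of the ray to infinity stays in the component.\<close>

lemma inside_sph:
  assumes H: "radial_direction H"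
  shows "inside (sph H) = {x. sph_gauge H x < 1}"
proof (intro equalityI subsetI)
  obtain C where C: "\<And>x. x \<noteq> 0 \<Longrightarrow> \<bar>H x\<bar> \<le> C" using radial_bounded[OF H] by blast
  have low: "norm x \<le> exp (C / 2) * sph_gauge H x" for x
  proof (cases "x = 0")
    case False
    have "0 \<le> C / 2 + H x / 2" using C[OF False] by (simp add: abs_le_iff)
    then have "1 \<le> exp (C / 2) * exp (H x / 2)" by (simp flip: exp_add)
    then show ?thesis using mult_right_mono[of 1 "exp (C / 2) * exp (H x / 2)" "norm x"] by (simp add: sph_gauge_def mult.assoc)
  qed (simp add: sph_gauge_def)
  {
    fix x assume "x \<in> {x. sph_gauge H x < 1}"
    then have x: "sph_gauge H x < 1" by simp
    have "connected_component_set (- sph H) x \<subseteq> {y. sph_gauge H y < 1}"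
    proof
      fix y assume "y \<in> connected_component_set (- sph H) x"
      then obtain T where T: "connected T" "T \<subseteq> - sph H" "x \<in> T" "y \<in> T"
        by (auto simp: connected_component_def)
      have "connected (sph_gauge H ` T)"
        by (rule connected_continuous_image[OF continuous_on_subset[OF continuous_gauge[OF H]] T(1)]) simp
      moreover have "1 \<notin> sph_gauge H ` T" using T(2) gauge_sph by auto
      ultimately have "1 \<notin> {sph_gauge H x..sph_gauge H y}"
        using T(3,4) connected_contains_Icc[of "sph_gauge H ` T" "sph_gauge H x" "sph_gauge H y"] by blast
      then show "y \<in> {y. sph_gauge H y < 1}" using x by simp
    qed
    moreover have "bounded {y. sph_gauge H y < 1}"
      unfolding bounded_iff
    proof (intro exI[of _ "exp (C / 2)"] ballI)
      fix y assume "y \<in> {y. sph_gauge H y < 1}"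
      then have "exp (C / 2) * sph_gauge H y \<le> exp (C / 2) * 1" by (intro mult_left_mono) auto
      from order_trans[OF low this] show "norm y \<le> exp (C / 2)" by simp
    qed
    ultimately show "x \<in> inside (sph H)"
      unfolding inside_def using x gauge_sph bounded_subset by auto
  next
    fix x assume x: "x \<in> inside (sph H)"
    show "x \<in> {x. sph_gauge H x < 1}"
    proof (rule ccontr)
      assume "x \<notin> {x. sph_gauge H x < 1}"
      moreover have "sph_gauge H x \<noteq> 1" using x gauge_sph by (auto simp: inside_def)
      ultimately have g: "sph_gauge H x > 1" by simp
      then have x0: "x \<noteq> 0" by (auto simp: sph_gauge_def)
      define R where "R = (\<lambda>t. t *\<^sub>R x) ` {1..}"
      have "connected R" unfolding R_def
        by (intro connected_continuous_image continuous_intros connected_Ici)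
      moreover have "R \<subseteq> - sph H"
      proof -
        have "sph_gauge H (t *\<^sub>R x) > 1" if "t \<ge> 1" for t
        proof -
          have "sph_gauge H (t *\<^sub>R x) = t * sph_gauge H x" using that by (simp add: sph_gauge_def radial_scale[OF H])
          also have "\<dots> \<ge> 1 * sph_gauge H x" using that g by (intro mult_right_mono) auto
          finally show ?thesis using g by simp
        qed
        then have "t *\<^sub>R x \<notin> sph H" if "t \<ge> 1" for t using that gauge_sph[of "t *\<^sub>R x"] by fastforce
        then show ?thesis unfolding R_def by blast
      qed
      moreover have "x \<in> R" unfolding R_def by (intro image_eqI[of _ _ 1]) auto
      ultimately have "R \<subseteq> connected_component_set (- sph H) x"
        by (intro connected_component_maximal)
      then have "bounded R" using x bounded_subset by (auto simp: inside_def)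
      then obtain K where K: "\<And>y. y \<in> R \<Longrightarrow> norm y \<le> K" unfolding bounded_iff by blast
      define t where "t = max 1 ((K + 1) / norm x)"
      have "K + 1 \<le> t * norm x" using x0 by (simp add: t_def max_def field_simps)
      moreover have "t *\<^sub>R x \<in> R" "t \<ge> 1" by (auto simp: R_def t_def)
      ultimately show False using K[of "t *\<^sub>R x"] by simp
    qed
  }
qed

text \<open>The determinant of the identity minus a rank-one matrix.\<close>

lemma vol4_rank_one:
  "vol4 (e1 - c1 *\<^sub>R x) (mult_i e1 - c2 *\<^sub>R x) (e2 - c3 *\<^sub>R x) (mult_i e2 - c4 *\<^sub>R x)
    = 1 - (Re (fst x) * c1 + Im (fst x) * c2 + Re (snd x) * c3 + Im (snd x) * c4)"
  by (simp add: vol4_expand e1_def e2_def mult_i_def algebra_simps)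

text \<open>Substitute \<open>x \<mapsto> exp (- H x / 2) x\<close>. The rank-one part of its derivative has trace 0 by the Euler
relation, so the Jacobian is \<open>exp (- H x / 2)\<^sup>4\<close>.\<close>

proposition enclosed_volume_eq:
  assumes H: "radial_direction H"
  shows "enclosed_volume (sph H) = (LINT x|ball_measure. exp (- 2 * H x))"
proof -
  obtain C where C: "\<And>x. x \<noteq> 0 \<Longrightarrow> \<bar>H x\<bar> \<le> C" using radial_bounded[OF H] by blast
  define \<psi> where "\<psi> x = exp (- H x / 2) *\<^sub>R x" for x
  have gm: "sph_gauge H \<in> borel_measurable borel"
    by (rule borel_measurable_continuous_onI[OF continuous_gauge[OF H]])
  have Hpsi: "H (exp s *\<^sub>R x) = H x" for s x by (simp add: radial_scale[OF H])
  have Hpsi': "H (\<psi> x) = H x" for x by (simp only: \<psi>_def Hpsi)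
  have gauge_psi: "sph_gauge H (\<psi> x) = norm x" for x
  proof -
    have "sph_gauge H (\<psi> x) = (exp (H x / 2) * exp (- H x / 2)) * norm x"
      unfolding sph_gauge_def Hpsi' by (simp add: \<psi>_def)
    then show ?thesis by (simp flip: exp_add)
  qed
  have img: "\<psi> ` punctured_ball = {x. sph_gauge H x < 1} - {0}"
  proof (intro equalityI subsetI)
    fix y assume "y \<in> \<psi> ` punctured_ball"
    then obtain x where x: "x \<in> punctured_ball" "y = \<psi> x" by blast
    then show "y \<in> {x. sph_gauge H x < 1} - {0}"
      by (simp add: mem_punctured_ball gauge_psi) (simp add: \<psi>_def)
  next
    fix y assume y: "y \<in> {x. sph_gauge H x < 1} - {0}"
    have "y = \<psi> (exp (H y / 2) *\<^sub>R y)" by (simp add: \<psi>_def Hpsi flip: exp_add)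
    moreover have "exp (H y / 2) *\<^sub>R y \<in> punctured_ball" using y by (simp add: punctured_ball_def sph_gauge_def)
    ultimately show "y \<in> \<psi> ` punctured_ball" by blast
  qed
  have inj: "inj_on \<psi> punctured_ball"
  proof (rule inj_on_inverseI)
    fix x show "exp (H (\<psi> x) / 2) *\<^sub>R \<psi> x = x" by (simp add: \<psi>_def Hpsi flip: exp_add)
  qed
  define \<psi>' where "\<psi>' x v = exp (- H x / 2) *\<^sub>R (v - (DD H x v / 2) *\<^sub>R x)" for x v
  have der: "(\<psi> has_derivative \<psi>' x) (at x)" if "x \<in> punctured_ball" for x
  proof -
    have d: "(H has_derivative DD H x) (at x)"
      using smooth_on_has_derivative[OF radial_smooth[OF H], of x] that by (simp add: punctured_ball_def)
    from has_derivative_scaleR[OF has_derivative_exp[OF has_derivative_mult_right[OF d, of "- 1 / 2"]] has_derivative_ident]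
    show ?thesis unfolding \<psi>_def \<psi>'_def
      by (simp add: scaleR_right_diff_distrib mult.commute)
  qed
  have J: "exp (- 2 * H x) = \<bar>vol4 (\<psi>' x (C2_of (axis 1 1))) (\<psi>' x (C2_of (axis 2 1))) (\<psi>' x (C2_of (axis 3 1))) (\<psi>' x (C2_of (axis 4 1)))\<bar>"
    if "x \<in> punctured_ball" for x
  proof -
    have x: "x \<noteq> 0" using that by (simp add: punctured_ball_def)
    have lin: "linear (DD H x)"
      using smooth_on_differentiable[OF radial_smooth[OF H], of x] x by (intro linear_frechet_derivative) simp
    have "Re (fst x) * (DD H x e1 / 2) + Im (fst x) * (DD H x (mult_i e1) / 2) + Re (snd x) * (DD H x e2 / 2) + Im (snd x) * (DD H x (mult_i e2) / 2) = DD H x x / 2"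
      using linear_C2_expand[OF lin, of "fst x" "snd x"] by simp
    also have "\<dots> = 0" by (simp add: DD_radial_self[OF H x])
    finally have z: "Re (fst x) * (DD H x e1 / 2) + Im (fst x) * (DD H x (mult_i e1) / 2) + Re (snd x) * (DD H x e2 / 2) + Im (snd x) * (DD H x (mult_i e2) / 2) = 0" .
    have "vol4 (\<psi>' x (C2_of (axis 1 1))) (\<psi>' x (C2_of (axis 2 1))) (\<psi>' x (C2_of (axis 3 1))) (\<psi>' x (C2_of (axis 4 1)))
       = exp (- H x / 2) ^ 4"
      unfolding \<psi>'_def C2_of_axis linear_scale[OF linear_vol4(1)] linear_scale[OF linear_vol4(2)]
        linear_scale[OF linear_vol4(3)] linear_scale[OF linear_vol4(4)] vol4_rank_one z
      by (simp add: power_def numeral_eq_Suc)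
    also have "\<dots> = exp (- 2 * H x)" by (simp flip: exp_of_nat_mult)
    finally show ?thesis by simp
  qed
  have "{x. sph_gauge H x < 1} \<in> sets borel"
    using measurable_sets_borel[OF gm, of "{..<1}"] by (simp add: vimage_def)
  then have T: "\<psi> ` punctured_ball \<in> sets borel" unfolding img by simp
  have bd: "bounded (\<psi> ` punctured_ball)"
    unfolding bounded_iff
  proof (intro exI[of _ "exp (C / 2)"] ballI)
    fix y assume "y \<in> \<psi> ` punctured_ball"
    then obtain x where "x \<in> punctured_ball" "y = \<psi> x" by blast
    then have x: "x \<noteq> 0" "norm x < 1" "y = \<psi> x" by (simp_all add: mem_punctured_ball)
    have "norm y = exp (- H x / 2) * norm x" by (simp add: x \<psi>_def)
    also have "\<dots> \<le> exp (C / 2) * 1"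
      using x C[OF x(1)] by (intro mult_mono) (auto simp: abs_le_iff)
    finally show "norm y \<le> exp (C / 2)" by simp
  qed
  have Jm: "(\<lambda>x. ennreal (exp (- 2 * H x)) * indicator punctured_ball x) \<in> borel_measurable borel"
    using radial_measurable[OF H] by measurable
  have "enclosed_volume (sph H) = measure lebesgue {x. sph_gauge H x < 1}"
    by (simp add: enclosed_volume_def inside_sph[OF H])
  also have "\<dots> = measure lborel {x. sph_gauge H x < 1}"
    using \<open>{x. sph_gauge H x < 1} \<in> sets borel\<close> by simp
  also have "\<dots> = enn2real (emeasure lborel (\<psi> ` punctured_ball))"
  proof -
    have "emeasure lborel ({x. sph_gauge H x < 1} - {0}) = emeasure lborel {x. sph_gauge H x < 1}"
      using \<open>{x. sph_gauge H x < 1} \<in> sets borel\<close> by (intro emeasure_Diff_null_set) (auto simp: null_sets_def)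
    then show ?thesis by (simp add: measure_def img)
  qed
  also have "emeasure lborel (\<psi> ` punctured_ball) = (\<integral>\<^sup>+x\<in>punctured_ball. ennreal (exp (- 2 * H x)) \<partial>lborel)"
    by (rule emeasure_image_C2[OF bounded_linear_C2_of bij_C2_of C2_of_iso punctured_ball_borel der inj T bd J Jm])
  also have "\<dots> = (\<integral>\<^sup>+x. ennreal (exp (- 2 * H x)) \<partial>ball_measure)"
    unfolding ball_measure_def by (subst nn_integral_restrict_space) simp_all
  also have "enn2real \<dots> = (LINT x|ball_measure. exp (- 2 * H x))"
  proof (rule integral_eq_nn_integral[symmetric])
    have "(\<lambda>x. exp (- 2 * H x)) \<in> borel_measurable borel" using radial_measurable[OF H] by measurable
    then show "(\<lambda>x. exp (- 2 * H x)) \<in> borel_measurable ball_measure"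
      unfolding ball_measure_def by (simp add: measurable_restrict_space1)
  qed simp
  finally show ?thesis .
qed

section \<open>Integration over the ball\<close>

lemma finite_measure_ball: "finite_measure ball_measure"
proof (rule finite_measureI)
  have "emeasure lborel punctured_ball \<le> emeasure lborel (ball (0::C2) 1)"
    by (intro emeasure_mono) (auto simp: punctured_ball_def)
  also have "\<dots> < \<infinity>" by (rule emeasure_bounded_finite) simp
  finally show "emeasure ball_measure (space ball_measure) \<noteq> \<infinity>"
    unfolding ball_measure_def by (simp add: emeasure_restrict_space space_restrict_space)
qed

lemma space_ball_measure: "space ball_measure = punctured_ball"
  by (simp add: ball_measure_def space_restrict_space)

lemma measurable_ball_measure: "f \<in> borel_measurable borel \<Longrightarrow> f \<in> borel_measurable ball_measure"
  unfolding ball_measure_def by (simp add: measurable_restrict_space1)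

lemma AE_ball_measure: "(\<And>x. x \<noteq> 0 \<Longrightarrow> P x) \<Longrightarrow> AE x in ball_measure. P x"
  by (rule AE_I2) (simp add: space_ball_measure mem_punctured_ball)

lemma integrable_ball_measure:
  fixes f :: "C2 \<Rightarrow> real"
  assumes "f \<in> borel_measurable borel" "\<And>x. x \<noteq> 0 \<Longrightarrow> \<bar>f x\<bar> \<le> C"
  shows "integrable ball_measure f"
  by (rule finite_measure.integrable_const_bound[OF finite_measure_ball, of f C])
    (use assms in \<open>auto intro: AE_ball_measure measurable_ball_measure\<close>)

lemma integrable_radial:
  assumes G: "radial_direction G" shows "integrable ball_measure G"
proof -
  obtain C where "\<And>x. x \<noteq> 0 \<Longrightarrow> \<bar>G x\<bar> \<le> C" using radial_bounded[OF G] by blast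
  then show ?thesis by (rule integrable_ball_measure[OF radial_measurable[OF G]])
qed

lemma integral_ball_measure_cong:
  fixes f :: "C2 \<Rightarrow> real"
  assumes "\<And>x. x \<noteq> 0 \<Longrightarrow> f x = g x"
  shows "(LINT x|ball_measure. f x) = (LINT x|ball_measure. g x)"
  by (rule Bochner_Integration.integral_cong) (simp_all add: space_ball_measure mem_punctured_ball assms)

definition ball_vol :: real where "ball_vol = measure ball_measure (space ball_measure)"

lemma ball_vol_pos: "ball_vol > 0"
proof -
  have "ball ((1/2) *\<^sub>R e1) (1/2) \<subseteq> punctured_ball"
  proof
    fix x :: C2 assume x: "x \<in> ball ((1/2) *\<^sub>R e1) (1/2)"
    have e: "norm e1 = 1" by (simp add: e1_def)
    have "norm x \<le> norm (x - (1/2) *\<^sub>R e1) + norm ((1/2) *\<^sub>R e1)" using norm_triangle_sub by (metis add.commute)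
    then have "norm x < 1" using x e by (simp add: dist_norm norm_minus_commute)
    moreover have "x \<noteq> 0" using x e by auto
    ultimately show "x \<in> punctured_ball" by (simp add: mem_punctured_ball)
  qed
  then have "measure lborel (ball ((1/2) *\<^sub>R e1) (1/2)) \<le> measure lborel punctured_ball"
  proof (rule measure_mono_fmeasurable)
    have "bounded punctured_ball" by (simp add: punctured_ball_def bounded_diff)
    then show "punctured_ball \<in> fmeasurable lborel"
      using emeasure_bounded_finite by (simp add: fmeasurable_def)
  qed simp
  moreover have "measure lborel (ball ((1/2) *\<^sub>R e1) (1/2)) > 0"
    using content_ball_pos[of "1/2" "(1/2) *\<^sub>R e1"] by simp
  moreover have "ball_vol = measure lborel punctured_ball"
    unfolding ball_vol_def space_ball_measure unfolding ball_measure_def by (simp add: measure_restrict_space)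
  ultimately show ?thesis by linarith
qed

lemma increment_bound:
  fixes f f' :: "real \<Rightarrow> real"
  assumes der: "\<And>e. \<bar>e - e0\<bar> < d \<Longrightarrow> (f has_real_derivative f' e) (at e)"
    and bd: "\<And>e. \<bar>e - e0\<bar> < d \<Longrightarrow> \<bar>f' e\<bar> \<le> C" and h: "\<bar>h\<bar> < d"
  shows "\<bar>f (e0 + h) - f e0\<bar> \<le> C * \<bar>h\<bar>"
proof -
  have "\<exists>z. \<bar>z - e0\<bar> < d \<and> f (e0 + h) - f e0 = h * f' z"
  proof (cases h "0::real" rule: linorder_cases)
    case less
    obtain z where "e0 + h < z" "z < e0" "f e0 - f (e0 + h) = (e0 - (e0 + h)) * f' z"
      using MVT2[of "e0 + h" e0 f f'] der less h by fastforce
    then show ?thesis using h by (intro exI[of _ z]) (auto simp: algebra_simps)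
  next
    case equal
    then show ?thesis using h by (intro exI[of _ e0]) auto
  next
    case greater
    obtain z where "e0 < z" "z < e0 + h" "f (e0 + h) - f e0 = (e0 + h - e0) * f' z"
      using MVT2[of e0 "e0 + h" f f'] der greater h by fastforce
    then show ?thesis using h by (intro exI[of _ z]) auto
  qed
  then obtain z where z: "\<bar>z - e0\<bar> < d" "f (e0 + h) - f e0 = h * f' z" by blast
  have "\<bar>h * f' z\<bar> \<le> \<bar>h\<bar> * C" unfolding abs_mult by (intro mult_left_mono bd z) simp
  then show ?thesis using z(2) by (simp add: mult.commute)
qed

text \<open>Dominated convergence along sequences; the mean value theorem supplies the dominating constant.\<close>

lemma has_real_derivative_integral:
  fixes f f' :: "real \<Rightarrow> 'a \<Rightarrow> real"
  assumes M: "finite_measure M" and d: "d > 0"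
    and der: "\<And>e x. \<bar>e - e0\<bar> < d \<Longrightarrow> x \<in> space M \<Longrightarrow> ((\<lambda>e. f e x) has_real_derivative f' e x) (at e)"
    and int: "\<And>e. \<bar>e - e0\<bar> < d \<Longrightarrow> integrable M (f e)"
    and meas: "f' e0 \<in> borel_measurable M"
    and bd: "\<And>e x. \<bar>e - e0\<bar> < d \<Longrightarrow> x \<in> space M \<Longrightarrow> \<bar>f' e x\<bar> \<le> C"
  shows "((\<lambda>e. LINT x|M. f e x) has_real_derivative (LINT x|M. f' e0 x)) (at e0)"
  unfolding DERIV_def
proof (subst tendsto_at_iff_sequentially, intro allI impI)
  fix X :: "nat \<Rightarrow> real" assume X: "\<forall>i. X i \<in> UNIV - {0}" and X0: "X \<longlonglongrightarrow> 0"
  obtain N where N: "\<And>n. n \<ge> N \<Longrightarrow> \<bar>X n\<bar> < d"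
    using LIMSEQ_D[OF X0 d] by auto
  define Y where "Y n = X (n + N)" for n
  have Y: "Y n \<noteq> 0" "\<bar>Y n\<bar> < d" for n using X N by (auto simp: Y_def)
  have Y0: "Y \<longlonglongrightarrow> 0" unfolding Y_def by (rule LIMSEQ_ignore_initial_segment[OF X0])
  have inte: "integrable M (f e0)" using int[of e0] d by simp
  have intY: "integrable M (f (e0 + Y n))" for n using int[of "e0 + Y n"] Y by simp
  have "(\<lambda>n. LINT x|M. (f (e0 + Y n) x - f e0 x) / Y n) \<longlonglongrightarrow> (LINT x|M. f' e0 x)"
  proof (rule integral_dominated_convergence[where w="\<lambda>_. C"])
    show "f' e0 \<in> borel_measurable M" by (rule meas)
    show "(\<lambda>x. (f (e0 + Y n) x - f e0 x) / Y n) \<in> borel_measurable M" for n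
      using intY[of n] inte by measurable
    show "integrable M (\<lambda>_. C)" using M by (simp add: finite_measure.integrable_const)
    show "AE x in M. (\<lambda>n. (f (e0 + Y n) x - f e0 x) / Y n) \<longlonglongrightarrow> f' e0 x"
    proof (rule AE_I2)
      fix x assume "x \<in> space M"
      then have "((\<lambda>h. (f (e0 + h) x - f e0 x) / h) \<longlongrightarrow> f' e0 x) (at 0)"
        using der[of e0 x] d by (simp add: DERIV_def)
      then show "(\<lambda>n. (f (e0 + Y n) x - f e0 x) / Y n) \<longlonglongrightarrow> f' e0 x"
        using Y0 Y(1) by (simp add: tendsto_at_iff_sequentially comp_def)
    qed
    show "AE x in M. norm ((f (e0 + Y n) x - f e0 x) / Y n) \<le> C" for n
    proof (rule AE_I2)
      fix x assume x: "x \<in> space M"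
      have "\<bar>f (e0 + Y n) x - f e0 x\<bar> \<le> C * \<bar>Y n\<bar>"
        using der[OF _ x] bd[OF _ x] Y(2)[of n] by (rule increment_bound)
      then show "norm ((f (e0 + Y n) x - f e0 x) / Y n) \<le> C"
        using Y(1)[of n] by (simp add: abs_divide pos_divide_le_eq)
    qed
  qed
  moreover have "(LINT x|M. (f (e0 + Y n) x - f e0 x) / Y n) = ((LINT x|M. f (e0 + Y n) x) - (LINT x|M. f e0 x)) / Y n" for n
    using intY[of n] inte by simp
  ultimately have "(\<lambda>n. ((LINT x|M. f (e0 + Y n) x) - (LINT x|M. f e0 x)) / Y n) \<longlonglongrightarrow> (LINT x|M. f' e0 x)"
    by (simp only:)
  then have "(\<lambda>n. ((LINT x|M. f (e0 + X (n + N)) x) - (LINT x|M. f e0 x)) / X (n + N)) \<longlonglongrightarrow> (LINT x|M. f' e0 x)"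
    unfolding Y_def .
  then show "((\<lambda>h. ((LINT x|M. f (e0 + h) x) - (LINT x|M. f e0 x)) / h) \<circ> X) \<longlonglongrightarrow> (LINT x|M. f' e0 x)"
    unfolding comp_def by (rule LIMSEQ_offset)
qed

section \<open>Rotation invariance\<close>

text \<open>The one-parameter group \<open>exp (t A)\<close> when \<open>A\<^sup>2 = -1\<close>.\<close>

definition rot :: "(C2 \<Rightarrow> C2) \<Rightarrow> real \<Rightarrow> C2 \<Rightarrow> C2" where
  "rot A t x = cos t *\<^sub>R x + sin t *\<^sub>R A x"

lemma rot_properties:
  assumes A: "A \<in> {mult_i, mult_j, mult_k}"
  shows "bounded_linear A" "\<And>x. A (A x) = - x" "\<And>x. x \<bullet> A x = 0" "\<And>x. A x \<bullet> A x = x \<bullet> x"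
  using A bounded_linear_ijk by auto

lemma vol4_rot:
  assumes A: "A \<in> {mult_i, mult_j, mult_k}" and cs: "c\<^sup>2 + s\<^sup>2 = 1"
  shows "vol4 (c *\<^sub>R e1 + s *\<^sub>R A e1) (c *\<^sub>R mult_i e1 + s *\<^sub>R A (mult_i e1))
     (c *\<^sub>R e2 + s *\<^sub>R A e2) (c *\<^sub>R mult_i e2 + s *\<^sub>R A (mult_i e2)) = 1"
proof -
  have "vol4 (c *\<^sub>R e1 + s *\<^sub>R A e1) (c *\<^sub>R mult_i e1 + s *\<^sub>R A (mult_i e1))
     (c *\<^sub>R e2 + s *\<^sub>R A e2) (c *\<^sub>R mult_i e2 + s *\<^sub>R A (mult_i e2)) = (c\<^sup>2 + s\<^sup>2)\<^sup>2"
    using A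
    by (elim insertE emptyE) (simp_all add: vol4_expand e1_def e2_def mult_i_def mult_j_def mult_k_def power2_eq_square algebra_simps)
  then show ?thesis by (simp add: cs)
qed

lemma norm_rot:
  assumes A: "A \<in> {mult_i, mult_j, mult_k}"
  shows "norm (rot A t x) = norm x"
proof -
  have "(norm (rot A t x))\<^sup>2 = cos t * cos t * (x \<bullet> x) + sin t * sin t * (x \<bullet> x)"
    unfolding power2_norm_eq_inner rot_def using rot_properties(3,4)[OF A]
    by (simp add: inner_add_left inner_add_right inner_commute[of "A x" x] algebra_simps)
  also have "\<dots> = ((cos t)\<^sup>2 + (sin t)\<^sup>2) * (x \<bullet> x)" by (simp only: power2_eq_square distrib_right)
  finally have "(norm (rot A t x))\<^sup>2 = (norm x)\<^sup>2" by (simp add: power2_norm_eq_inner)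
  then show ?thesis by simp
qed

lemma rot_inverse:
  assumes A: "A \<in> {mult_i, mult_j, mult_k}"
  shows "rot A (- t) (rot A t x) = x"
proof -
  have lin: "linear A" using rot_properties(1)[OF A] by (rule bounded_linear.linear)
  have "rot A (- t) (rot A t x) = (cos t * cos t) *\<^sub>R x + (sin t * sin t) *\<^sub>R x"
    unfolding rot_def
    by (simp add: linear_add[OF lin] linear_scale[OF lin] rot_properties(2)[OF A] algebra_simps)
  also have "\<dots> = ((cos t)\<^sup>2 + (sin t)\<^sup>2) *\<^sub>R x" by (simp only: power2_eq_square scaleR_left_distrib)
  finally show ?thesis by simp
qed

lemma bounded_linear_rot:
  assumes A: "A \<in> {mult_i, mult_j, mult_k}" shows "bounded_linear (rot A t)"
  unfolding rot_def
  by (intro bounded_linear_add bounded_linear_compose[OF bounded_linear_scaleR_right] bounded_linear_ident rot_properties(1)[OF A])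

lemma ball_measure_rot:
  assumes A: "A \<in> {mult_i, mult_j, mult_k}"
  shows "distr ball_measure ball_measure (rot A t) = ball_measure"
proof (rule measure_eqI)
  have m: "rot A t \<in> borel_measurable borel"
    by (rule borel_measurable_continuous_onI[OF linear_continuous_on[OF bounded_linear_rot[OF A]]])
  have pb: "rot A s x \<in> punctured_ball \<longleftrightarrow> x \<in> punctured_ball" for s x
    unfolding mem_punctured_ball norm_rot[OF A] using norm_rot[OF A, of s x] by (metis norm_eq_zero)
  have mB: "rot A t \<in> ball_measure \<rightarrow>\<^sub>M ball_measure"
    unfolding ball_measure_def
    by (rule measurable_restrict_space3) (use m pb in \<open>auto simp: Pi_iff\<close>)
  fix B assume "B \<in> sets (distr ball_measure ball_measure (rot A t))"
  then have B: "B \<in> sets borel" "B \<subseteq> punctured_ball" "B \<in> sets ball_measure"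
    by (auto simp: ball_measure_def sets_restrict_space)
  define S where "S = rot A t -` B"
  have S: "S \<in> sets borel" "S \<subseteq> punctured_ball"
    unfolding S_def using measurable_sets_borel[OF m B(1)] pb[of t] B(2) by blast+
  have img: "rot A t ` S = B"
  proof (intro equalityI subsetI)
    fix y assume "y \<in> B"
    moreover have "y = rot A t (rot A (- t) y)" using rot_inverse[OF A, of "- t" y] by simp
    ultimately show "y \<in> rot A t ` S" unfolding S_def by (metis imageI vimageI)
  qed (auto simp: S_def)
  have "emeasure lborel (rot A t ` S) = (\<integral>\<^sup>+x\<in>S. ennreal 1 \<partial>lborel)"
  proof (rule emeasure_image_C2[OF bounded_linear_C2_of bij_C2_of C2_of_iso S(1)])
    show "(rot A t has_derivative rot A t) (at x)" for x
      by (rule bounded_linear_imp_has_derivative[OF bounded_linear_rot[OF A]])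
    show "inj_on (rot A t) S" by (rule inj_on_inverseI[of _ "rot A (- t)"]) (rule rot_inverse[OF A])
    show "rot A t ` S \<in> sets borel" using img B(1) by simp
    have "bounded punctured_ball" by (simp add: punctured_ball_def bounded_diff)
    then show "bounded (rot A t ` S)" unfolding img using B(2) bounded_subset by blast
    show "1 = \<bar>vol4 (rot A t (C2_of (axis 1 1))) (rot A t (C2_of (axis 2 1))) (rot A t (C2_of (axis 3 1))) (rot A t (C2_of (axis 4 1)))\<bar>"
      unfolding C2_of_axis rot_def by (subst vol4_rot[OF A]) simp_all
    show "(\<lambda>x. ennreal 1 * indicator S x) \<in> borel_measurable borel" using S(1) by measurable
  qed
  then have "emeasure lborel B = emeasure lborel S" using img S(1) by simp
  then show "emeasure (distr ball_measure ball_measure (rot A t)) B = emeasure ball_measure B"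
    using B S mB by (simp add: emeasure_distr ball_measure_def emeasure_restrict_space space_restrict_space
        S_def[symmetric] Int_absorb2)
qed simp

text \<open>The integral of \<open>G \<circ> rot A t\<close> does not depend on \<open>t\<close>, and its derivative at 0 is the left-hand side.\<close>

proposition integral_lie_eq_0:
  assumes G: "radial_direction G" and A: "A \<in> {mult_i, mult_j, mult_k}"
  shows "(LINT x|ball_measure. lie A G x) = 0"
proof -
  have bl: "bounded_linear A" by (rule rot_properties(1)[OF A])
  have rl: "radial_direction (lie A G)" by (rule radial_lie[OF G bl])
  obtain C where C: "\<And>x. x \<noteq> 0 \<Longrightarrow> \<bar>lie A G x\<bar> \<le> C" using radial_bounded[OF rl] by blast
  have m: "rot A t \<in> borel_measurable borel" for t
    by (rule borel_measurable_continuous_onI[OF linear_continuous_on[OF bounded_linear_rot[OF A]]])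
  have nz: "rot A t x \<noteq> 0" if "x \<noteq> 0" for t x
    using norm_rot[OF A, of t x] that by (metis norm_eq_zero)
  have const: "(LINT x|ball_measure. G (rot A t x)) = (LINT x|ball_measure. G x)" for t
  proof -
    have pb: "rot A s x \<in> punctured_ball \<longleftrightarrow> x \<in> punctured_ball" for s x
      unfolding mem_punctured_ball norm_rot[OF A] using norm_rot[OF A, of s x] by (metis norm_eq_zero)
    have mB: "rot A t \<in> ball_measure \<rightarrow>\<^sub>M ball_measure"
      unfolding ball_measure_def
      by (rule measurable_restrict_space3) (use m pb in \<open>auto simp: Pi_iff\<close>)
    have "(LINT x|ball_measure. G x) = (LINT x|distr ball_measure ball_measure (rot A t). G x)"
      by (simp only: ball_measure_rot[OF A])
    also have "\<dots> = (LINT x|ball_measure. G (rot A t x))"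
      by (rule integral_distr[OF mB measurable_ball_measure[OF radial_measurable[OF G]]])
    finally show ?thesis by simp
  qed
  have "((\<lambda>t. LINT x|ball_measure. G (rot A t x)) has_real_derivative (LINT x|ball_measure. lie A G (rot A 0 x))) (at 0)"
  proof (rule has_real_derivative_integral[OF finite_measure_ball zero_less_one])
    fix t x assume "x \<in> space ball_measure"
    then have x: "x \<noteq> 0" by (simp add: space_ball_measure mem_punctured_ball)
    have Arot: "A (rot A t x) = (- sin t) *\<^sub>R x + cos t *\<^sub>R A x"
      using bounded_linear.linear[OF bl] rot_properties(2)[OF A]
      by (simp add: rot_def linear_add linear_scale)
    have lin: "linear (DD G (rot A t x))"
      using smooth_on_differentiable[OF radial_smooth[OF G]] nz[OF x] by (intro linear_frechet_derivative) simp
    have "((\<lambda>t. rot A t x) has_derivative (\<lambda>h. h *\<^sub>R A (rot A t x))) (at t)"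
      unfolding Arot unfolding rot_def by (auto intro!: derivative_eq_intros simp: algebra_simps)
    from has_derivative_compose[OF this smooth_on_has_derivative[OF radial_smooth[OF G]]] nz[OF x]
    have "((\<lambda>t. G (rot A t x)) has_derivative (\<lambda>h. DD G (rot A t x) (h *\<^sub>R A (rot A t x)))) (at t)" by simp
    then show "((\<lambda>t. G (rot A t x)) has_real_derivative lie A G (rot A t x)) (at t)"
      by (simp add: has_field_derivative_def lie_def linear_scale[OF lin] mult_commute_abs)
    show "\<bar>lie A G (rot A t x)\<bar> \<le> C" by (rule C[OF nz[OF x]])
  next
    obtain K where K: "\<And>x. x \<noteq> 0 \<Longrightarrow> \<bar>G x\<bar> \<le> K" using radial_bounded[OF G] by blast
    show "integrable ball_measure (\<lambda>x. G (rot A t x))" for t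
      by (rule integrable_ball_measure[of _ K])
        (use measurable_compose[OF m radial_measurable[OF G]] K nz in auto)
    show "(\<lambda>x. lie A G (rot A 0 x)) \<in> borel_measurable ball_measure"
      by (rule measurable_ball_measure[OF measurable_compose[OF m radial_measurable[OF rl]]])
  qed
  then have "((\<lambda>t. LINT x|ball_measure. G x) has_real_derivative (LINT x|ball_measure. lie A G x)) (at (0::real))"
    unfolding const by (simp add: rot_def)
  then show ?thesis by (metis DERIV_const DERIV_unique)
qed

section \<open>First and second variation\<close>

lemma integral_ma_lin:
  assumes G: "radial_direction G" shows "(LINT x|ball_measure. ma_lin G x) = 0"
proof -
  have "integrable ball_measure (lie A (lie A G))" if "A \<in> {mult_i, mult_j, mult_k}" for A
    using rot_properties(1)[OF that] by (intro integrable_radial radial_lie G)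
  then show ?thesis
    using integral_lie_eq_0[OF radial_lie[OF G bounded_linear_mult_j], of mult_j]
      integral_lie_eq_0[OF radial_lie[OF G bounded_linear_mult_k], of mult_k]
    unfolding ma_lin_def by simp
qed

text \<open>The cubic \<open>|x|\<^sup>4 M\<close> along the ray \<open>e \<mapsto> e G\<close> of perturbations, and its derivatives in \<open>e\<close>.\<close>

definition det_ray :: "(C2 \<Rightarrow> real) \<Rightarrow> real \<Rightarrow> C2 \<Rightarrow> real" where
  "det_ray G e x = 1 + e * ma_lin G x + e^2 * ma_quad G x + e^3 * ma_cub G x"
definition det_ray' :: "(C2 \<Rightarrow> real) \<Rightarrow> real \<Rightarrow> C2 \<Rightarrow> real" where
  "det_ray' G e x = ma_lin G x + 2 * e * ma_quad G x + 3 * e^2 * ma_cub G x"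
definition det_ray'' :: "(C2 \<Rightarrow> real) \<Rightarrow> real \<Rightarrow> C2 \<Rightarrow> real" where
  "det_ray'' G e x = 2 * ma_quad G x + 6 * e * ma_cub G x"

text \<open>The integrand of the area along the ray, and its logarithmic derivative in \<open>e\<close>.\<close>

definition area_dens :: "(C2 \<Rightarrow> real) \<Rightarrow> real \<Rightarrow> C2 \<Rightarrow> real" where
  "area_dens G e x = 2 powr (7/3) * exp (- (4/3) * (e * G x)) * det_ray G e x powr (1/3)"
definition log_slope :: "(C2 \<Rightarrow> real) \<Rightarrow> real \<Rightarrow> C2 \<Rightarrow> real" where
  "log_slope G e x = - (4/3) * G x + det_ray' G e x / (3 * det_ray G e x)"
definition log_slope' :: "(C2 \<Rightarrow> real) \<Rightarrow> real \<Rightarrow> C2 \<Rightarrow> real" where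
  "log_slope' G e x = (det_ray'' G e x * det_ray G e x - det_ray' G e x ^ 2) / (3 * det_ray G e x ^ 2)"

lemma area_dens_derivatives:
  assumes "det_ray G e x > 0"
  shows "((\<lambda>e. area_dens G e x) has_real_derivative area_dens G e x * log_slope G e x) (at e)"
    and "((\<lambda>e. area_dens G e x * log_slope G e x) has_real_derivative area_dens G e x * (log_slope G e x ^ 2 + log_slope' G e x)) (at e)"
proof -
  have p: "((\<lambda>e. det_ray G e x) has_real_derivative det_ray' G e x) (at e)"
    unfolding det_ray_def det_ray'_def by (auto intro!: derivative_eq_intros)
  have p': "((\<lambda>e. det_ray' G e x) has_real_derivative det_ray'' G e x) (at e)"
    unfolding det_ray'_def det_ray''_def by (auto intro!: derivative_eq_intros)
  have pp: "det_ray G e x powr (1/3 - 1) = det_ray G e x powr (1/3) / det_ray G e x"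
    using assms by (subst powr_diff) simp
  have dexp: "((\<lambda>e. exp (- (4/3) * (e * G x))) has_real_derivative exp (- (4/3) * (e * G x)) * (- (4/3) * G x)) (at e)"
    by (auto intro!: derivative_eq_intros)
  have dpow: "((\<lambda>e. det_ray G e x powr (1/3)) has_real_derivative (1/3 * det_ray G e x powr (1/3 - 1)) * det_ray' G e x) (at e)"
    by (rule DERIV_chain2[OF has_real_derivative_powr[OF assms] p])
  have "((\<lambda>e. 2 powr (7/3) * (exp (- (4/3) * (e * G x)) * det_ray G e x powr (1/3))) has_real_derivative area_dens G e x * log_slope G e x) (at e)"
  proof (rule DERIV_cong[OF DERIV_cmult[OF DERIV_mult[OF dexp dpow]]])
    define E R where "E = exp (- (4/3) * (e * G x))" and "R = det_ray G e x powr (1/3)"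
    show "2 powr (7/3) * (exp (- (4/3) * (e * G x)) * (- (4/3) * G x) * det_ray G e x powr (1/3)
       + (1/3 * det_ray G e x powr (1/3 - 1)) * det_ray' G e x * exp (- (4/3) * (e * G x))) = area_dens G e x * log_slope G e x"
      unfolding pp area_dens_def log_slope_def E_def[symmetric] R_def[symmetric] using assms by (simp add: field_simps)
  qed
  then show 1: "((\<lambda>e. area_dens G e x) has_real_derivative area_dens G e x * log_slope G e x) (at e)"
    unfolding area_dens_def[abs_def] by (simp only: mult.assoc)
  have "((\<lambda>e. log_slope G e x) has_real_derivative log_slope' G e x) (at e)"
  proof -
    have "((\<lambda>e. - (4/3) * G x + det_ray' G e x / (3 * det_ray G e x)) has_real_derivative
       0 + (det_ray'' G e x * (3 * det_ray G e x) - det_ray' G e x * (3 * det_ray' G e x)) / ((3 * det_ray G e x) * (3 * det_ray G e x))) (at e)"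
      using assms by (intro DERIV_add DERIV_const DERIV_divide p' DERIV_cmult p) simp
    also have "0 + (det_ray'' G e x * (3 * det_ray G e x) - det_ray' G e x * (3 * det_ray' G e x)) / ((3 * det_ray G e x) * (3 * det_ray G e x)) = log_slope' G e x"
      unfolding log_slope'_def using assms by (simp add: field_simps power2_eq_square)
    finally show ?thesis unfolding log_slope_def .
  qed
  from DERIV_mult[OF 1 this]
  show "((\<lambda>e. area_dens G e x * log_slope G e x) has_real_derivative area_dens G e x * (log_slope G e x ^ 2 + log_slope' G e x)) (at e)"
    by (simp add: algebra_simps power2_eq_square)
qed

text \<open>If \<open>C\<close> bounds \<open>G\<close> and the three coefficients, the cubic stays between 1/2 and 3/2 for
\<open>|e| < 1 / (6 C)\<close>. There all surfaces are strongly pseudoconvex, and the integrands are dominated.\<close>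

lemma area_dens_bounds:
  assumes G: "radial_direction G"
  obtains d K where "0 < d" "d \<le> 1"
    "\<And>e x. \<bar>e\<bar> < d \<Longrightarrow> x \<noteq> 0 \<Longrightarrow> det_ray G e x > 0"
    "\<And>e x. \<bar>e\<bar> < d \<Longrightarrow> x \<noteq> 0 \<Longrightarrow> \<bar>area_dens G e x\<bar> \<le> K"
    "\<And>e x. \<bar>e\<bar> < d \<Longrightarrow> x \<noteq> 0 \<Longrightarrow> \<bar>area_dens G e x * log_slope G e x\<bar> \<le> K"
    "\<And>e x. \<bar>e\<bar> < d \<Longrightarrow> x \<noteq> 0 \<Longrightarrow> \<bar>area_dens G e x * (log_slope G e x ^ 2 + log_slope' G e x)\<bar> \<le> K"
proof -
  obtain C0 C1 C2 C3 where
    "\<And>x. x \<noteq> 0 \<Longrightarrow> \<bar>G x\<bar> \<le> C0" "\<And>x. x \<noteq> 0 \<Longrightarrow> \<bar>ma_lin G x\<bar> \<le> C1"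
    "\<And>x. x \<noteq> 0 \<Longrightarrow> \<bar>ma_quad G x\<bar> \<le> C2" "\<And>x. x \<noteq> 0 \<Longrightarrow> \<bar>ma_cub G x\<bar> \<le> C3"
    using radial_bounded[OF G] radial_bounded[OF radial_ma_lin[OF G]] radial_bounded[OF radial_ma_quad[OF G]]
      radial_bounded[OF radial_ma_cub[OF G]] by metis
  note b = this
  define C where "C = Max {1, C0, C1, C2, C3}"
  have C1: "C \<ge> 1" by (simp add: C_def)
  have CC: "C0 \<le> C" "C1 \<le> C" "C2 \<le> C" "C3 \<le> C" by (simp_all add: C_def)
  have C: "\<bar>G x\<bar> \<le> C" "\<bar>ma_lin G x\<bar> \<le> C" "\<bar>ma_quad G x\<bar> \<le> C" "\<bar>ma_cub G x\<bar> \<le> C" if "x \<noteq> 0" for x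
    using b[OF that] CC by linarith+
  define d where "d = 1 / (6 * C)"
  have d: "0 < d" "d \<le> 1" using C1 by (simp_all add: d_def)
  define F where "F = 2 powr (7/3) * exp (4/3 * C) * (3/2) powr (1/3)"
  \<comment> \<open>The cubic is at least 1/2, its first derivative at most 6 C, its second at most 8 C.\<close>
  define L where "L = 4/3 * C + 4 * C"
  define L' where "L' = (12 * C + 36 * C\<^sup>2) / (3/4)"
  have nn: "F \<ge> 0" "L \<ge> 0" "L' \<ge> 0" using C1 by (simp_all add: F_def L_def L'_def)
  have e2: "\<bar>e * y\<bar> \<le> C" if "\<bar>e\<bar> \<le> 1" "\<bar>y\<bar> \<le> C" for e y
    unfolding abs_mult using mult_mono[of "\<bar>e\<bar>" 1 "\<bar>y\<bar>" C] that C1 by simp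
  have pw: "\<bar>e ^ n\<bar> \<le> 1" if "\<bar>e\<bar> < d" for e :: real and n
    using that d by (simp add: power_abs power_le_one)
  have det_ray: "1/2 \<le> det_ray G e x" "det_ray G e x \<le> 3/2" if e: "\<bar>e\<bar> < d" and x: "x \<noteq> 0" for e x
  proof -
    have "\<bar>ma_lin G x + e * ma_quad G x + e^2 * ma_cub G x\<bar> \<le> 3 * C"
      using C(2)[OF x] e2[OF pw[OF e, of 1, simplified] C(3)[OF x]] e2[OF pw[OF e, of 2] C(4)[OF x]] by linarith
    then have "\<bar>e\<bar> * \<bar>ma_lin G x + e * ma_quad G x + e^2 * ma_cub G x\<bar> \<le> d * (3 * C)"
      using e by (intro mult_mono) auto
    also have "\<dots> = 1/2" using C1 by (simp add: d_def)
    finally have "\<bar>e * (ma_lin G x + e * ma_quad G x + e^2 * ma_cub G x)\<bar> \<le> 1/2" by (simp only: abs_mult)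
    moreover have "det_ray G e x = 1 + e * (ma_lin G x + e * ma_quad G x + e^2 * ma_cub G x)"
      by (simp add: det_ray_def algebra_simps power2_eq_square power3_eq_cube)
    ultimately show "1/2 \<le> det_ray G e x" "det_ray G e x \<le> 3/2" by linarith+
  qed
  have area_dens: "\<bar>area_dens G e x\<bar> \<le> F" if e: "\<bar>e\<bar> < d" and x: "x \<noteq> 0" for e x
  proof -
    have "\<bar>e * G x\<bar> \<le> C" using e2[OF pw[OF e, of 1, simplified] C(1)[OF x]] .
    then have "exp (- (4/3) * (e * G x)) \<le> exp (4/3 * C)" by (simp add: abs_le_iff)
    moreover have "det_ray G e x powr (1/3) \<le> (3/2) powr (1/3)" using det_ray[OF e x] by (intro powr_mono2) auto
    ultimately show ?thesis unfolding area_dens_def F_def by (simp add: abs_mult mult_mono)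
  qed
  have det_ray': "\<bar>det_ray' G e x\<bar> \<le> 6 * C" and det_ray'': "\<bar>det_ray'' G e x\<bar> \<le> 8 * C" if e: "\<bar>e\<bar> < d" and x: "x \<noteq> 0" for e x
    using C(2)[OF x] C(3)[OF x] e2[OF pw[OF e, of 1, simplified] C(3)[OF x]] e2[OF pw[OF e, of 2] C(4)[OF x]]
      e2[OF pw[OF e, of 1, simplified] C(4)[OF x]]
    unfolding det_ray'_def det_ray''_def mult.assoc by linarith+
  have log_slope: "\<bar>log_slope G e x\<bar> \<le> L" if e: "\<bar>e\<bar> < d" and x: "x \<noteq> 0" for e x
  proof -
    have "\<bar>det_ray' G e x / (3 * det_ray G e x)\<bar> = \<bar>det_ray' G e x\<bar> / (3 * det_ray G e x)" using det_ray[OF e x] by (simp add: abs_divide)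
    also have "\<dots> \<le> (6 * C) / (3/2)" using det_ray[OF e x] det_ray'[OF e x] C1 by (intro frac_le) auto
    finally have "\<bar>det_ray' G e x / (3 * det_ray G e x)\<bar> \<le> 4 * C" by simp
    then show ?thesis unfolding log_slope_def L_def using C(1)[OF x] by linarith
  qed
  have log_slope': "\<bar>log_slope' G e x\<bar> \<le> L'" if e: "\<bar>e\<bar> < d" and x: "x \<noteq> 0" for e x
  proof -
    have 1: "\<bar>det_ray'' G e x * det_ray G e x\<bar> \<le> (8 * C) * (3/2)"
      unfolding abs_mult using det_ray[OF e x] det_ray''[OF e x] C1 by (intro mult_mono) auto
    have 2: "\<bar>det_ray' G e x ^ 2\<bar> \<le> (6 * C) ^ 2"
      unfolding power_abs using det_ray'[OF e x] by (intro power_mono) auto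
    have 3: "\<bar>det_ray'' G e x * det_ray G e x - det_ray' G e x ^ 2\<bar> \<le> 12 * C + 36 * C\<^sup>2"
    proof -
      have "\<bar>det_ray'' G e x * det_ray G e x - det_ray' G e x ^ 2\<bar> \<le> \<bar>det_ray'' G e x * det_ray G e x\<bar> + \<bar>det_ray' G e x ^ 2\<bar>"
        by (rule abs_triangle_ineq4)
      also have "\<dots> \<le> 8 * C * (3/2) + (6 * C)\<^sup>2" by (rule add_mono[OF 1 2])
      finally show ?thesis by (simp add: power_mult_distrib)
    qed
    have "(1/2)^2 \<le> (det_ray G e x)^2" using det_ray[OF e x] by (intro power_mono) auto
    then have 4: "3/4 \<le> 3 * det_ray G e x ^ 2" by (simp add: power_divide)
    have "\<bar>log_slope' G e x\<bar> = \<bar>det_ray'' G e x * det_ray G e x - det_ray' G e x ^ 2\<bar> / (3 * det_ray G e x ^ 2)"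
      unfolding log_slope'_def by (simp add: abs_divide)
    also have "\<dots> \<le> L'" unfolding L'_def using 3 4 C1 by (intro frac_le) auto
    finally show ?thesis .
  qed
  define K where "K = F + F * L + F * (L\<^sup>2 + L')"
  have K: "F \<le> K" "F * L \<le> K" "F * (L\<^sup>2 + L') \<le> K" using nn by (simp_all add: K_def)
  show ?thesis
  proof (rule that[OF d, of K])
    fix e x assume e: "\<bar>e\<bar> < d" and x: "x \<noteq> (0::C2)"
    show "det_ray G e x > 0" using det_ray[OF e x] by simp
    show "\<bar>area_dens G e x\<bar> \<le> K" using area_dens[OF e x] K by linarith
    have "\<bar>area_dens G e x * log_slope G e x\<bar> \<le> F * L"
      unfolding abs_mult using area_dens[OF e x] log_slope[OF e x] nn by (intro mult_mono) auto
    then show "\<bar>area_dens G e x * log_slope G e x\<bar> \<le> K" using K by linarith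
    have "\<bar>log_slope G e x ^ 2\<bar> \<le> L\<^sup>2" unfolding power_abs using log_slope[OF e x] by (intro power_mono) auto
    then have "\<bar>log_slope G e x ^ 2 + log_slope' G e x\<bar> \<le> L\<^sup>2 + L'" using log_slope'[OF e x] by linarith
    then have "\<bar>area_dens G e x * (log_slope G e x ^ 2 + log_slope' G e x)\<bar> \<le> F * (L\<^sup>2 + L')"
      unfolding abs_mult using area_dens[OF e x] nn by (intro mult_mono) auto
    then show "\<bar>area_dens G e x * (log_slope G e x ^ 2 + log_slope' G e x)\<bar> \<le> K" using K by linarith
  qed
qed

lemma area_dens_measurable:
  assumes G: "radial_direction G"
  shows "area_dens G e \<in> borel_measurable borel" "(\<lambda>x. area_dens G e x * log_slope G e x) \<in> borel_measurable borel"
    "(\<lambda>x. area_dens G e x * (log_slope G e x ^ 2 + log_slope' G e x)) \<in> borel_measurable borel"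
proof -
  note [measurable] = radial_measurable[OF G] radial_measurable[OF radial_ma_lin[OF G]]
    radial_measurable[OF radial_ma_quad[OF G]] radial_measurable[OF radial_ma_cub[OF G]]
  have [measurable]: "det_ray G e \<in> borel_measurable borel" "det_ray' G e \<in> borel_measurable borel" "det_ray'' G e \<in> borel_measurable borel"
    unfolding det_ray_def det_ray'_def det_ray''_def by measurable
  show [measurable]: "area_dens G e \<in> borel_measurable borel" unfolding area_dens_def by measurable
  have [measurable]: "log_slope G e \<in> borel_measurable borel" "log_slope' G e \<in> borel_measurable borel"
    unfolding log_slope_def log_slope'_def by measurable
  show "(\<lambda>x. area_dens G e x * log_slope G e x) \<in> borel_measurable borel"
    "(\<lambda>x. area_dens G e x * (log_slope G e x ^ 2 + log_slope' G e x)) \<in> borel_measurable borel" by measurable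
qed

lemma fefferman_area_ray:
  assumes G: "radial_direction G" and pos: "\<And>x. x \<noteq> 0 \<Longrightarrow> det_ray G e x > 0"
  shows "fefferman_area (perturbed_sphere G e) = (LINT x|ball_measure. area_dens G e x)"
proof -
  have H: "radial_direction (\<lambda>x. e * G x)" by (rule radial_cmult[OF G])
  have ma_det: "ma_det (\<lambda>x. e * G x) x = det_ray G e x" if "x \<noteq> 0" for x
    using ma_det_cmult[OF G that] by (simp add: det_ray_def)
  have "fefferman_area (sph (\<lambda>x. e * G x)) = (LINT x|ball_measure. cone_weight (\<lambda>x. e * G x) x)"
    using ma_det pos by (intro fefferman_area_eq[OF H]) simp
  also have "\<dots> = (LINT x|ball_measure. area_dens G e x)"
  proof (rule integral_ball_measure_cong)
    fix x :: C2 assume x: "x \<noteq> 0"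
    have "root 3 (det_ray G e x) = det_ray G e x powr (1/3)" using pos[OF x] by (simp add: root_powr_inverse)
    then show "cone_weight (\<lambda>x. e * G x) x = area_dens G e x" by (simp add: cone_weight_def area_dens_def ma_det[OF x])
  qed
  finally show ?thesis by (simp only: perturbed_sphere_cmult[of G e])
qed

lemma enclosed_volume_ray:
  assumes G: "radial_direction G"
  shows "enclosed_volume (perturbed_sphere G e) = (LINT x|ball_measure. exp (- 2 * (e * G x)))"
  using enclosed_volume_eq[OF radial_cmult[OF G, of e]] by (simp only: perturbed_sphere_cmult[of G e])

definition volume_ray :: "(C2 \<Rightarrow> real) \<Rightarrow> real \<Rightarrow> real" where
  "volume_ray G e = (LINT x|ball_measure. exp (- 2 * (e * G x)))"
definition volume_ray' :: "(C2 \<Rightarrow> real) \<Rightarrow> real \<Rightarrow> real" where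
  "volume_ray' G e = (LINT x|ball_measure. - 2 * G x * exp (- 2 * (e * G x)))"
definition volume_ray'' :: "(C2 \<Rightarrow> real) \<Rightarrow> real \<Rightarrow> real" where
  "volume_ray'' G e = (LINT x|ball_measure. 4 * G x ^ 2 * exp (- 2 * (e * G x)))"

lemma volume_ray_derivatives:
  assumes G: "radial_direction G"
  shows "(volume_ray G has_real_derivative volume_ray' G e) (at e)"
    and "(volume_ray' G has_real_derivative volume_ray'' G e) (at e)"
proof -
  note [measurable] = radial_measurable[OF G]
  obtain C where C: "C > 0" "\<And>x. x \<noteq> 0 \<Longrightarrow> \<bar>G x\<bar> \<le> C" using radial_bounded[OF G] by blast
  define E where "E = exp (2 * ((\<bar>e\<bar> + 1) * C))"
  have ex: "exp (- 2 * (a * G x)) \<le> E" if "\<bar>a - e\<bar> < 1" "x \<noteq> 0" for a x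
  proof -
    have "\<bar>a * G x\<bar> \<le> (\<bar>e\<bar> + 1) * C" unfolding abs_mult using that C by (intro mult_mono) auto
    then have "- 2 * (a * G x) \<le> 2 * ((\<bar>e\<bar> + 1) * C)" by linarith
    then show ?thesis unfolding E_def by (simp only: exp_le_cancel_iff)
  qed
  have nz: "x \<noteq> 0" if "x \<in> space ball_measure" for x using that by (simp add: space_ball_measure mem_punctured_ball)
  have b1: "\<bar>- 2 * G x * exp (- 2 * (a * G x))\<bar> \<le> 2 * C * E" if "\<bar>a - e\<bar> < 1" "x \<noteq> 0" for a x
    using mult_mono[OF C(2)[OF that(2)] ex[OF that]] C(1) by (simp add: abs_mult E_def)
  have b2: "\<bar>4 * G x ^ 2 * exp (- 2 * (a * G x))\<bar> \<le> 4 * C\<^sup>2 * E" if "\<bar>a - e\<bar> < 1" "x \<noteq> 0" for a x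
  proof -
    have "G x ^ 2 \<le> C\<^sup>2" using power_mono[OF C(2)[OF that(2)], of 2] by simp
    then show ?thesis using mult_mono[OF _ ex[OF that], of "G x ^ 2" "C\<^sup>2"] by (simp add: abs_mult E_def)
  qed
  show "(volume_ray G has_real_derivative volume_ray' G e) (at e)"
    unfolding volume_ray_def[abs_def] volume_ray'_def
  proof (rule has_real_derivative_integral[OF finite_measure_ball zero_less_one])
    show "((\<lambda>e. exp (- 2 * (e * G x))) has_real_derivative - 2 * G x * exp (- 2 * (a * G x))) (at a)" for a x
      by (auto intro!: derivative_eq_intros)
    show "integrable ball_measure (\<lambda>x. exp (- 2 * (a * G x)))" if "\<bar>a - e\<bar> < 1" for a
      by (rule integrable_ball_measure[where C=E]) (use ex[OF that] in auto)
    show "(\<lambda>x. - 2 * G x * exp (- 2 * (e * G x))) \<in> borel_measurable ball_measure"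
      by (rule measurable_ball_measure) measurable
  qed (use b1 nz in blast)
  show "(volume_ray' G has_real_derivative volume_ray'' G e) (at e)"
    unfolding volume_ray'_def[abs_def] volume_ray''_def
  proof (rule has_real_derivative_integral[OF finite_measure_ball zero_less_one])
    show "((\<lambda>e. - 2 * G x * exp (- 2 * (e * G x))) has_real_derivative 4 * G x ^ 2 * exp (- 2 * (a * G x))) (at a)" for a x
      by (auto intro!: derivative_eq_intros simp: power2_eq_square)
    show "integrable ball_measure (\<lambda>x. - 2 * G x * exp (- 2 * (a * G x)))" if "\<bar>a - e\<bar> < 1" for a
      by (rule integrable_ball_measure[where C="2 * C * E"]) (use b1[OF that] in auto)
    show "(\<lambda>x. 4 * G x ^ 2 * exp (- 2 * (e * G x))) \<in> borel_measurable ball_measure"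
      by (rule measurable_ball_measure) measurable
  qed (use b2 nz in blast)
qed

definition area_ray :: "(C2 \<Rightarrow> real) \<Rightarrow> real \<Rightarrow> real" where
  "area_ray G e = (LINT x|ball_measure. area_dens G e x)"
definition area_ray' :: "(C2 \<Rightarrow> real) \<Rightarrow> real \<Rightarrow> real" where
  "area_ray' G e = (LINT x|ball_measure. area_dens G e x * log_slope G e x)"
definition area_ray'' :: "(C2 \<Rightarrow> real) \<Rightarrow> real \<Rightarrow> real" where
  "area_ray'' G e = (LINT x|ball_measure. area_dens G e x * (log_slope G e x ^ 2 + log_slope' G e x))"

lemma area_ray_derivatives:
  assumes G: "radial_direction G"
  obtains d where "0 < d" "\<And>e. \<bar>e\<bar> < d \<Longrightarrow> fefferman_area (perturbed_sphere G e) = area_ray G e"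
    "\<And>e. \<bar>e\<bar> < d \<Longrightarrow> (area_ray G has_real_derivative area_ray' G e) (at e)"
    "\<And>e. \<bar>e\<bar> < d \<Longrightarrow> (area_ray' G has_real_derivative area_ray'' G e) (at e)"
proof -
  obtain d K where d: "0 < d" "d \<le> 1"
    and pos: "\<And>e x. \<bar>e\<bar> < d \<Longrightarrow> x \<noteq> 0 \<Longrightarrow> det_ray G e x > 0"
    and K0: "\<And>e x. \<bar>e\<bar> < d \<Longrightarrow> x \<noteq> 0 \<Longrightarrow> \<bar>area_dens G e x\<bar> \<le> K"
    and K1: "\<And>e x. \<bar>e\<bar> < d \<Longrightarrow> x \<noteq> 0 \<Longrightarrow> \<bar>area_dens G e x * log_slope G e x\<bar> \<le> K"
    and K2: "\<And>e x. \<bar>e\<bar> < d \<Longrightarrow> x \<noteq> 0 \<Longrightarrow> \<bar>area_dens G e x * (log_slope G e x ^ 2 + log_slope' G e x)\<bar> \<le> K"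
    using area_dens_bounds[OF G] by blast
  have near: "\<bar>a\<bar> < d" if "\<bar>a - e\<bar> < d - \<bar>e\<bar>" for a e using that by linarith
  have nz: "x \<noteq> 0" if "x \<in> space ball_measure" for x using that by (simp add: space_ball_measure mem_punctured_ball)
  show thesis
  proof (rule that[OF d(1)])
    fix e assume e: "\<bar>e\<bar> < d"
    then have de: "d - \<bar>e\<bar> > 0" by simp
    show "fefferman_area (perturbed_sphere G e) = area_ray G e"
      unfolding area_ray_def by (rule fefferman_area_ray[OF G pos[OF e]])
    show "(area_ray G has_real_derivative area_ray' G e) (at e)"
      unfolding area_ray_def[abs_def] area_ray'_def
    proof (rule has_real_derivative_integral[OF finite_measure_ball de, where C=K])
      fix a assume "\<bar>a - e\<bar> < d - \<bar>e\<bar>"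
      then have a: "\<bar>a\<bar> < d" by (rule near)
      show "integrable ball_measure (area_dens G a)"
        by (rule integrable_ball_measure[OF area_dens_measurable(1)[OF G] K0[OF a]])
      fix x assume "x \<in> space ball_measure"
      then have x: "x \<noteq> 0" by (rule nz)
      show "((\<lambda>e. area_dens G e x) has_real_derivative area_dens G a x * log_slope G a x) (at a)" by (rule area_dens_derivatives(1)[OF pos[OF a x]])
      show "\<bar>area_dens G a x * log_slope G a x\<bar> \<le> K" by (rule K1[OF a x])
    qed (rule measurable_ball_measure[OF area_dens_measurable(2)[OF G]])
    show "(area_ray' G has_real_derivative area_ray'' G e) (at e)"
      unfolding area_ray'_def[abs_def] area_ray''_def
    proof (rule has_real_derivative_integral[OF finite_measure_ball de, where C=K])
      fix a assume "\<bar>a - e\<bar> < d - \<bar>e\<bar>"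
      then have a: "\<bar>a\<bar> < d" by (rule near)
      show "integrable ball_measure (\<lambda>x. area_dens G a x * log_slope G a x)"
        by (rule integrable_ball_measure[OF area_dens_measurable(2)[OF G] K1[OF a]])
      fix x assume "x \<in> space ball_measure"
      then have x: "x \<noteq> 0" by (rule nz)
      show "((\<lambda>e. area_dens G e x * log_slope G e x) has_real_derivative area_dens G a x * (log_slope G a x ^ 2 + log_slope' G a x)) (at a)"
        by (rule area_dens_derivatives(2)[OF pos[OF a x]])
      show "\<bar>area_dens G a x * (log_slope G a x ^ 2 + log_slope' G a x)\<bar> \<le> K" by (rule K2[OF a x])
    qed (rule measurable_ball_measure[OF area_dens_measurable(3)[OF G]])
  qed
qed

lemma area_ray_0: "area_ray G 0 = 2 powr (7/3) * ball_vol"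
  and volume_ray_0: "volume_ray G 0 = ball_vol"
  by (simp_all add: area_ray_def volume_ray_def area_dens_def det_ray_def ball_vol_def)

definition quotient_ray' :: "(C2 \<Rightarrow> real) \<Rightarrow> real \<Rightarrow> real" where
  "quotient_ray' G e = (3/2 * area_ray G e powr (1/2) * area_ray' G e * volume_ray G e
     - area_ray G e powr (3/2) * volume_ray' G e) / (volume_ray G e)\<^sup>2"

lemma quotient_derivative:
  assumes G: "radial_direction G"
  shows "\<forall>\<^sub>F e in nhds 0. ((\<lambda>e. iso_quotient (perturbed_sphere G e)) has_real_derivative quotient_ray' G e) (at e)"
proof -
  obtain d where d: "0 < d" and area: "\<And>e. \<bar>e\<bar> < d \<Longrightarrow> fefferman_area (perturbed_sphere G e) = area_ray G e"
    and dF: "\<And>e. \<bar>e\<bar> < d \<Longrightarrow> (area_ray G has_real_derivative area_ray' G e) (at e)"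
    using area_ray_derivatives[OF G] by metis
  have "\<forall>\<^sub>F e in nhds 0. area_ray G e > 0 \<and> volume_ray G e > 0"
  proof (rule eventually_conj)
    have "isCont (area_ray G) 0" "isCont (volume_ray G) 0"
      using dF[of 0] volume_ray_derivatives(1)[OF G, of 0] d by (auto intro: DERIV_isCont)
    moreover have "area_ray G 0 > 0" "volume_ray G 0 > 0" using ball_vol_pos by (simp_all add: area_ray_0 volume_ray_0)
    ultimately show "\<forall>\<^sub>F e in nhds 0. area_ray G e > 0" "\<forall>\<^sub>F e in nhds 0. volume_ray G e > 0"
      unfolding continuous_at by (auto dest: order_tendstoD simp: tendsto_at_iff_tendsto_nhds)
  qed
  moreover have "\<forall>\<^sub>F e in nhds 0. \<bar>e\<bar> < d"
    unfolding eventually_nhds_metric using d by (intro exI[of _ d]) (auto simp: dist_real_def)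
  ultimately show ?thesis
  proof eventually_elim
    case (elim e)
    then have ed: "\<bar>e\<bar> < d" and FV: "area_ray G e > 0" "volume_ray G e > 0" by auto
    have "((\<lambda>e. area_ray G e powr (3/2)) has_real_derivative (3/2 * area_ray G e powr (3/2 - 1)) * area_ray' G e) (at e)"
      by (rule DERIV_chain2[OF has_real_derivative_powr[OF FV(1)] dF[OF ed]])
    from DERIV_divide[OF this volume_ray_derivatives(1)[OF G]] FV
    have "((\<lambda>e. area_ray G e powr (3/2) / volume_ray G e) has_real_derivative quotient_ray' G e) (at e)"
      by (simp add: power2_eq_square quotient_ray'_def)
    then show ?case
    proof (rule has_field_derivative_transform_within_open[where S="{-d<..<d}"])
      fix a assume "a \<in> {- d<..<d}"
      then have "fefferman_area (perturbed_sphere G a) = area_ray G a" by (intro area) auto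
      then show "area_ray G a powr (3/2) / volume_ray G a = iso_quotient (perturbed_sphere G a)"
        unfolding iso_quotient_def enclosed_volume_ray[OF G] volume_ray_def by simp
    qed (use ed in auto)
  qed
qed

lemma area_ray'_0:
  assumes G: "radial_direction G"
  shows "area_ray' G 0 = - (4/3) * 2 powr (7/3) * (LINT x|ball_measure. G x)"
proof -
  define c :: real where "c = 2 powr (7/3)"
  have "area_ray' G 0 = (LINT x|ball_measure. (- (4/3) * c) * G x + (c/3) * ma_lin G x)"
    unfolding area_ray'_def
    by (rule integral_ball_measure_cong) (simp add: area_dens_def log_slope_def det_ray_def det_ray'_def c_def field_simps)
  also have "\<dots> = (- (4/3) * c) * (LINT x|ball_measure. G x) + (c/3) * (LINT x|ball_measure. ma_lin G x)"
    using integrable_radial[OF G] integrable_radial[OF radial_ma_lin[OF G]]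
    by (subst Bochner_Integration.integral_add) simp_all
  finally show ?thesis by (simp add: integral_ma_lin[OF G] c_def)
qed

lemma powr_three_halves: "(3/2) * (a :: real) powr (1/2) * a = (3/2) * a powr (3/2)" if "a > 0"
  using powr_add[of a "1/2" 1] that by simp

text \<open>The derivatives of area and volume are \<open>-4/3\<close> and \<open>-2\<close> times the mean of \<open>G\<close>, relative to their values,
and the exponent \<open>3/2\<close> of the area makes them cancel.\<close>

proposition first_variation:
  assumes G: "radial_direction G"
  shows "((\<lambda>e. iso_quotient (perturbed_sphere G e)) has_real_derivative 0) (at 0)"
proof -
  have "((\<lambda>e. iso_quotient (perturbed_sphere G e)) has_real_derivative quotient_ray' G 0) (at 0)"
    using quotient_derivative[OF G] by (rule eventually_nhds_x_imp_x)
  moreover have "quotient_ray' G 0 = 0"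
  proof -
    define c where "c = 2 powr (7/3) * ball_vol"
    have c: "c > 0" using ball_vol_pos by (simp add: c_def)
    have "volume_ray' G 0 = - 2 * (LINT x|ball_measure. G x)" by (simp add: volume_ray'_def)
    then have "3/2 * area_ray G 0 powr (1/2) * area_ray' G 0 * volume_ray G 0 - area_ray G 0 powr (3/2) * volume_ray' G 0
      = - (4/3) * (LINT x|ball_measure. G x) * ((3/2) * c powr (1/2) * c) + c powr (3/2) * (2 * (LINT x|ball_measure. G x))"
      unfolding area_ray_0 volume_ray_0 area_ray'_0[OF G] by (simp add: c_def)
    also have "\<dots> = 0" unfolding powr_three_halves[OF c] by simp
    finally show ?thesis by (simp add: quotient_ray'_def)
  qed
  ultimately show ?thesis by simp
qed

definition second_variation_density :: "(C2 \<Rightarrow> real) \<Rightarrow> C2 \<Rightarrow> real" where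
  "second_variation_density G x = - (4/3) * G x ^ 2 - (4/3) * (G x * ma_lin G x) - (1/3) * ma_lin G x ^ 2 + ma_quad G x"

text \<open>Since the first derivatives of area and volume vanish at 0, only the term with the combination
\<open>3/2 F'' - 2\<^sup>7\<^sup>/\<^sup>3 V''\<close> of second derivatives survives in the quotient rule.\<close>

proposition second_variation:
  assumes G: "radial_direction G" and I: "(LINT x|ball_measure. G x) = 0"
  obtains k where "k > 0" "has_second_derivative (\<lambda>e. iso_quotient (perturbed_sphere G e))
    (k * (LINT x|ball_measure. second_variation_density G x)) 0"
proof -
  define c :: real where "c = 2 powr (7/3)"
  define F F1 V V1 where F: "F = area_ray G" and F1: "F1 = area_ray' G" and V: "V = volume_ray G" and V1: "V1 = volume_ray' G"
  define F2 V2 where "F2 = area_ray'' G 0" and "V2 = volume_ray'' G 0"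
  have cv: "c * ball_vol > 0" and c0: "c > 0" using ball_vol_pos by (simp_all add: c_def)
  have F0: "F 0 = c * ball_vol" and V0: "V 0 = ball_vol" and F10: "F1 0 = 0" and V10: "V1 0 = 0"
    using I by (simp_all add: F V F1 V1 area_ray_0 volume_ray_0 area_ray'_0[OF G] volume_ray'_def c_def)
  have dF: "(F has_real_derivative 0) (at 0)" and dF1: "(F1 has_real_derivative F2) (at 0)"
    using area_ray_derivatives[OF G] F10 unfolding F F1 F2_def by (metis abs_zero)+
  have dV: "(V has_real_derivative 0) (at 0)" and dV1: "(V1 has_real_derivative V2) (at 0)"
    using volume_ray_derivatives[OF G, of 0] V10 unfolding V V1 V2_def by simp_all
  have i: "integrable ball_measure (\<lambda>x. G x ^ 2)" "integrable ball_measure (\<lambda>x. G x * ma_lin G x)"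
     "integrable ball_measure (\<lambda>x. ma_lin G x ^ 2)" "integrable ball_measure (ma_quad G)"
    by (intro integrable_radial radial_power radial_mult radial_ma_lin radial_ma_quad G)+
  define k where "k = c * (c * ball_vol) powr (1/2) / ball_vol"
  define T where "T = (LINT x|ball_measure. second_variation_density G x)"
  have key: "3/2 * F2 - c * V2 = c * T"
  proof -
    define i1 i2 i3 i4 where "i1 = (LINT x|ball_measure. G x ^ 2)" and "i2 = (LINT x|ball_measure. G x * ma_lin G x)"
      and "i3 = (LINT x|ball_measure. ma_lin G x ^ 2)" and "i4 = (LINT x|ball_measure. ma_quad G x)"
    have lin: "(LINT x|ball_measure. p * G x ^ 2 + q * (G x * ma_lin G x) + r * ma_lin G x ^ 2 + s * ma_quad G x)
       = p * i1 + q * i2 + r * i3 + s * i4" for p q r s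
      unfolding i1_def i2_def i3_def i4_def using i by simp
    have F2_eq: "F2 = (c * 16/9) * i1 + (- c * 8/9) * i2 + (- c * 2/9) * i3 + (c * 2/3) * i4"
      unfolding F2_def area_ray''_def lin[symmetric]
      by (rule integral_ball_measure_cong)
        (simp add: area_dens_def log_slope_def log_slope'_def det_ray_def det_ray'_def det_ray''_def c_def field_simps power2_eq_square)
    have T_eq: "T = (- 4/3) * i1 + (- 4/3) * i2 + (- 1/3) * i3 + 1 * i4"
      unfolding T_def second_variation_density_def lin[symmetric] by (rule integral_ball_measure_cong) simp
    have V2_eq: "V2 = 4 * i1" by (simp add: V2_def volume_ray''_def i1_def)
    show ?thesis unfolding F2_eq T_eq V2_eq by (simp add: field_simps)
  qed
  have Fp: "((\<lambda>e. F e powr s) has_real_derivative 0) (at 0)" for s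
    using DERIV_chain2[OF has_real_derivative_powr[of "F 0" s] dF] cv by (simp add: F0)
  have "((\<lambda>e. 3/2 * F e powr (1/2) * F1 e * V e - F e powr (3/2) * V1 e) has_real_derivative
     3/2 * F 0 powr (1/2) * F2 * V 0 - F 0 powr (3/2) * V2) (at 0)"
    by (rule DERIV_cong[OF DERIV_diff[OF DERIV_mult[OF DERIV_mult[OF DERIV_cmult[OF Fp] dF1] dV] DERIV_mult[OF Fp dV1]]])
      (simp add: F10 V10)
  moreover have "((\<lambda>e. (V e)\<^sup>2) has_real_derivative 0) (at 0)"
    by (rule DERIV_cong[OF DERIV_power[OF dV]]) simp
  ultimately have "((\<lambda>e. (3/2 * F e powr (1/2) * F1 e * V e - F e powr (3/2) * V1 e) / (V e)\<^sup>2) has_real_derivative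
     ((3/2 * F 0 powr (1/2) * F2 * V 0 - F 0 powr (3/2) * V2) * (V 0)\<^sup>2
       - (3/2 * F 0 powr (1/2) * F1 0 * V 0 - F 0 powr (3/2) * V1 0) * 0) / ((V 0)\<^sup>2 * (V 0)\<^sup>2)) (at 0)"
    by (rule DERIV_divide) (use ball_vol_pos V0 in simp)
  moreover have "((3/2 * F 0 powr (1/2) * F2 * V 0 - F 0 powr (3/2) * V2) * (V 0)\<^sup>2
       - (3/2 * F 0 powr (1/2) * F1 0 * V 0 - F 0 powr (3/2) * V1 0) * 0) / ((V 0)\<^sup>2 * (V 0)\<^sup>2) = k * T"
  proof -
    have p: "(c * ball_vol) powr (3/2) = (c * ball_vol) * (c * ball_vol) powr (1/2)"
      using powr_three_halves[OF cv] by (simp add: mult_ac)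
    have "((3/2 * F 0 powr (1/2) * F2 * V 0 - F 0 powr (3/2) * V2) * (V 0)\<^sup>2
       - (3/2 * F 0 powr (1/2) * F1 0 * V 0 - F 0 powr (3/2) * V1 0) * 0) / ((V 0)\<^sup>2 * (V 0)\<^sup>2)
      = (c * ball_vol) powr (1/2) * (3/2 * F2 - c * V2) / ball_vol"
      unfolding F0 V0 p using ball_vol_pos by (simp add: field_simps power2_eq_square)
    then show ?thesis unfolding key k_def by simp
  qed
  ultimately have "(quotient_ray' G has_real_derivative k * T) (at 0)"
    unfolding quotient_ray'_def[abs_def] F F1 V V1 by simp
  then have "has_second_derivative (\<lambda>e. iso_quotient (perturbed_sphere G e)) (k * T) 0"
    unfolding has_second_derivative_def using quotient_derivative[OF G] by blast
  moreover have "k > 0" using cv c0 ball_vol_pos by (simp add: k_def)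
  ultimately show thesis using that unfolding T_def by blast
qed

section \<open>Perturbations of both signs\<close>

text \<open>In the coordinates \<open>z\<close> and the conjugate of \<open>w\<close>, the quaternion units act complex linearly, so their
rotation fields act on polynomials in these two variables as derivations, and commute with taking
the real part and dividing by powers of \<open>|x|\<close>.\<close>

definition radial_Re :: "nat \<Rightarrow> (C2 \<Rightarrow> complex) \<Rightarrow> C2 \<Rightarrow> real" where
  "radial_Re n h x = Re (h x) * inverse ((x \<bullet> x) ^ n)"

lemma radial_radial_Re:
  assumes h: "smooth_on UNIV h" and hom: "\<And>t x. t > 0 \<Longrightarrow> h (t *\<^sub>R x) = of_real (t ^ (2 * n)) * h x"
  shows "radial_direction (radial_Re n h)"
  unfolding radial_direction_def
proof (intro conjI allI impI)
  have sh: "smooth_on (- {0}) h" by (rule smooth_on_subset[OF h open_punctured]) simp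
  have sid: "smooth_on (- {0}) (\<lambda>x::C2. x)" by (rule smooth_on_bounded_linear[OF open_punctured bounded_linear_ident])
  show "smooth_on (- {0}) (radial_Re n h)"
    unfolding radial_Re_def
    by (rule smooth_on_mult[OF smooth_on_linear_compose[OF bounded_linear_Re sh]
          smooth_on_inverse[OF smooth_on_power[OF smooth_on_inner[OF sid sid]]]]) auto
  fix p :: C2 and t :: real assume "p \<noteq> 0" "t > 0"
  then show "radial_Re n h (t *\<^sub>R p) = radial_Re n h p"
    unfolding radial_Re_def hom[OF \<open>t > 0\<close>]
    by (simp add: power_mult_distrib power_mult power2_eq_square field_simps flip: of_real_power)
qed

lemma lie_radial_Re:
  assumes h: "(h has_derivative h') (at x)" and hA: "h' (A x) = g x" and A: "x \<bullet> A x = 0" and x: "x \<noteq> 0"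
  shows "lie A (radial_Re n h) x = radial_Re n g x"
proof -
  have q: "((\<lambda>y. inverse ((y \<bullet> y) ^ n)) has_derivative
     (\<lambda>v. - (inverse ((x \<bullet> x) ^ n) * (of_nat n * (x \<bullet> v + v \<bullet> x) * (x \<bullet> x) ^ (n - 1)) * inverse ((x \<bullet> x) ^ n)))) (at x)"
    by (intro Deriv.has_derivative_inverse has_derivative_power has_derivative_inner has_derivative_ident) (use x in simp)
  have "((\<lambda>y. Re (h y)) has_derivative (\<lambda>v. Re (h' v))) (at x)"
    by (rule bounded_linear.has_derivative[OF bounded_linear_Re h])
  from has_derivative_mult[OF this q]
  have "(radial_Re n h has_derivative (\<lambda>v. Re (h x) * - (inverse ((x \<bullet> x) ^ n) * (of_nat n * (x \<bullet> v + v \<bullet> x) * (x \<bullet> x) ^ (n - 1)) * inverse ((x \<bullet> x) ^ n))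
      + Re (h' v) * inverse ((x \<bullet> x) ^ n))) (at x)"
    unfolding radial_Re_def .
  from DD_eqI[OF this] show ?thesis
    using A by (simp add: lie_def hA radial_Re_def inner_commute[of "A x" x])
qed

abbreviation z_of :: "C2 \<Rightarrow> complex" where "z_of x \<equiv> fst x"
abbreviation wbar_of :: "C2 \<Rightarrow> complex" where "wbar_of x \<equiv> cnj (snd x)"

lemma frame_coords:
  "z_of (mult_i x) = \<i> * z_of x" "wbar_of (mult_i x) = - \<i> * wbar_of x"
  "z_of (mult_j x) = wbar_of x" "wbar_of (mult_j x) = - z_of x"
  "z_of (mult_k x) = \<i> * wbar_of x" "wbar_of (mult_k x) = \<i> * z_of x"
  by (simp_all add: mult_i_def mult_j_def mult_k_def)

lemma has_derivative_z_of: "(z_of has_derivative z_of) (at x)"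
  and has_derivative_wbar_of: "(wbar_of has_derivative wbar_of) (at x)"
  by (auto intro!: bounded_linear_imp_has_derivative bounded_linear_fst
      bounded_linear_compose[OF bounded_linear_cnj] bounded_linear_snd)

text \<open>By homogeneity the point may be moved to radius 1/2, inside the ball, where continuity keeps \<open>G\<^sup>2\<close>
bounded below.\<close>

lemma integral_square_pos:
  assumes G: "radial_direction G" and x0: "x0 \<noteq> 0" "G x0 \<noteq> 0"
  shows "(LINT x|ball_measure. G x ^ 2) > 0"
proof -
  define y where "y = (1 / (2 * norm x0)) *\<^sub>R x0"
  have y: "G y = G x0" "norm y = 1/2" unfolding y_def using x0 by (auto intro: radial_scale[OF G])
  have y0: "y \<in> - {0}" using y(2) by auto
  have "continuous_on (- {0}) (\<lambda>x. G x ^ 2)"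
    by (intro continuous_intros smooth_on_continuous[OF radial_smooth[OF G]])
  then have "isCont (\<lambda>x. G x ^ 2) y" using y0 open_punctured continuous_on_eq_continuous_at by blast
  moreover define s where "s = G x0 ^ 2 / 2"
  moreover have s: "s > 0" "G y ^ 2 > s" using x0 y by (simp_all add: s_def)
  ultimately obtain r where r: "r > 0" "\<And>x. dist x y < r \<Longrightarrow> dist (G x ^ 2) (G y ^ 2) < G y ^ 2 - s"
    unfolding continuous_at_eps_delta by (metis diff_gt_0_iff_gt)
  define q where "q = min r (1/4)"
  have q: "q > 0" using r by (simp add: q_def)
  have sub: "ball y q \<subseteq> punctured_ball"
  proof
    fix x assume "x \<in> ball y q"
    then have d: "norm (x - y) < 1/4" by (simp add: q_def dist_norm norm_minus_commute)
    have "norm x \<le> norm (x - y) + norm y" "norm y \<le> norm (x - y) + norm x"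
      using norm_triangle_sub[of x y] norm_triangle_sub[of y x] by (simp_all add: norm_minus_commute)
    then have "norm x < 1" "norm x > 0" using d y(2) by linarith+
    then show "x \<in> punctured_ball" by (simp add: mem_punctured_ball)
  qed
  have big: "s \<le> G x ^ 2" if "x \<in> ball y q" for x
    using r(2)[of x] that by (simp add: q_def dist_real_def dist_commute)
  have fin: "emeasure lborel (ball y q) < \<infinity>" by (rule emeasure_bounded_finite) simp
  have sets: "ball y q \<in> sets ball_measure" using sub by (simp add: ball_measure_def sets_restrict_space_iff)
  have em: "measure ball_measure (ball y q) = measure lborel (ball y q)"
    using sub by (simp add: ball_measure_def measure_restrict_space)
  have "0 < s * measure lborel (ball y q)"
    using s content_ball_pos[OF q, of y] by simp
  also have "\<dots> = (LINT x|ball_measure. s * indicator (ball y q) x)"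
    using sets em by simp
  also have "\<dots> \<le> (LINT x|ball_measure. G x ^ 2)"
  proof (rule integral_mono_AE)
    show "integrable ball_measure (\<lambda>x. s * indicator (ball y q) x)"
      using sets finite_measure.emeasure_finite[OF finite_measure_ball, of "ball y q"]
      by (intro integrable_mult_right integrable_real_indicator) (auto simp: top.not_eq_extremum)
    show "integrable ball_measure (\<lambda>x. G x ^ 2)" by (intro integrable_radial radial_power G)
    show "AE x in ball_measure. s * indicator (ball y q) x \<le> G x ^ 2"
      using big by (intro AE_I2) (simp add: indicator_def)
  qed
  finally show ?thesis .
qed

lemma lie_lie_radial_Re:
  assumes f: "radial_direction (radial_Re n h)" and B: "bounded_linear B"
    and e: "\<And>y. y \<noteq> 0 \<Longrightarrow> lie B (radial_Re n h) y = radial_Re n g y"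
    and g: "(g has_derivative g') (at x)" "g' (A x) = r x" and A: "x \<bullet> A x = 0" and x: "x \<noteq> 0"
  shows "lie A (lie B (radial_Re n h)) x = radial_Re n r x"
proof -
  have "lie A (lie B (radial_Re n h)) x = lie A (radial_Re n g) x"
    by (rule lie_cong[OF smooth_on_lie[OF radial_smooth[OF f] B] e x])
  also have "\<dots> = radial_Re n r x"
    by (rule lie_radial_Re[where h=g and h'=g' and g=r and x=x and A=A, OF g A x])
  finally show ?thesis .
qed

definition monomial :: "complex \<Rightarrow> nat \<Rightarrow> nat \<Rightarrow> C2 \<Rightarrow> complex" where
  "monomial c m n x = c * (z_of x ^ m * wbar_of x ^ n)"

lemma smooth_monomial: "smooth_on UNIV (monomial c m n)"
  unfolding monomial_def[abs_def]
  by (intro smooth_on_mult smooth_on_power smooth_on_const smooth_on_bounded_linear open_UNIV bounded_linear_fst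
      bounded_linear_compose[OF bounded_linear_cnj] bounded_linear_snd)

lemma has_derivative_monomial:
  "(monomial c m n has_derivative
    (\<lambda>v. c * (z_of x ^ m * (of_nat n * wbar_of v * wbar_of x ^ (n - 1)) + of_nat m * z_of v * z_of x ^ (m - 1) * wbar_of x ^ n))) (at x)"
  unfolding monomial_def[abs_def]
  by (intro has_derivative_mult_right has_derivative_mult has_derivative_power has_derivative_z_of has_derivative_wbar_of)

text \<open>For \<open>G = Re z\<^sup>2 / |x|\<^sup>2\<close> the linear part \<open>ma_lin G\<close> is \<open>-G\<close>, and the second derivative along \<open>ix\<close> is \<open>-4 G\<close>.
Integrating the derivative of \<open>G \<cdot> t\<close> by parts, with \<open>t\<close> the derivative of \<open>G\<close> along \<open>ix\<close>, shows that
\<open>t\<^sup>2\<close> and \<open>4 G\<^sup>2\<close> have the same integral; this beats the negative term \<open>- G\<^sup>2 / 3\<close>.\<close>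

lemma increasing_direction:
  obtains G D where "radial_direction G" "D > 0" "has_second_derivative (\<lambda>e. iso_quotient (perturbed_sphere G e)) D 0"
proof -
  note d = has_derivative_monomial
  define G where "G = radial_Re 1 (monomial 1 2 0)"
  have G: "radial_direction G"
    unfolding G_def by (rule radial_radial_Re[OF smooth_monomial]) (simp add: monomial_def scaleR_conv_of_real power_mult_distrib)
  note ll = lie_lie_radial_Re[OF G[unfolded G_def], folded G_def]
  note calc = frame_coords monomial_def power2_eq_square algebra_simps
  have li: "lie mult_i G x = radial_Re 1 (monomial (2 * \<i>) 2 0) x" if "x \<noteq> 0" for x
    unfolding G_def by (rule lie_radial_Re[OF d _ _ that]) (simp_all add: calc)
  have lj: "lie mult_j G x = radial_Re 1 (monomial 2 1 1) x" if "x \<noteq> 0" for x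
    unfolding G_def by (rule lie_radial_Re[OF d _ _ that]) (simp_all add: calc)
  have lk: "lie mult_k G x = radial_Re 1 (monomial (2 * \<i>) 1 1) x" if "x \<noteq> 0" for x
    unfolding G_def by (rule lie_radial_Re[OF d _ _ that]) (simp_all add: calc)
  have lii: "lie mult_i (lie mult_i G) x = radial_Re 1 (monomial (-4) 2 0) x" if "x \<noteq> 0" for x
    by (rule ll[OF bounded_linear_mult_i li d _ _ that]) (simp_all add: calc)
  have lji: "lie mult_j (lie mult_i G) x = radial_Re 1 (monomial (4 * \<i>) 1 1) x" if "x \<noteq> 0" for x
    by (rule ll[OF bounded_linear_mult_i li d _ _ that]) (simp_all add: calc)
  have lki: "lie mult_k (lie mult_i G) x = radial_Re 1 (monomial (- 4) 1 1) x" if "x \<noteq> 0" for x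
    by (rule ll[OF bounded_linear_mult_i li d _ _ that]) (simp_all add: calc)
  have ljj: "lie mult_j (lie mult_j G) x = radial_Re 1 (\<lambda>x. 2 * (wbar_of x ^ 2 - z_of x ^ 2)) x" if "x \<noteq> 0" for x
    by (rule ll[OF bounded_linear_mult_j lj d _ _ that]) (simp_all add: calc)
  have lkk: "lie mult_k (lie mult_k G) x = radial_Re 1 (\<lambda>x. - 2 * (wbar_of x ^ 2 + z_of x ^ 2)) x" if "x \<noteq> 0" for x
    by (rule ll[OF bounded_linear_mult_k lk d _ _ that]) (simp_all add: calc)
  have m1: "ma_lin G x = - G x" if "x \<noteq> 0" for x
  proof -
    have "lie mult_j (lie mult_j G) x + lie mult_k (lie mult_k G) x = - 4 * G x"
      unfolding ljj[OF that] lkk[OF that] unfolding radial_Re_def G_def monomial_def distrib_right[symmetric] by simp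
    then show ?thesis unfolding ma_lin_def by simp
  qed
  have I: "(LINT x|ball_measure. G x) = 0"
    using integral_ma_lin[OF G] integral_ball_measure_cong[of "ma_lin G" "\<lambda>x. - G x"] m1 by simp
  define t where "t = lie mult_i G"
  have rt: "radial_direction t" unfolding t_def by (rule radial_lie[OF G bounded_linear_mult_i])
  have m2: "ma_quad G x \<ge> t x ^ 2 / 4" if "x \<noteq> 0" for x
  proof -
    have "lie mult_k G x * lie mult_j (lie mult_i G) x - lie mult_j G x * lie mult_k (lie mult_i G) x
       = 2 * (lie mult_k G x)\<^sup>2 + 2 * (lie mult_j G x)\<^sup>2"
      unfolding lji[OF that] lki[OF that] lj[OF that] lk[OF that]
      by (simp add: radial_Re_def monomial_def power2_eq_square algebra_simps)
    then show ?thesis unfolding ma_quad_def t_def by simp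
  qed
  have tt: "(LINT x|ball_measure. t x ^ 2 - 4 * G x ^ 2) = 0"
  proof -
    have "(LINT x|ball_measure. lie mult_i (\<lambda>x. G x * t x) x) = 0"
      by (rule integral_lie_eq_0[OF radial_mult[OF G rt]]) simp
    moreover have "lie mult_i (\<lambda>x. G x * t x) x = t x ^ 2 - 4 * G x ^ 2" if "x \<noteq> 0" for x
    proof -
      have x: "x \<in> - {0}" using that by simp
      have "((\<lambda>x. G x * t x) has_derivative (\<lambda>v. G x * DD t x v + DD G x v * t x)) (at x)"
        by (intro has_derivative_mult smooth_on_has_derivative[OF radial_smooth[OF G] x] smooth_on_has_derivative[OF radial_smooth[OF rt] x])
      then have "lie mult_i (\<lambda>x. G x * t x) x = G x * lie mult_i t x + lie mult_i G x * t x"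
        unfolding lie_def by (simp add: DD_eqI)
      moreover have "lie mult_i t x = - 4 * G x"
        using lii[OF that] by (simp add: t_def radial_Re_def monomial_def G_def)
      ultimately show ?thesis by (simp add: power2_eq_square flip: t_def)
    qed
    ultimately show ?thesis
      using integral_ball_measure_cong[of "lie mult_i (\<lambda>x. G x * t x)" "\<lambda>x. t x ^ 2 - 4 * G x ^ 2"] by simp
  qed
  obtain k where k: "k > 0" "has_second_derivative (\<lambda>e. iso_quotient (perturbed_sphere G e))
    (k * (LINT x|ball_measure. second_variation_density G x)) 0"
    using second_variation[OF G I] by blast
  have "0 < (2/3) * (LINT x|ball_measure. G x ^ 2)"
    using integral_square_pos[OF G, of e1] by (simp add: G_def radial_Re_def monomial_def e1_def prod_eq_iff)
  also have "\<dots> = (LINT x|ball_measure. (2/3) * G x ^ 2) + (1/4) * (LINT x|ball_measure. t x ^ 2 - 4 * G x ^ 2)"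
    unfolding tt by simp
  also have "\<dots> = (LINT x|ball_measure. (2/3) * G x ^ 2 + (1/4) * (t x ^ 2 - 4 * G x ^ 2))"
    using integrable_radial[OF radial_power[OF G, of 2]]
      integrable_radial[OF radial_diff[OF radial_power[OF rt, of 2] radial_cmult[OF radial_power[OF G, of 2], of 4]]]
    by (subst Bochner_Integration.integral_add) (simp_all only: integrable_mult_right integral_mult_right_zero)
  also have "\<dots> \<le> (LINT x|ball_measure. second_variation_density G x)"
  proof (rule integral_mono_AE)
    show "integrable ball_measure (\<lambda>x. (2/3) * G x ^ 2 + (1/4) * (t x ^ 2 - 4 * G x ^ 2))"
      by (intro integrable_radial radial_add radial_cmult radial_diff radial_power G rt)
    show "integrable ball_measure (second_variation_density G)"
      unfolding second_variation_density_def[abs_def]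
      by (intro integrable_radial radial_add radial_cmult radial_diff radial_mult[OF G] radial_power radial_ma_lin radial_ma_quad G)
    show "AE x in ball_measure. (2/3) * G x ^ 2 + (1/4) * (t x ^ 2 - 4 * G x ^ 2) \<le> second_variation_density G x"
    proof (rule AE_ball_measure)
      fix x :: C2 assume x: "x \<noteq> 0"
      show "(2/3) * G x ^ 2 + (1/4) * (t x ^ 2 - 4 * G x ^ 2) \<le> second_variation_density G x"
        using m2[OF x] unfolding second_variation_density_def m1[OF x] by (simp add: power2_eq_square field_simps)
    qed
  qed
  finally show thesis using that[OF G _ k(2)] k(1) by simp
qed

text \<open>For \<open>G = Re (z\<^sup>2 w\<^sup>*\<^sup>2) / |x|\<^sup>4\<close> the linear part \<open>ma_lin G\<close> is \<open>-6 G\<close>. As \<open>G\<close> is invariant under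
multiplication by unit complex numbers, its derivative along \<open>ix\<close> and hence the quadratic part vanish.\<close>

lemma decreasing_direction:
  obtains G D where "radial_direction G" "D < 0" "has_second_derivative (\<lambda>e. iso_quotient (perturbed_sphere G e)) D 0"
proof -
  note d = has_derivative_monomial
  define G where "G = radial_Re 2 (monomial 1 2 2)"
  have G: "radial_direction G"
    unfolding G_def by (rule radial_radial_Re[OF smooth_monomial])
      (simp add: monomial_def scaleR_conv_of_real power_mult_distrib power4_eq_xxxx power2_eq_square mult_ac)
  note ll = lie_lie_radial_Re[OF G[unfolded G_def], folded G_def]
  note calc = frame_coords monomial_def power2_eq_square power3_eq_cube power4_eq_xxxx algebra_simps
  have li: "lie mult_i G x = radial_Re 2 (\<lambda>x. 0) x" if "x \<noteq> 0" for x
    unfolding G_def by (rule lie_radial_Re[OF d _ _ that]) (simp_all add: calc)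
  have lj: "lie mult_j G x = radial_Re 2 (\<lambda>x. monomial 2 1 3 x + monomial (-2) 3 1 x) x" if "x \<noteq> 0" for x
    unfolding G_def by (rule lie_radial_Re[OF d _ _ that]) (simp_all add: calc)
  have lk: "lie mult_k G x = radial_Re 2 (\<lambda>x. monomial (2 * \<i>) 1 3 x + monomial (2 * \<i>) 3 1 x) x" if "x \<noteq> 0" for x
    unfolding G_def by (rule lie_radial_Re[OF d _ _ that]) (simp_all add: calc)
  have ljj: "lie mult_j (lie mult_j G) x = radial_Re 2 (\<lambda>x. 2 * wbar_of x ^ 4 + 2 * z_of x ^ 4 - 12 * (z_of x ^ 2 * wbar_of x ^ 2)) x" if "x \<noteq> 0" for x
    by (rule ll[OF bounded_linear_mult_j lj has_derivative_add[OF d d] _ _ that]) (simp_all add: calc)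
  have lkk: "lie mult_k (lie mult_k G) x = radial_Re 2 (\<lambda>x. - 2 * wbar_of x ^ 4 - 2 * z_of x ^ 4 - 12 * (z_of x ^ 2 * wbar_of x ^ 2)) x" if "x \<noteq> 0" for x
    by (rule ll[OF bounded_linear_mult_k lk has_derivative_add[OF d d] _ _ that]) (simp_all add: calc)
  have m1: "ma_lin G x = - 6 * G x" if "x \<noteq> 0" for x
  proof -
    have "lie mult_j (lie mult_j G) x + lie mult_k (lie mult_k G) x = - 24 * G x"
      unfolding ljj[OF that] lkk[OF that] unfolding radial_Re_def G_def monomial_def distrib_right[symmetric]
      by (simp add: algebra_simps)
    then show ?thesis unfolding ma_lin_def by simp
  qed
  have I: "(LINT x|ball_measure. G x) = 0"
    using integral_ma_lin[OF G] integral_ball_measure_cong[of "ma_lin G" "\<lambda>x. - 6 * G x"] m1 by simp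
  have lz: "lie A (lie mult_i G) x = 0" if "x \<noteq> 0" for A x
  proof -
    have "lie A (lie mult_i G) x = lie A (\<lambda>x. 0) x"
      by (rule lie_cong[OF smooth_on_lie[OF radial_smooth[OF G] bounded_linear_mult_i] _ that]) (simp add: li radial_Re_def)
    then show ?thesis by (simp add: lie_def)
  qed
  have m2: "ma_quad G x = 0" if "x \<noteq> 0" for x
    unfolding ma_quad_def lz[OF that] li[OF that] by (simp add: radial_Re_def)
  obtain k where k: "k > 0" "has_second_derivative (\<lambda>e. iso_quotient (perturbed_sphere G e))
    (k * (LINT x|ball_measure. second_variation_density G x)) 0"
    using second_variation[OF G I] by blast
  have "(LINT x|ball_measure. second_variation_density G x)
      = (LINT x|ball_measure. (- 16/3) * G x ^ 2)"
    by (rule integral_ball_measure_cong) (simp add: second_variation_density_def m1 m2 power2_eq_square field_simps)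
  also have "\<dots> = (- 16/3) * (LINT x|ball_measure. G x ^ 2)" by simp
  also have "\<dots> < 0"
  proof -
    have "(1, 1) \<noteq> (0 :: C2)" by (simp add: zero_prod_def)
    moreover from this have "G (1, 1) \<noteq> 0" by (simp add: G_def radial_Re_def monomial_def)
    ultimately show ?thesis using integral_square_pos[OF G, of "(1, 1)"] by linarith
  qed
  finally have "k * (LINT x|ball_measure. second_variation_density G x) < 0"
    using k(1) by (simp add: mult_pos_neg)
  then show thesis using that[OF G _ k(2)] by blast
qed

theorem theorem17:
  shows "unit_sphere_saddle_point iso_quotient"
  unfolding unit_sphere_saddle_point_def
proof (intro conjI allI impI)
  fix G assume "radial_direction G"
  then show "((\<lambda>\<epsilon>. iso_quotient (perturbed_sphere G \<epsilon>)) has_real_derivative 0) (at 0)"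
    by (rule first_variation)
next
  show "\<exists>G D. radial_direction G \<and> D > 0 \<and> has_second_derivative (\<lambda>\<epsilon>. iso_quotient (perturbed_sphere G \<epsilon>)) D 0"
    using increasing_direction by blast
next
  show "\<exists>G D. radial_direction G \<and> D < 0 \<and> has_second_derivative (\<lambda>\<epsilon>. iso_quotient (perturbed_sphere G \<epsilon>)) D 0"
    using decreasing_direction by blast
qed

end
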